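(* Let $s\geq 2$, $d'\geq 1$ and $n\geq 3$ be integers, and let $A_1,\ldots,A_n$ be $n$ nontrivial partitions of $sd'$ of the form $$A_1=[sa_{11},\ldots,sa_{1r_1}],\quad A_2=[sa_{21},\ldots,sa_{2r_2}],\quad A_k=[a_{k1},\ldots,a_{kr_k}]\quad (3\leq k\leq n),$$ where all $a_{kl}\geq 1$ are integers, satisfying the Riemann-Hurwitz condition $\sum_{k=1}^{n}r_k=s(n-2)d'+2$. Then the following are equivalent: (1) There exists a branched cover $f:S^2\to S^2$ of degree $sd'$ with branching data $\mathcal{D}=\{A_1,\ldots,A_n\}$. (2) For each $3\leq k\leq n$ there is a decomposition of $A_k$ into $s$ partitions $A_k^{1},\ldots,A_k^{s}$ of $d'$ such that there exists a branched cover $g:S^2\to S^2$ of degree $d'$ whose branching data consists of $[a_{11},\ldots,a_{1r_1}]$, $[a_{21},\ldots,a_{2r_2}]$ and all the partitions $A_k^{j}$ ($3\leq k\leq n$, $1\leq j\leq s$).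
   Context: A branched cover $f:Y\to X$ between compact, connected, orientable surfaces is a surjective map that is locally modeled on the power maps $\mathbb{C}\ni z\mapsto z^m\in\mathbb{C}$ for positive integers $m$; $m$ is the local degree at the preimage point corresponding to $0$. A point of $X$ having a preimage of local degree greater than $1$ is a branch point; there are finitely many of them. Removing the branch points and their preimages gives a genuine covering map, whose degree $d$ is called the degree of $f$. A partition of $d$ is a multiset $[b_1,\ldots,b_r]$ of positive integers with sum $d$; it is nontrivial if at least one part is greater than $1$. The local degrees at the preimages of each branch point form a nontrivial partition of $d$. If $f$ has $n$ branch points, with corresponding partitions $A_1,\ldots,A_n$, then $\{A_1,\ldots,A_n\}$ (counted with multiplicity) is the branching data of $f$. When a list of partitions prescribing branching data contains trivial partitions $[1,\ldots,1]$, these correspond to non-branch points and are disregarded. Decomposing a partition $A$ of $md$ into $m$ partitions of $d$ means writing the multiset $A$ as the multiset union of $m$ multisets, each with sum $d$. *)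

theory Defs
  imports "HOL-Analysis.Analysis" "HOL-Library.Multiset"
begin

text \<open>
  Surfaces are subsets of topological spaces, with the subspace topology; a map \<open>Y \<rightarrow> X\<close> is a
  total function of which only the restriction to \<open>Y\<close> matters.
\<close>

abbreviation S2 :: "(real ^ 3) set" where
  "S2 \<equiv> sphere 0 1"

text \<open>
  Near \<open>y\<close> the map \<open>f\<close> is \<open>z \<mapsto> z ^ m\<close> in charts \<open>\<phi>\<close> and \<open>\<psi>\<close> centred at \<open>y\<close> and \<open>f y\<close>. The charts
  are only required to be homeomorphisms: branched covers are topological objects here, and no
  orientation or complex structure is to be respected.
\<close>

definition power_model_at ::
    "'a::topological_space set \<Rightarrow> 'b::topological_space set \<Rightarrow> ('a \<Rightarrow> 'b) \<Rightarrow> 'a \<Rightarrow> nat \<Rightarrow> bool" where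
  "power_model_at Y X f y m \<longleftrightarrow>
     m > 0 \<and>
     (\<exists>U V D E (\<phi> :: 'a \<Rightarrow> complex) \<phi>' (\<psi> :: 'b \<Rightarrow> complex) \<psi>'.
        openin (top_of_set Y) U \<and> y \<in> U \<and> openin (top_of_set X) V \<and> f ` U \<subseteq> V \<and>
        open D \<and> homeomorphism U D \<phi> \<phi>' \<and> \<phi> y = 0 \<and>
        open E \<and> homeomorphism V E \<psi> \<psi>' \<and> \<psi> (f y) = 0 \<and>
        (\<forall>u\<in>U. \<psi> (f u) = \<phi> u ^ m))"

definition branched_cover ::
    "'a::topological_space set \<Rightarrow> 'b::topological_space set \<Rightarrow> ('a \<Rightarrow> 'b) \<Rightarrow> bool" where
  "branched_cover Y X f \<longleftrightarrow> f ` Y = X \<and> (\<forall>y\<in>Y. \<exists>m. power_model_at Y X f y m)"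

text \<open>
  The exponent is determined by \<open>f\<close> and \<open>y\<close>: it is the number of preimages in a small
  neighbourhood of \<open>y\<close> of any point close to, but different from, \<open>f y\<close>.
\<close>

definition local_degree ::
    "'a::topological_space set \<Rightarrow> 'b::topological_space set \<Rightarrow> ('a \<Rightarrow> 'b) \<Rightarrow> 'a \<Rightarrow> nat" where
  "local_degree Y X f y = (THE m. power_model_at Y X f y m)"

definition branch_points ::
    "'a::topological_space set \<Rightarrow> 'b::topological_space set \<Rightarrow> ('a \<Rightarrow> 'b) \<Rightarrow> 'b set" where
  "branch_points Y X f = {x \<in> X. \<exists>y\<in>Y. f y = x \<and> local_degree Y X f y > 1}"

text \<open>
  The number of sheets of the covering map obtained by removing the branch points and their
  preimages.
\<close>

definition has_degree ::
    "'a::topological_space set \<Rightarrow> 'b::topological_space set \<Rightarrow> ('a \<Rightarrow> 'b) \<Rightarrow> nat \<Rightarrow> bool" where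
  "has_degree Y X f d \<longleftrightarrow>
     (\<forall>x \<in> X - branch_points Y X f. finite {y \<in> Y. f y = x} \<and> card {y \<in> Y. f y = x} = d)"

text \<open>
  For a branched cover with compact domain, all fibres and the set of branch points are finite, so
  that \<open>mset_set\<close> (which is empty on infinite sets) loses nothing below.
\<close>

definition local_degrees_over ::
    "'a::topological_space set \<Rightarrow> 'b::topological_space set \<Rightarrow> ('a \<Rightarrow> 'b) \<Rightarrow> 'b \<Rightarrow> nat multiset" where
  "local_degrees_over Y X f x = image_mset (local_degree Y X f) (mset_set {y \<in> Y. f y = x})"

definition branching_data ::
    "'a::topological_space set \<Rightarrow> 'b::topological_space set \<Rightarrow> ('a \<Rightarrow> 'b) \<Rightarrow> nat multiset multiset" where
  "branching_data Y X f = image_mset (local_degrees_over Y X f) (mset_set (branch_points Y X f))"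

definition partition_of :: "nat \<Rightarrow> nat multiset \<Rightarrow> bool" where
  "partition_of d A \<longleftrightarrow> (\<forall>b \<in># A. b > 0) \<and> sum_mset A = d"

definition nontrivial :: "nat multiset \<Rightarrow> bool" where
  "nontrivial A \<longleftrightarrow> (\<exists>b \<in># A. b > 1)"

text \<open>
  A decomposition of \<open>A\<close> into the \<open>m\<close> partitions \<open>P 1, \<dots>, P m\<close> of \<open>d\<close>; the sum is the multiset
  union.
\<close>

definition decomposition :: "nat \<Rightarrow> nat \<Rightarrow> nat multiset \<Rightarrow> (nat \<Rightarrow> nat multiset) \<Rightarrow> bool" where
  "decomposition m d A P \<longleftrightarrow> (\<forall>j\<in>{1..m}. partition_of d (P j)) \<and> A = (\<Sum>j\<in>{1..m}. P j)"

text \<open>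
  Trivial partitions in a list prescribing branching data correspond to non-branch points and are
  disregarded.
\<close>

definition realizes ::
    "'a::topological_space set \<Rightarrow> 'b::topological_space set \<Rightarrow> ('a \<Rightarrow> 'b) \<Rightarrow> nat
      \<Rightarrow> nat multiset multiset \<Rightarrow> bool" where
  "realizes Y X f d \<D> \<longleftrightarrow>
     branched_cover Y X f \<and> has_degree Y X f d \<and>
     branching_data Y X f = filter_mset nontrivial \<D>"

end

theory Submission
  imports Defs
begin

text \<open>
  The \<open>s\<close>-fold power map \<open>h\<close> of the sphere, \<open>z \<mapsto> z ^ s\<close>, is a branched cover that is totally branched
  over \<open>0\<close> and \<open>\<infinity>\<close>, which it fixes, and unbranched elsewhere. Both conditions of the theorem say that there is a branched
  cover of the form \<open>f = h \<circ> g\<close> in which \<open>0\<close> and \<open>\<infinity>\<close> carry the first two partitions. In such a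
  composite the local degrees over \<open>0\<close> and \<open>\<infinity>\<close> are those of \<open>g\<close> multiplied by \<open>s\<close>, while the partition over
  any other point is the union of the partitions of \<open>g\<close> over its \<open>s\<close> preimages under \<open>h\<close>
  (\<open>local_degrees_over_sphere_power\<close>).

  Given \<open>g\<close>, a coordinate on the target of \<open>g\<close> is chosen in which the prescribed points form the fibres
  of \<open>h\<close>. This is possible because homeomorphisms of the plane move any tuple of distinct points to any other
  (\<open>sphere_coordinate_through_points\<close>).

  Given \<open>f\<close>, the factor \<open>g\<close> is an \<open>s\<close>-th root of \<open>f\<close> (\<open>sphere_power_factorization\<close>). Near each
  zero or pole the function \<open>f\<close> is, up to a change of charts, a power with exponent divisible by \<open>s\<close>, so that
  local roots exist; they can be glued because the sphere is simply connected, which in coordinates is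
  the statement \<open>punctured_plane_root\<close> about the punctured plane. The degree of \<open>g\<close> is controlled by the
  constancy of the number of preimages counted with local degree (\<open>branched_map_fibre_count_constant\<close>).

  Branched covers are topological here, so the local charts are arbitrary homeomorphisms. The fact that
  makes them manageable is \<open>power_germ_if_power_model_at\<close>: the exponent of a power model does not depend on
  the chart in the target, because a homeomorphism fixing \<open>0\<close> has winding number \<open>1\<close> or \<open>-1\<close> around \<open>0\<close> and therefore
  lifts through \<open>z \<mapsto> z ^ m\<close> (\<open>lift_through_power\<close>).
\<close>

section \<open>Logarithms on a punctured disc\<close>

text \<open>
  The values of such a function differ by integer multiples of \<open>2 \<pi> \<i>\<close>, so its range is discrete.
\<close>

lemma constant_on_if_exp_constant:
  fixes f :: "'a::topological_space \<Rightarrow> complex"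
  assumes "connected S" "continuous_on S f"
    and "\<And>x y. x \<in> S \<Longrightarrow> y \<in> S \<Longrightarrow> exp (f x) = exp (f y)"
  shows "f constant_on S"
proof (rule continuous_discrete_range_constant[OF assms(1,2)])
  fix x assume x: "x \<in> S"
  have "2 * pi \<le> norm (f y - f x)" if y: "y \<in> S" "f y \<noteq> f x" for y
  proof -
    obtain n :: int where n: "f y = f x + (of_int (2 * n) * pi) * \<i>"
      using assms(3)[OF y(1) x] unfolding exp_eq by blast
    with y have "n \<noteq> 0" by auto
    then have "1 \<le> \<bar>real_of_int n\<bar>" by linarith
    then show ?thesis using n by (simp add: norm_mult)
  qed
  then show "\<exists>e>0. \<forall>y. y \<in> S \<and> f y \<noteq> f x \<longrightarrow> e \<le> norm (f y - f x)"
    by (metis pi_gt_zero zero_less_mult_iff zero_less_numeral)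
qed

lemma periodic_eq_if_exp_eq:
  fixes M :: "complex \<Rightarrow> complex"
  assumes per: "\<And>w. Re w < c \<Longrightarrow> M (w + of_real (2 * pi) * \<i>) = M w"
    and "exp w = exp w'" "Re w < c"
  shows "M w = M w'"
proof -
  have nat: "M (w + of_nat n * (of_real (2 * pi) * \<i>)) = M w" if "Re w < c" for w and n :: nat
  proof (induction n)
    case (Suc n)
    have "Re (w + of_nat n * (of_real (2 * pi) * \<i>)) < c" using that by simp
    from per[OF this] Suc show ?case by (simp add: algebra_simps)
  qed simp
  obtain k :: int where k: "w = w' + (of_int (2 * k) * pi) * \<i>"
    using assms(2) unfolding exp_eq by blast
  show ?thesis
  proof (cases "k \<ge> 0")
    case True
    then have "w = w' + of_nat (nat k) * (of_real (2 * pi) * \<i>)" using k by simp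
    moreover have "Re w' < c" using assms(3) k by simp
    ultimately show ?thesis using nat by metis
  next
    case False
    then have "w' = w + of_nat (nat (- k)) * (of_real (2 * pi) * \<i>)"
      using k by (simp add: algebra_simps)
    then show ?thesis using nat[OF assms(3)] by metis
  qed
qed

text \<open>
  A nonvanishing function on the punctured disc becomes a function on a half-plane after the
  substitution \<open>z = exp w\<close>, and there it has a logarithm \<open>l\<close>. The increment of \<open>l\<close> along the period
  \<open>2 \<pi> \<i>\<close> of \<open>exp\<close> is a constant multiple \<open>k\<close> of that period, namely the winding number; once \<open>k w\<close> is
  subtracted, \<open>l\<close> is periodic and descends to the punctured disc again.
\<close>

lemma punctured_ball_logarithm:
  fixes F :: "complex \<Rightarrow> complex"
  assumes "continuous_on (ball 0 r - {0}) F"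
    and nz: "\<And>z. z \<in> ball 0 r - {0} \<Longrightarrow> F z \<noteq> 0"
  obtains k :: int and L where "continuous_on (ball 0 r - {0}) L"
    "\<And>z. z \<in> ball 0 r - {0} \<Longrightarrow> F z = z powi k * exp (L z)"
proof (cases "r > 0")
  case False
  then have "ball (0::complex) r - {0} = {}" by simp
  then show ?thesis using that[where L = "\<lambda>_. 0" and k = 0] by (metis continuous_on_empty empty_iff)
next
  case r: True
  let ?B = "ball (0::complex) r - {0}"
  define H where "H = {w::complex. Re w < ln r}"
  let ?p = "of_real (2 * pi) * \<i> :: complex"
  have "exp (Re w) < r" if "w \<in> H" for w
    using that r unfolding H_def by (metis exp_less_mono exp_ln mem_Collect_eq)
  then have expH: "exp ` H \<subseteq> ?B" by auto
  have LnH: "Ln z \<in> H" if "z \<in> ?B" for z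
    using that r unfolding H_def by auto
  have "convex H" unfolding H_def by (rule convex_halfspace_Re_lt)
  have "open H" unfolding H_def by (rule open_halfspace_Re_lt)
  have "continuous_on H (\<lambda>w. F (exp w))"
    by (rule continuous_on_compose2[OF assms(1) _ expH]) (intro continuous_intros)
  moreover have "\<And>w. w \<in> H \<Longrightarrow> F (exp w) \<noteq> 0" using nz expH by blast
  ultimately obtain l where l: "continuous_on H l" "\<And>w. w \<in> H \<Longrightarrow> F (exp w) = exp (l w)"
    using continuous_logarithm_on_contractible \<open>convex H\<close> convex_imp_contractible by metis
  have shift: "w + ?p \<in> H" if "w \<in> H" for w using that unfolding H_def by simp
  have exp_shift: "exp (w + ?p) = exp w" for w
    by (simp add: exp_add)
  let ?d = "\<lambda>w. l (w + ?p) - l w"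
  have expd: "exp (?d w) = 1" if "w \<in> H" for w
    using l(2)[OF that] l(2)[OF shift[OF that]] exp_shift[of w] by (simp add: exp_diff)
  have "continuous_on H ?d"
    using shift by (auto intro!: continuous_intros l(1) continuous_on_compose2[OF l(1)])
  then have "?d constant_on H"
    by (rule constant_on_if_exp_constant[OF convex_connected[OF \<open>convex H\<close>]]) (simp only: expd)
  then obtain c where c: "\<And>w. w \<in> H \<Longrightarrow> ?d w = c" unfolding constant_on_def by blast
  have H0: "Ln (of_real (r / 2)) \<in> H" using r by (intro LnH) auto
  then have "exp c = 1" using c expd by metis
  then obtain k :: int where k: "c = of_int k * ?p"
    using exp_eq[of c 0] by auto
  define M where "M w = l w - of_int k * w" for w
  have M: "continuous_on H M" unfolding M_def by (intro continuous_intros l(1))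
  have perM: "M (w + ?p) = M w" if "w \<in> H" for w
    using c[OF that] k unfolding M_def by (simp add: algebra_simps)
  have M_eq: "M w = M w'" if "exp w = exp w'" "w \<in> H" for w w'
    using periodic_eq_if_exp_eq[of "ln r" M w w'] perM that unfolding H_def by auto
  show ?thesis
  proof
    \<comment> \<open>Across the cut of \<open>Ln\<close> another branch of the logarithm gives the same value of \<open>M\<close>.\<close>
    have "isCont (\<lambda>z. M (Ln z)) z" if z: "z \<in> ?B" for z
    proof (cases "z \<in> \<real>\<^sub>\<le>\<^sub>0")
      case False
      then have "isCont Ln z" by (intro continuous_intros) auto
      moreover have "isCont M (Ln z)"
        using M \<open>open H\<close> LnH[OF z] continuous_on_eq_continuous_at by blast
      ultimately show ?thesis by (rule isCont_o2)
    next
      case True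
      then have nz: "- z \<notin> \<real>\<^sub>\<le>\<^sub>0" using z by (auto simp: complex_nonpos_Reals_iff complex_eq_iff)
      have iH: "Ln (- z) + \<i> * pi \<in> H" if "z \<in> ?B" for z
        using that r unfolding H_def by auto
      have "isCont (\<lambda>z. Ln (- z) + \<i> * pi) z" using nz by (intro continuous_intros) auto
      moreover have "isCont M (Ln (- z) + \<i> * pi)"
        using M \<open>open H\<close> iH[OF z] continuous_on_eq_continuous_at by blast
      ultimately have "isCont (\<lambda>z. M (Ln (- z) + \<i> * pi)) z" by (rule isCont_o2)
      moreover have "\<forall>\<^sub>F u in nhds z. M (Ln (- u) + \<i> * pi) = M (Ln u)"
      proof -
        have "open ?B" by auto
        then have "\<forall>\<^sub>F u in nhds z. u \<in> ?B" using z eventually_nhds_in_open by blast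
        then show ?thesis
        proof eventually_elim
          case (elim u)
          have "exp (Ln (- u) + \<i> * pi) = exp (Ln u)" using elim by (simp add: exp_add)
          then show ?case using M_eq iH[OF elim] by blast
        qed
      qed
      ultimately show ?thesis using isCont_cong by metis
    qed
    then show "continuous_on ?B (\<lambda>z. M (Ln z))" by (simp add: continuous_at_imp_continuous_on)
    show "F z = z powi k * exp (M (Ln z))" if z: "z \<in> ?B" for z
    proof -
      have "exp (of_int k * Ln z) = z powi k" using z
        by (metis DiffD2 exp_Ln exp_power_int singletonI)
      then show ?thesis using l(2)[OF LnH[OF z]] z unfolding M_def
        by (simp add: exp_diff)
    qed
  qed
qed

text \<open>
  The exponent in the preceding lemma is unique: \<open>z powi j\<close> with \<open>j \<noteq> 0\<close> has no logarithm on a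
  circle around \<open>0\<close>, because \<open>\<i> j \<theta>\<close> does not return to its initial value after a full turn.
\<close>

lemma power_int_eq_exp_imp_zero:
  fixes j :: int
  assumes "r > 0" "continuous_on (ball 0 r - {0}) M"
    and eq: "\<And>z::complex. z \<in> ball 0 r - {0} \<Longrightarrow> z powi j = exp (M z)"
  shows "j = 0"
proof -
  define e where "e \<theta> = of_real (r / 2) * exp (\<i> * of_real \<theta>)" for \<theta> :: real
  define N where "N \<theta> = M (e \<theta>) - \<i> * of_int j * of_real \<theta>" for \<theta> :: real
  have e: "e \<theta> \<in> ball 0 r - {0}" for \<theta> using \<open>r > 0\<close> unfolding e_def by (auto simp: norm_mult)
  have "continuous_on UNIV N" unfolding N_def
    by (intro continuous_intros continuous_on_compose2[OF assms(2)])
      (use e in \<open>auto simp: e_def intro!: continuous_intros\<close>)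
  moreover have "exp (N \<theta>) = of_real (r / 2) powi j" for \<theta>
  proof -
    have "exp (\<i> * of_real \<theta>) powi j = exp (of_int j * (\<i> * of_real \<theta>))"
      by (simp add: exp_power_int)
    then have "exp (M (e \<theta>)) = of_real (r / 2) powi j * exp (of_int j * (\<i> * of_real \<theta>))"
      unfolding eq[OF e, symmetric] by (simp only: e_def power_int_mult_distrib)
    then show ?thesis unfolding N_def by (simp add: exp_diff mult_ac)
  qed
  ultimately have "N constant_on UNIV"
    by (intro constant_on_if_exp_constant) auto
  then have "N (2 * pi) = N 0" unfolding constant_on_def by auto
  moreover have "e (2 * pi) = e 0" unfolding e_def by (simp add: mult_ac flip: cis_conv_exp)
  ultimately show ?thesis unfolding N_def by simp
qed

text \<open>
  A homeomorphism \<open>\<tau>\<close> between neighbourhoods of \<open>0\<close> lifts through \<open>z \<mapsto> z ^ m\<close>. Writing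
  \<open>\<tau> z = z powi k * exp (L z)\<close>, the lift is \<open>z powi k * exp (L (z ^ m) / m)\<close>. It is injective because \<open>\<tau>\<close>
  has winding number \<open>k = 1\<close> or \<open>k = -1\<close>, which makes \<open>z powi k\<close> injective. This is what makes
  power models independent of the chart in the target.
\<close>

lemma lift_through_power:
  fixes \<tau> :: "complex \<Rightarrow> complex"
  assumes "r > 0" and cont: "continuous_on (ball 0 r) \<tau>" and inj: "inj_on \<tau> (ball 0 r)"
    and "\<tau> 0 = 0" and "m > 0"
  obtains \<rho> T where "\<rho> > 0" "continuous_on (ball 0 \<rho>) T" "inj_on T (ball 0 \<rho>)" "T 0 = 0"
    "\<And>z. z \<in> ball 0 \<rho> \<Longrightarrow> z ^ m \<in> ball 0 r \<and> T z ^ m = \<tau> (z ^ m)"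
proof -
  let ?P = "\<lambda>r. ball (0::complex) r - {0}"
  have nz: "\<tau> z \<noteq> 0" if "z \<in> ?P r" for z
  proof
    assume "\<tau> z = 0"
    then have "\<tau> z = \<tau> 0" using assms(4) by simp
    then have "z = 0" using inj_onD[OF inj, of z 0] that \<open>r > 0\<close> by auto
    then show False using that by simp
  qed
  obtain k L where L: "continuous_on (?P r) L" "\<And>z. z \<in> ?P r \<Longrightarrow> \<tau> z = z powi k * exp (L z)"
    using punctured_ball_logarithm[of r \<tau>] nz continuous_on_subset[OF cont] by (metis Diff_subset)
  obtain \<tau>' where hom: "homeomorphism (ball 0 r) (\<tau> ` ball 0 r) \<tau> \<tau>'"
    using invariance_of_domain_homeomorphism[OF open_ball cont _ inj] by auto
  have "open (\<tau> ` ball 0 r)" using invariance_of_domain[OF cont open_ball inj] .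
  moreover have "0 \<in> \<tau> ` ball 0 r" using assms(1,4) by (metis centre_in_ball image_eqI)
  ultimately obtain r' where r': "r' > 0" "ball 0 r' \<subseteq> \<tau> ` ball 0 r"
    using open_contains_ball by metis
  have cont': "continuous_on (ball 0 r') \<tau>'"
    using hom r' continuous_on_subset homeomorphism_def by metis
  have nz': "\<tau>' u \<noteq> 0" if "u \<in> ?P r'" for u
    using that homeomorphism_apply2[OF hom, of u] r' assms(4) by auto
  obtain k' L' where L': "continuous_on (?P r') L'"
    "\<And>z. z \<in> ?P r' \<Longrightarrow> \<tau>' z = z powi k' * exp (L' z)"
    using punctured_ball_logarithm[of r' \<tau>'] nz' continuous_on_subset[OF cont'] by (metis Diff_subset)
  \<comment> \<open>Composing with the inverse multiplies the two winding exponents, so they are units.\<close>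
  have "isCont \<tau> 0" using cont \<open>r > 0\<close> by (simp add: continuous_on_eq_continuous_at)
  then obtain d where d: "d > 0" "\<And>z. dist z 0 < d \<Longrightarrow> dist (\<tau> z) 0 < r'"
    unfolding continuous_at_eps_delta using \<open>r' > 0\<close> assms(4) by metis
  define q where "q = min d r"
  have q: "q > 0" "?P q \<subseteq> ?P r" using d \<open>r > 0\<close> by (auto simp: q_def)
  have tq: "\<tau> z \<in> ?P r'" if "z \<in> ?P q" for z
    using d(2)[of z] nz[of z] that q(2) by (auto simp: q_def)
  have "z powi (1 - k * k') = exp (of_int k' * L z + L' (\<tau> z))" if z: "z \<in> ?P q" for z
  proof -
    have zr: "z \<in> ?P r" using z q by blast
    have "z = \<tau>' (\<tau> z)" using homeomorphism_apply1[OF hom] zr by simp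
    also have "\<dots> = (z powi k * exp (L z)) powi k' * exp (L' (\<tau> z))"
      using L'(2)[OF tq[OF z]] L(2)[OF zr] by simp
    also have "\<dots> = z powi (k * k') * (exp (of_int k' * L z) * exp (L' (\<tau> z)))"
      by (simp add: power_int_mult_distrib power_int_mult exp_power_int)
    finally have "z / z powi (k * k') = exp (of_int k' * L z) * exp (L' (\<tau> z))"
      using z by (simp add: field_simps)
    then show ?thesis using z by (simp add: power_int_diff exp_add)
  qed
  moreover have "continuous_on (?P q) (\<lambda>z. of_int k' * L z + L' (\<tau> z))"
  proof (rule continuous_on_add)
    show "continuous_on (?P q) (\<lambda>z. of_int k' * L z)"
      using continuous_on_subset[OF L(1) q(2)] by (intro continuous_intros)
    have "continuous_on (?P q) \<tau>" using continuous_on_subset[OF cont] q(2) by blast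
    then show "continuous_on (?P q) (\<lambda>z. L' (\<tau> z))"
      by (rule continuous_on_compose2[OF L'(1)]) (intro image_subsetI tq)
  qed
  ultimately have "1 - k * k' = 0"
    by (intro power_int_eq_exp_imp_zero[OF q(1), where M = "\<lambda>z. of_int k' * L z + L' (\<tau> z)"])
  then have "k * k' = 1" by simp
  then have kcase: "k = 1 \<or> k = -1" using zmult_eq_1_iff by blast
  \<comment> \<open>In the unit disc \<open>z ^ m\<close> is at most as large as \<open>z\<close>.\<close>
  define \<rho> where "\<rho> = min 1 r"
  have pow: "z ^ m \<in> ball 0 r" if "z \<in> ball 0 \<rho>" for z :: complex
  proof -
    have "norm z ^ m \<le> norm z ^ 1" using that \<open>m > 0\<close> unfolding \<rho>_def
      by (intro power_decreasing) auto
    also have "\<dots> < r" using that unfolding \<rho>_def by simp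
    finally show ?thesis by (simp add: norm_power)
  qed
  define T where "T z = (if z = 0 then 0 else z powi k * exp (L (z ^ m) / of_nat m))" for z
  have powP: "z ^ m \<in> ?P r" if "z \<in> ?P \<rho>" for z using pow[of z] that by auto
  have Tm: "T z ^ m = \<tau> (z ^ m)" if "z \<in> ball 0 \<rho>" for z
  proof (cases "z = 0")
    case False
    then have "z ^ m \<in> ?P r" using powP that by simp
    moreover have "(z powi k) ^ m = (z ^ m) powi k"
      by (metis mult.commute power_int_power power_int_power')
    moreover have "exp (L (z ^ m) / of_nat m) ^ m = exp (L (z ^ m))"
      using \<open>m > 0\<close> by (simp flip: exp_of_nat_mult)
    ultimately show ?thesis using False L(2) by (simp add: T_def power_mult_distrib)
  qed (use \<open>m > 0\<close> assms(4) in \<open>simp add: T_def zero_power\<close>)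
  have "continuous_on (?P \<rho>) (\<lambda>z. z powi k * exp (L (z ^ m) / of_nat m))"
    by (intro continuous_intros continuous_on_compose2[OF L(1)]) (use powP \<open>m > 0\<close> in auto)
  then have c1: "continuous_on (?P \<rho>) T"
    by (rule continuous_on_eq) (simp add: T_def)
  have "isCont T z" if z: "z \<in> ball 0 \<rho>" for z
  proof (cases "z = 0")
    case False
    moreover have "open (?P \<rho>)" by (intro open_Diff) auto
    ultimately show ?thesis using c1 z continuous_on_eq_continuous_at[of "?P \<rho>" T] by auto
  next
    case True
    have "isCont (\<lambda>z. root m (norm (\<tau> (z ^ m)))) 0"
    proof -
      have "isCont \<tau> (0 ^ m)" using \<open>isCont \<tau> 0\<close> \<open>m > 0\<close> by (simp add: zero_power)
      moreover have "isCont (\<lambda>z::complex. z ^ m) 0" by (rule isCont_power[OF continuous_ident])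
      ultimately have "isCont (\<lambda>z. \<tau> (z ^ m)) 0" by (rule isCont_o2[rotated])
      then have "isCont (\<lambda>z. norm (\<tau> (z ^ m))) 0" by (rule isCont_norm)
      then show ?thesis by (rule isCont_o2[OF _ isCont_real_root])
    qed
    then have "(\<lambda>z. root m (norm (\<tau> (z ^ m)))) \<midarrow>0\<rightarrow> 0"
      unfolding isCont_def using assms(4) \<open>m > 0\<close> by (simp add: zero_power)
    moreover have "\<forall>\<^sub>F z in at 0. norm (T z) \<le> root m (norm (\<tau> (z ^ m)))"
    proof -
      have "\<forall>\<^sub>F z in at 0. z \<in> ball 0 \<rho>"
        by (rule eventually_at_in_open') (use \<open>r > 0\<close> in \<open>auto simp: \<rho>_def\<close>)
      then show ?thesis
      proof eventually_elim
        case (elim z)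
        then show ?case using \<open>m > 0\<close>
          by (simp add: norm_power real_root_power_cancel flip: Tm)
      qed
    qed
    ultimately have "T \<midarrow>0\<rightarrow> 0" by (rule Lim_null_comparison[rotated])
    then show ?thesis using True by (simp add: isCont_def T_def)
  qed
  then have "continuous_on (ball 0 \<rho>) T" by (simp add: continuous_at_imp_continuous_on)
  moreover have "inj_on T (ball 0 \<rho>)"
  proof (rule inj_onI)
    fix z w assume zw: "z \<in> ball 0 \<rho>" "w \<in> ball 0 \<rho>" "T z = T w"
    then have "\<tau> (z ^ m) = \<tau> (w ^ m)" using Tm by metis
    then have eq: "z ^ m = w ^ m" using inj_onD[OF inj] pow zw by blast
    show "z = w"
    proof (cases "z = 0")
      case True
      then show ?thesis using eq \<open>m > 0\<close> by (simp add: zero_power)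
    next
      case False
      then have "w \<noteq> 0" using eq \<open>m > 0\<close> by (metis power_eq_0_iff)
      then have "z powi k = w powi k" using zw(3) False eq unfolding T_def by simp
      then show ?thesis using kcase by auto
    qed
  qed
  ultimately show ?thesis
    using that[of \<rho> T] pow Tm \<open>r > 0\<close> by (auto simp: T_def \<rho>_def)
qed

section \<open>Charts and germs of power maps\<close>

text \<open>
  Near \<open>y\<close> the complex function \<open>F\<close> is the \<open>m\<close>-th power of a chart centred at \<open>y\<close>. Asking for such
  charts inside every neighbourhood \<open>W\<close> costs nothing, since charts can be shrunk, and makes
  the notion visibly local.
\<close>

definition power_germ ::
    "'a::topological_space set \<Rightarrow> ('a \<Rightarrow> complex) \<Rightarrow> 'a \<Rightarrow> nat \<Rightarrow> bool" where
  "power_germ Y F y m \<longleftrightarrow> y \<in> Y \<and> m > 0 \<and>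
     (\<forall>W. openin (top_of_set Y) W \<and> y \<in> W \<longrightarrow>
       (\<exists>U \<phi> \<phi>' r. openin (top_of_set Y) U \<and> y \<in> U \<and> U \<subseteq> W \<and> r > 0 \<and>
          homeomorphism U (ball 0 r) \<phi> \<phi>' \<and> \<phi> y = 0 \<and> (\<forall>u\<in>U. F u = \<phi> u ^ m)))"

definition chart_at ::
    "'a::topological_space set \<Rightarrow> 'a \<Rightarrow> 'a set \<Rightarrow> complex set \<Rightarrow> ('a \<Rightarrow> complex) \<Rightarrow> (complex \<Rightarrow> 'a) \<Rightarrow> bool" where
  "chart_at Y y U D \<phi> \<phi>' \<longleftrightarrow>
     openin (top_of_set Y) U \<and> y \<in> U \<and> open D \<and> homeomorphism U D \<phi> \<phi>' \<and> \<phi> y = 0"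

lemma chart_shrink:
  assumes "chart_at Y y U D \<phi> \<phi>'" "openin (top_of_set Y) W" "y \<in> W"
  obtains R where "R > 0" "\<And>r. 0 < r \<Longrightarrow> r \<le> R \<Longrightarrow>
    ball 0 r \<subseteq> D \<and> chart_at Y y (\<phi>' ` ball 0 r) (ball 0 r) \<phi> \<phi>' \<and> \<phi>' ` ball 0 r \<subseteq> U \<inter> W"
proof -
  have U: "openin (top_of_set Y) U" "y \<in> U" "open D" "\<phi> y = 0" and hom: "homeomorphism U D \<phi> \<phi>'"
    using assms(1) unfolding chart_at_def by auto
  have "openin (top_of_set U) (U \<inter> W)"
    using U(1) assms(2) by (meson inf_le1 openin_Int openin_imp_subset openin_subset_trans)
  then have "openin (top_of_set D) (\<phi> ` (U \<inter> W))"
    by (rule homeomorphism_imp_open_map[OF hom])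
  then have "open (\<phi> ` (U \<inter> W))" using U(3) openin_open_eq by blast
  moreover have "0 \<in> \<phi> ` (U \<inter> W)" using U assms(3) by force
  ultimately obtain R where R: "R > 0" "ball 0 R \<subseteq> \<phi> ` (U \<inter> W)"
    using open_contains_ball by metis
  show ?thesis
  proof (rule that[OF R(1)])
    fix r :: real assume r: "0 < r" "r \<le> R"
    have sub: "ball 0 r \<subseteq> \<phi> ` (U \<inter> W)" using R r by auto
    have D: "ball 0 r \<subseteq> D" using sub hom unfolding homeomorphism_def by blast
    have UW: "\<phi>' ` ball 0 r \<subseteq> U \<inter> W"
    proof (rule image_subsetI)
      fix z :: complex assume "z \<in> ball 0 r"
      then obtain u where "u \<in> U \<inter> W" "z = \<phi> u" using sub by blast
      then show "\<phi>' z \<in> U \<inter> W" using homeomorphism_apply1[OF hom] by auto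
    qed
    have hom_sym: "homeomorphism D U \<phi>' \<phi>" using hom by (rule homeomorphism_symD)
    have "openin (top_of_set D) (ball 0 r)" using D U(3) by (simp add: openin_open_eq)
    then have "openin (top_of_set U) (\<phi>' ` ball 0 r)"
      by (rule homeomorphism_imp_open_map[OF hom_sym])
    then have "openin (top_of_set Y) (\<phi>' ` ball 0 r)" using U(1) openin_trans by blast
    moreover have "y \<in> \<phi>' ` ball 0 r"
      using homeomorphism_apply1[OF hom U(2)] U(4) r by (metis centre_in_ball image_eqI)
    moreover have "homeomorphism (ball 0 r) (\<phi>' ` ball 0 r) \<phi>' \<phi>"
      using homeomorphism_of_subsets[OF hom_sym D, of U] UW by blast
    ultimately have "chart_at Y y (\<phi>' ` ball 0 r) (ball 0 r) \<phi> \<phi>'"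
      unfolding chart_at_def using U homeomorphism_symD by blast
    then show "ball 0 r \<subseteq> D \<and> chart_at Y y (\<phi>' ` ball 0 r) (ball 0 r) \<phi> \<phi>' \<and> \<phi>' ` ball 0 r \<subseteq> U \<inter> W"
      using D UW by blast
  qed
qed

lemma power_germI:
  assumes "chart_at Y y U D \<phi> \<phi>'" "m > 0" "\<And>u. u \<in> U \<Longrightarrow> F u = \<phi> u ^ m"
  shows "power_germ Y F y m"
  unfolding power_germ_def
proof (intro conjI allI impI \<open>m > 0\<close>)
  show "y \<in> Y" using assms(1) openin_imp_subset unfolding chart_at_def by blast
next
  fix W assume W: "openin (top_of_set Y) W \<and> y \<in> W"
  obtain R where R: "R > 0"
    "ball 0 R \<subseteq> D \<and> chart_at Y y (\<phi>' ` ball 0 R) (ball 0 R) \<phi> \<phi>' \<and> \<phi>' ` ball 0 R \<subseteq> U \<inter> W"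
    using chart_shrink[OF assms(1)] W by (metis order_refl)
  then show "\<exists>U \<phi> \<phi>' r. openin (top_of_set Y) U \<and> y \<in> U \<and> U \<subseteq> W \<and> r > 0 \<and>
          homeomorphism U (ball 0 r) \<phi> \<phi>' \<and> \<phi> y = 0 \<and> (\<forall>u\<in>U. F u = \<phi> u ^ m)"
    using assms(3) unfolding chart_at_def
    by (intro exI[of _ "\<phi>' ` ball 0 R"] exI[of _ \<phi>] exI[of _ \<phi>'] exI[of _ R]) auto
qed

lemma power_germE:
  assumes "power_germ Y F y m" "openin (top_of_set Y) W" "y \<in> W"
  obtains U r \<phi> \<phi>' where "U \<subseteq> W" "r > 0" "chart_at Y y U (ball 0 r) \<phi> \<phi>'"
    "\<And>u. u \<in> U \<Longrightarrow> F u = \<phi> u ^ m"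
proof -
  obtain U \<phi> \<phi>' r where "openin (top_of_set Y) U \<and> y \<in> U \<and> U \<subseteq> W \<and> r > 0 \<and>
          homeomorphism U (ball 0 r) \<phi> \<phi>' \<and> \<phi> y = 0 \<and> (\<forall>u\<in>U. F u = \<phi> u ^ m)"
    using assms unfolding power_germ_def by meson
  then show ?thesis using that[of U r \<phi> \<phi>'] unfolding chart_at_def by auto
qed

lemma power_germ_cong:
  assumes "power_germ Y F y m" "openin (top_of_set Y) W" "y \<in> W" "\<And>u. u \<in> W \<Longrightarrow> F' u = F u"
  shows "power_germ Y F' y m"
proof -
  obtain U r \<phi> \<phi>' where "U \<subseteq> W" "r > 0" "chart_at Y y U (ball 0 r) \<phi> \<phi>'"
    "\<And>u. u \<in> U \<Longrightarrow> F u = \<phi> u ^ m" by (rule power_germE[OF assms(1-3)]) blast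
  then show ?thesis using assms unfolding power_germ_def[of Y F]
    by (intro power_germI[of Y y U "ball 0 r" \<phi> \<phi>']) auto
qed

text \<open>
  The number of \<open>m\<close>-th roots of \<open>c\<close> is \<open>m\<close>, and all of them lie in the disc when \<open>c\<close> is small.
  So the exponent can be read off from the fibres close to the centre.
\<close>

lemma power_chart_fibre:
  assumes "chart_at Y y U (ball 0 r) \<phi> \<phi>'" "r > 0" "m > 0" "\<And>u. u \<in> U \<Longrightarrow> F u = \<phi> u ^ m"
    and "c \<noteq> 0" "norm c < r ^ m"
  shows "finite {u \<in> U. F u = c}" "card {u \<in> U. F u = c} = m"
proof -
  have hom: "homeomorphism U (ball 0 r) \<phi> \<phi>'" using assms(1) unfolding chart_at_def by auto
  have "bij_betw \<phi> {u \<in> U. F u = c} {z. z ^ m = c}"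
  proof (rule bij_betw_byWitness[where f' = \<phi>'])
    show "\<forall>u\<in>{u \<in> U. F u = c}. \<phi>' (\<phi> u) = u" using homeomorphism_apply1[OF hom] by auto
    have *: "z \<in> ball 0 r" if "z ^ m = c" for z
    proof -
      have "norm z ^ m < r ^ m" using that assms(6) by (simp flip: norm_power)
      then show ?thesis using \<open>r > 0\<close> power_less_imp_less_base by fastforce
    qed
    then show "\<forall>z\<in>{z. z ^ m = c}. \<phi> (\<phi>' z) = z" using homeomorphism_apply2[OF hom] by auto
    show "\<phi> ` {u \<in> U. F u = c} \<subseteq> {z. z ^ m = c}" using assms(4) by auto
    show "\<phi>' ` {z. z ^ m = c} \<subseteq> {u \<in> U. F u = c}"
      using * assms(4) homeomorphism_apply2[OF hom] homeomorphism_image2[OF hom] by force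
  qed
  then show "card {u \<in> U. F u = c} = m" "finite {u \<in> U. F u = c}"
    using card_nth_roots[OF assms(5,3)] bij_betw_same_card bij_betw_finite finite_nth_roots[OF assms(3)]
    by metis+
qed

text \<open>
  Nested neighbourhoods in which the fibres over small values have \<open>m\<close> and \<open>n\<close> elements give
  \<open>n \<le> m\<close>; the situation is symmetric.
\<close>

lemma power_germ_unique:
  assumes "power_germ Y F y m" "power_germ Y F y n"
  shows "m = n"
proof -
  have le: "n \<le> m" if hm: "power_germ Y F y m" and hn: "power_germ Y F y n" for m n
  proof -
    have mn: "m > 0" "n > 0" using hm hn unfolding power_germ_def by auto
    have Y: "openin (top_of_set Y) Y" "y \<in> Y" using hm unfolding power_germ_def by auto
      obtain U1 r1 \<phi>1 \<phi>1' where 1: "U1 \<subseteq> Y" "r1 > 0" "chart_at Y y U1 (ball 0 r1) \<phi>1 \<phi>1'"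
        "\<And>u. u \<in> U1 \<Longrightarrow> F u = \<phi>1 u ^ m" by (rule power_germE[OF hm Y]) blast
      have o1: "openin (top_of_set Y) U1" "y \<in> U1" using 1 unfolding chart_at_def by auto
      obtain U2 r2 \<phi>2 \<phi>2' where 2: "U2 \<subseteq> U1" "r2 > 0" "chart_at Y y U2 (ball 0 r2) \<phi>2 \<phi>2'"
        "\<And>u. u \<in> U2 \<Longrightarrow> F u = \<phi>2 u ^ n" by (rule power_germE[OF hn o1]) blast
      obtain e where e: "0 < e" "e < min (r1 ^ m) (r2 ^ n)"
        using 1(2) 2(2) by (metis dense min_less_iff_conj zero_less_power)
      have c: "of_real e \<noteq> (0::complex)" "norm (of_real e :: complex) < r1 ^ m"
        "norm (of_real e :: complex) < r2 ^ n" using e by auto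
      have "card {u \<in> U2. F u = of_real e} \<le> card {u \<in> U1. F u = of_real e}"
        using 2(1) power_chart_fibre(1)[OF 1(3,2) mn(1) 1(4) c(1,2)] by (intro card_mono) auto
      then show ?thesis
        using power_chart_fibre(2)[OF 1(3,2) mn(1) 1(4) c(1,2)]
          power_chart_fibre(2)[OF 2(3,2) mn(2) 2(4) c(1,3)] by simp
  qed
  show ?thesis using le assms by (meson order_antisym)
qed

lemma power_model_at_iff_charts:
  "power_model_at Y X f y m \<longleftrightarrow> m > 0 \<and>
     (\<exists>U V D E \<phi> \<phi>' \<psi> \<psi>'. chart_at Y y U D \<phi> \<phi>' \<and> chart_at X (f y) V E \<psi> \<psi>' \<and> f ` U \<subseteq> V \<and>
        (\<forall>u\<in>U. \<psi> (f u) = \<phi> u ^ m))"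
  unfolding power_model_at_def chart_at_def
  by (rule conj_cong[OF refl], intro ex_cong1) auto

lemma power_model_atE:
  assumes "power_model_at Y X f y m"
  obtains U V D E \<phi> \<phi>' \<psi> \<psi>' where "chart_at Y y U D \<phi> \<phi>'" "chart_at X (f y) V E \<psi> \<psi>'"
    "f ` U \<subseteq> V" "\<And>u. u \<in> U \<Longrightarrow> \<psi> (f u) = \<phi> u ^ m"
proof -
  from assms show ?thesis unfolding power_model_at_iff_charts
    by (elim conjE exE) (rule that, assumption+, erule bspec)
qed

lemma power_model_at_pos: "power_model_at Y X f y m \<Longrightarrow> m > 0"
  unfolding power_model_at_def by blast

text \<open>
  The target chart in a power model may be replaced by any chart \<open>\<kappa>\<close> centred at \<open>f y\<close>: the change of
  charts is lifted through the power map and absorbed into the chart at \<open>y\<close>. Hence local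
  statements about \<open>f\<close> can be made in whichever coordinate of the target is convenient.
\<close>

lemma power_germ_if_power_model_at:
  assumes "power_model_at Y X f y m" and \<kappa>: "chart_at X (f y) V E \<kappa> \<kappa>'"
  shows "power_germ Y (\<lambda>u. \<kappa> (f u)) y m"
proof -
  have "m > 0" using power_model_at_pos[OF assms(1)] .
  obtain U V0 D E0 \<phi> \<phi>' \<psi> \<psi>' where \<phi>: "chart_at Y y U D \<phi> \<phi>'"
    and \<psi>: "chart_at X (f y) V0 E0 \<psi> \<psi>'"
    and f: "f ` U \<subseteq> V0" "\<And>u. u \<in> U \<Longrightarrow> \<psi> (f u) = \<phi> u ^ m"
    using power_model_atE[OF assms(1)] by metis
  have homU: "homeomorphism U D \<phi> \<phi>'" and oU: "openin (top_of_set Y) U" "y \<in> U" "\<phi> y = 0"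
    using \<phi> unfolding chart_at_def by auto
  have hom\<psi>: "homeomorphism V0 E0 \<psi> \<psi>'" and \<psi>0: "\<psi> (f y) = 0" "f y \<in> V0"
    using \<psi> unfolding chart_at_def by auto
  have hom\<kappa>: "homeomorphism V E \<kappa> \<kappa>'" and oV: "openin (top_of_set X) V" "f y \<in> V" "\<kappa> (f y) = 0"
    using \<kappa> unfolding chart_at_def by auto
  obtain R where R: "R > 0" "ball 0 R \<subseteq> E0" "\<psi>' ` ball 0 R \<subseteq> V0 \<inter> V"
    using chart_shrink[OF \<psi> oV(1,2)] by (metis order_refl)
  let ?\<tau> = "\<lambda>z. \<kappa> (\<psi>' z)"
  have "continuous_on (ball 0 R) \<psi>'"
    using hom\<psi> R(2) continuous_on_subset homeomorphism_def by metis
  moreover have "continuous_on V \<kappa>" using hom\<kappa> homeomorphism_def by blast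
  ultimately have cont: "continuous_on (ball 0 R) ?\<tau>"
    using R(3) continuous_on_compose2 by blast
  have inj: "inj_on ?\<tau> (ball 0 R)"
    using R(2,3) homeomorphism_apply2[OF hom\<psi>] homeomorphism_apply1[OF hom\<kappa>]
    by (intro inj_on_inverseI[of _ "\<lambda>w. \<psi> (\<kappa>' w)"]) (auto simp: image_subset_iff subset_iff)
  have "?\<tau> 0 = 0" using homeomorphism_apply1[OF hom\<psi> \<psi>0(2)] \<psi>0(1) oV(3) by simp
  then obtain \<rho> T where T: "\<rho> > 0" "continuous_on (ball 0 \<rho>) T" "inj_on T (ball 0 \<rho>)" "T 0 = 0"
    "\<And>z. z \<in> ball 0 \<rho> \<Longrightarrow> z ^ m \<in> ball 0 R \<and> T z ^ m = ?\<tau> (z ^ m)"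
    using lift_through_power[OF R(1) cont inj _ \<open>m > 0\<close>] by metis
  obtain R' where R': "R' > 0" "\<And>r. 0 < r \<Longrightarrow> r \<le> R' \<Longrightarrow>
    ball 0 r \<subseteq> D \<and> chart_at Y y (\<phi>' ` ball 0 r) (ball 0 r) \<phi> \<phi>' \<and> \<phi>' ` ball 0 r \<subseteq> U \<inter> U"
    using chart_shrink[OF \<phi> oU(1,2)] by metis
  define r where "r = min R' \<rho>"
  have r: "0 < r" "r \<le> R'" "ball 0 r \<subseteq> ball (0::complex) \<rho>" using T(1) R'(1) unfolding r_def by auto
  let ?U = "\<phi>' ` ball 0 r"
  have U: "chart_at Y y ?U (ball 0 r) \<phi> \<phi>'" "?U \<subseteq> U" using R'(2)[OF r(1,2)] by auto
  have contT: "continuous_on (ball 0 r) T" and injT: "inj_on T (ball 0 r)"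
    using T r continuous_on_subset inj_on_subset by blast+
  obtain T' where "homeomorphism (ball 0 r) (T ` ball 0 r) T T'"
    using invariance_of_domain_homeomorphism[OF open_ball contT order_refl injT] by metis
  then have "homeomorphism ?U (T ` ball 0 r) (T \<circ> \<phi>) (\<phi>' \<circ> T')"
    using homeomorphism_compose U(1) unfolding chart_at_def by blast
  moreover have "open (T ` ball 0 r)" using invariance_of_domain[OF contT open_ball injT] .
  ultimately have "chart_at Y y ?U (T ` ball 0 r) (T \<circ> \<phi>) (\<phi>' \<circ> T')"
    using U(1) T(4) unfolding chart_at_def by simp
  moreover have "\<kappa> (f u) = (T \<circ> \<phi>) u ^ m" if u: "u \<in> ?U" for u
  proof -
    have "\<phi> u \<in> ball 0 \<rho>" using u U(1) r(3) homeomorphism_image1 unfolding chart_at_def by blast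
    then have "T (\<phi> u) ^ m = \<kappa> (\<psi>' (\<phi> u ^ m))" using T(5) by blast
    also have "\<phi> u ^ m = \<psi> (f u)" using f(2) u U(2) by fastforce
    also have "\<psi>' (\<psi> (f u)) = f u" using homeomorphism_apply1[OF hom\<psi>] f(1) u U(2) by blast
    finally show ?thesis by simp
  qed
  ultimately show ?thesis using power_germI[where F = "\<lambda>u. \<kappa> (f u)", OF _ \<open>m > 0\<close>] by blast
qed

lemma power_model_atI:
  assumes "continuous_on Y f" "f ` Y \<subseteq> X" "chart_at X (f y) V E \<kappa> \<kappa>'"
    and "power_germ Y (\<lambda>u. \<kappa> (f u)) y m"
  shows "power_model_at Y X f y m"
proof -
  have m: "m > 0" "y \<in> Y" using assms(4) unfolding power_germ_def by auto
  have V: "openin (top_of_set X) V" "f y \<in> V" using assms(3) unfolding chart_at_def by auto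
  have "openin (top_of_set Y) (Y \<inter> f -` V)"
    using continuous_openin_preimage[OF assms(1) _ V(1)] assms(2) by blast
  moreover have "y \<in> Y \<inter> f -` V" using m V by auto
  ultimately obtain U r \<phi> \<phi>' where U: "U \<subseteq> Y \<inter> f -` V" "r > 0" "chart_at Y y U (ball 0 r) \<phi> \<phi>'"
    "\<And>u. u \<in> U \<Longrightarrow> \<kappa> (f u) = \<phi> u ^ m"
    by (rule power_germE[OF assms(4)]) blast
  then show ?thesis unfolding power_model_at_iff_charts
    using m assms(3) by (intro conjI exI[of _ U] exI[of _ V] exI[of _ "ball 0 r"] exI[of _ E]
      exI[of _ \<phi>] exI[of _ \<phi>'] exI[of _ \<kappa>] exI[of _ \<kappa>']) auto
qed

lemma local_degree_eq:
  assumes "power_model_at Y X f y m"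
  shows "local_degree Y X f y = m"
  unfolding local_degree_def
proof (rule the_equality[where P = "power_model_at Y X f y", OF assms])
  fix n assume n: "power_model_at Y X f y n"
  obtain V E \<psi> \<psi>' where "chart_at X (f y) V E \<psi> \<psi>'" using power_model_atE[OF assms] by metis
  then show "n = m" using power_germ_unique power_germ_if_power_model_at assms n by metis
qed

lemma power_models_imp_continuous:
  assumes "\<And>y. y \<in> Y \<Longrightarrow> \<exists>m. power_model_at Y X f y m"
  shows "continuous_on Y f"
proof -
  have "\<exists>U. openin (top_of_set Y) U \<and> y \<in> U \<and> continuous_on U f" if y: "y \<in> Y" for y
  proof -
    obtain m where "power_model_at Y X f y m" using assms[OF y] by blast
    then obtain U V D E \<phi> \<phi>' \<psi> \<psi>' where \<phi>: "chart_at Y y U D \<phi> \<phi>'"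
      and \<psi>: "chart_at X (f y) V E \<psi> \<psi>'"
      and f: "f ` U \<subseteq> V" "\<And>u. u \<in> U \<Longrightarrow> \<psi> (f u) = \<phi> u ^ m"
      using power_model_atE by metis
    have hom\<psi>: "homeomorphism V E \<psi> \<psi>'" and hom\<phi>: "homeomorphism U D \<phi> \<phi>'"
      using \<phi> \<psi> unfolding chart_at_def by auto
    have "continuous_on U \<phi>" using hom\<phi> homeomorphism_def by blast
    then have "continuous_on U (\<lambda>u. \<phi> u ^ m)" by (intro continuous_intros)
    moreover have "continuous_on E \<psi>'" using hom\<psi> homeomorphism_def by blast
    moreover have "(\<lambda>u. \<phi> u ^ m) ` U \<subseteq> E"
      using f homeomorphism_image1[OF hom\<psi>] by force
    ultimately have "continuous_on U (\<lambda>u. \<psi>' (\<phi> u ^ m))" using continuous_on_compose2 by blast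
    moreover have "\<psi>' (\<phi> u ^ m) = f u" if "u \<in> U" for u
      using f that homeomorphism_apply1[OF hom\<psi>] by (metis image_subset_iff)
    ultimately have "continuous_on U f" by (metis (no_types, lifting) continuous_on_eq)
    then show ?thesis using \<phi> unfolding chart_at_def by blast
  qed
  then obtain U where U: "\<And>y. y \<in> Y \<Longrightarrow> openin (top_of_set Y) (U y) \<and> y \<in> U y \<and> continuous_on (U y) f"
    by metis
  show ?thesis unfolding continuous_openin_preimage_eq
  proof (intro allI impI)
    fix T :: "'b set" assume T: "open T"
    have "openin (top_of_set Y) (U y \<inter> f -` T)" if "y \<in> Y" for y
      using U[OF that] continuous_openin_preimage_gen[OF _ T] openin_trans by blast
    moreover have "Y \<inter> f -` T = (\<Union>y\<in>Y. U y \<inter> f -` T)"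
      using U openin_imp_subset by fastforce
    ultimately show "openin (top_of_set Y) (Y \<inter> f -` T)" by (metis (no_types, lifting) imageE openin_Union)
  qed
qed

text \<open>
  By invariance of domain, an injective continuous function of the coordinate is again a
  coordinate. This yields translated charts (with \<open>q z = z\<close>) and, away from \<open>0\<close>, charts that are
  powers of a given one.
\<close>

lemma chart_push:
  fixes q :: "complex \<Rightarrow> complex"
  assumes U: "openin (top_of_set Y) U" "homeomorphism U D \<phi> \<phi>'" "open D" "u \<in> U"
    and B: "open B" "B \<subseteq> D" "\<phi> u \<in> B" "continuous_on B q" "inj_on q B"
  obtains U2 D2 \<phi>2 where "U2 \<subseteq> U"
    "chart_at Y u U2 D2 (\<lambda>v. q (\<phi> v) - q (\<phi> u)) \<phi>2"
proof -
  let ?q = "\<lambda>z. q z - q (\<phi> u)"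
  have q: "continuous_on B ?q" "inj_on ?q B"
    using B by (auto intro!: continuous_intros simp: inj_on_def)
  obtain q' where hq: "homeomorphism B (?q ` B) ?q q'"
    using invariance_of_domain_homeomorphism[OF B(1) q(1) order_refl q(2)] by auto
  have hs: "homeomorphism D U \<phi>' \<phi>" using U(2) by (rule homeomorphism_symD)
  have "openin (top_of_set D) B" using B U(3) by (simp add: openin_open_eq)
  then have "openin (top_of_set U) (\<phi>' ` B)" by (rule homeomorphism_imp_open_map[OF hs])
  then have o: "openin (top_of_set Y) (\<phi>' ` B)" using U(1) openin_trans by blast
  have hB: "homeomorphism (\<phi>' ` B) B \<phi> \<phi>'"
    using homeomorphism_of_subsets[OF hs B(2), of U] homeomorphism_image1[OF hs] B(2)
      homeomorphism_symD by blast
  have "homeomorphism (\<phi>' ` B) (?q ` B) (?q \<circ> \<phi>) (\<phi>' \<circ> q')"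
    using homeomorphism_compose[OF hB hq] .
  moreover have "open (?q ` B)" using invariance_of_domain[OF q(1) B(1) q(2)] .
  moreover have "u \<in> \<phi>' ` B" using homeomorphism_apply1[OF U(2,4)] B(3) by force
  ultimately have "chart_at Y u (\<phi>' ` B) (?q ` B) (?q \<circ> \<phi>) (\<phi>' \<circ> q')"
    using o unfolding chart_at_def by simp
  moreover have "\<phi>' ` B \<subseteq> U" using homeomorphism_image1[OF hs] B(2) by blast
  ultimately show ?thesis using that[of "\<phi>' ` B"] unfolding comp_def by blast
qed

text \<open>
  Two points with the same \<open>m\<close>-th power differ by a root of unity, and the finitely many roots of unity other than \<open>1\<close> keep a distance from \<open>1\<close>.
\<close>

lemma power_locally_inj:
  fixes z0 :: complex
  assumes "z0 \<noteq> 0" "m > 0"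
  obtains \<epsilon> where "\<epsilon> > 0" "inj_on (\<lambda>z. z ^ m) (ball z0 \<epsilon>)"
proof -
  obtain \<delta> where \<delta>: "\<delta> > 0" "\<And>\<zeta>::complex. \<zeta> ^ m = 1 \<Longrightarrow> \<zeta> \<noteq> 1 \<Longrightarrow> \<delta> \<le> dist 1 \<zeta>"
    using finite_set_avoid[OF finite_nth_roots[OF assms(2), of 1], of 1] by auto
  define \<epsilon> where "\<epsilon> = min (norm z0 / 2) (\<delta> * norm z0 / 4)"
  have "\<epsilon> > 0" using \<delta> assms unfolding \<epsilon>_def by simp
  moreover have "inj_on (\<lambda>z. z ^ m) (ball z0 \<epsilon>)"
  proof (rule inj_onI, rule ccontr)
    fix z w assume zw: "z \<in> ball z0 \<epsilon>" "w \<in> ball z0 \<epsilon>" "z ^ m = w ^ m" "z \<noteq> w"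
    have "norm z0 \<le> norm z + dist z0 z" by (metis add.commute dist_norm norm_triangle_sub)
    then have z: "norm z > norm z0 / 2" using zw(1) unfolding \<epsilon>_def by auto
    then have "z \<noteq> 0" using assms by auto
    have "(w / z) ^ m = 1" using \<open>z \<noteq> 0\<close> by (simp add: power_divide flip: zw(3))
    moreover have "w / z \<noteq> 1" using zw(4) \<open>z \<noteq> 0\<close> by auto
    ultimately have "\<delta> \<le> dist 1 (w / z)" using \<delta> by blast
    also have "\<dots> = dist z w / norm z"
      using \<open>z \<noteq> 0\<close> by (simp add: dist_norm field_simps flip: norm_divide)
    finally have "\<delta> * norm z \<le> dist z w" using \<open>z \<noteq> 0\<close> by (simp add: field_simps)
    moreover have "dist z w \<le> dist z0 z + dist z0 w" by (rule dist_triangle3)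
    moreover have "dist z0 z + dist z0 w < \<delta> * norm z0 / 2" using zw unfolding \<epsilon>_def by auto
    moreover have "\<delta> * (norm z0 / 2) < \<delta> * norm z" using z \<delta>(1) by (rule mult_strict_left_mono)
    ultimately show False by simp
  qed
  ultimately show ?thesis using that by blast
qed

section \<open>Constancy of the number of preimages\<close>

text \<open>
  A branched cover up to surjectivity, which is recovered from the constancy of the number of preimages.
\<close>

definition branched_map ::
    "'a::topological_space set \<Rightarrow> 'b::topological_space set \<Rightarrow> ('a \<Rightarrow> 'b) \<Rightarrow> bool" where
  "branched_map Y X f \<longleftrightarrow> f ` Y \<subseteq> X \<and> (\<forall>y\<in>Y. \<exists>m. power_model_at Y X f y m)"

lemma branched_map_continuous: "branched_map Y X f \<Longrightarrow> continuous_on Y f"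
  unfolding branched_map_def by (rule power_models_imp_continuous) blast

lemma branched_map_model:
  "branched_map Y X f \<Longrightarrow> y \<in> Y \<Longrightarrow> power_model_at Y X f y (local_degree Y X f y)"
  unfolding branched_map_def using local_degree_eq by metis

lemma local_degree_pos: "branched_map Y X f \<Longrightarrow> y \<in> Y \<Longrightarrow> local_degree Y X f y > 0"
  using branched_map_model power_model_at_pos by blast

text \<open>
  Off its centre a power map is locally injective, so there \<open>z \<mapsto> z ^ m\<close> itself serves as a chart in which \<open>f\<close> has exponent \<open>1\<close>.
\<close>

lemma local_degree_eq_1_off_centre:
  assumes f: "branched_map Y X f" and \<psi>: "openin (top_of_set X) V" "homeomorphism V E \<psi> \<psi>'" "open E"
    and \<phi>: "chart_at Y y U (ball 0 r) \<phi> \<phi>'" and eq: "\<And>u. u \<in> U \<Longrightarrow> \<psi> (f u) = \<phi> u ^ m"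
    and "m > 0" "u \<in> U" "f u \<in> V" "\<phi> u \<noteq> 0"
  shows "local_degree Y X f u = 1"
proof (rule local_degree_eq)
  have U: "openin (top_of_set Y) U" "homeomorphism U (ball 0 r) \<phi> \<phi>'"
    using \<phi> unfolding chart_at_def by auto
  obtain \<epsilon> where \<epsilon>: "\<epsilon> > 0" "inj_on (\<lambda>z. z ^ m) (ball (\<phi> u) \<epsilon>)"
    using power_locally_inj[OF \<open>\<phi> u \<noteq> 0\<close> \<open>m > 0\<close>] by blast
  let ?B = "ball (\<phi> u) \<epsilon> \<inter> ball 0 r"
  have "\<phi> u \<in> ?B" using \<epsilon> homeomorphism_image1[OF U(2)] assms(8) by auto
  moreover have "continuous_on ?B (\<lambda>z. z ^ m)" by (intro continuous_intros)
  moreover have "inj_on (\<lambda>z. z ^ m) ?B" using \<epsilon>(2) inj_on_subset by blast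
  ultimately obtain U2 D2 \<phi>2 where U2: "U2 \<subseteq> U"
    "chart_at Y u U2 D2 (\<lambda>v. \<phi> v ^ m - \<phi> u ^ m) \<phi>2"
    using chart_push[OF U open_ball assms(8), of ?B "\<lambda>z. z ^ m"] by (metis inf_le2 open_Int open_ball)
  obtain V2 E2 \<psi>2 where V2: "chart_at X (f u) V2 E2 (\<lambda>x. \<psi> x - \<psi> (f u)) \<psi>2"
    using chart_push[OF \<psi> \<open>f u \<in> V\<close> \<psi>(3) order_refl, of "\<lambda>z. z"] homeomorphism_image1[OF \<psi>(2)]
      \<open>f u \<in> V\<close> by (metis continuous_on_id image_eqI inj_on_id2)
  have "power_germ Y (\<lambda>v. \<psi> (f v) - \<psi> (f u)) u 1"
  proof (rule power_germI[OF U2(2)])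
    show "\<psi> (f v) - \<psi> (f u) = (\<phi> v ^ m - \<phi> u ^ m) ^ 1" if "v \<in> U2" for v
      using eq U2(1) that \<open>u \<in> U\<close> by auto
  qed simp
  then show "power_model_at Y X f u 1"
    using power_model_atI[OF branched_map_continuous[OF f] _ V2] f unfolding branched_map_def by blast
qed

text \<open>
  Near the centre of a power model, a fibre either is the centre, of local degree \<open>m\<close>, or consists
  of \<open>m\<close> points of local degree \<open>1\<close>; the weighted count is \<open>m\<close> in both cases.
\<close>

lemma branched_map_local_fibre:
  assumes f: "branched_map Y X f" and "y \<in> Y" and W: "openin (top_of_set Y) W" "y \<in> W"
  obtains U V where "openin (top_of_set Y) U" "y \<in> U" "U \<subseteq> W" "openin (top_of_set X) V" "f y \<in> V"
    "\<And>x. x \<in> V \<Longrightarrow> finite {u \<in> U. f u = x}"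
    "\<And>x. x \<in> V \<Longrightarrow> (\<Sum>u \<in> {u \<in> U. f u = x}. local_degree Y X f u) = local_degree Y X f y"
proof -
  let ?m = "local_degree Y X f y"
  have m: "?m > 0" and model: "power_model_at Y X f y ?m"
    using local_degree_pos[OF f \<open>y \<in> Y\<close>] branched_map_model[OF f \<open>y \<in> Y\<close>] .
  obtain V0 E \<psi> \<psi>' where \<psi>: "chart_at X (f y) V0 E \<psi> \<psi>'"
    using power_model_atE[OF model] by metis
  have V0: "openin (top_of_set X) V0" "f y \<in> V0" "homeomorphism V0 E \<psi> \<psi>'" "open E" "\<psi> (f y) = 0"
    using \<psi> unfolding chart_at_def by auto
  have "openin (top_of_set Y) (Y \<inter> f -` V0)"
    using continuous_openin_preimage[OF branched_map_continuous[OF f] _ V0(1)] f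
    unfolding branched_map_def by blast
  then have "openin (top_of_set Y) (W \<inter> (Y \<inter> f -` V0))" using W(1) by (rule openin_Int[rotated])
  moreover have "y \<in> W \<inter> (Y \<inter> f -` V0)" using W \<open>y \<in> Y\<close> V0 by auto
  ultimately obtain U r \<phi> \<phi>' where U: "U \<subseteq> W \<inter> (Y \<inter> f -` V0)" "r > 0"
    "chart_at Y y U (ball 0 r) \<phi> \<phi>'" "\<And>u. u \<in> U \<Longrightarrow> \<psi> (f u) = \<phi> u ^ ?m"
    by (rule power_germE[OF power_germ_if_power_model_at[OF model \<psi>]]) blast
  have U': "openin (top_of_set Y) U" "y \<in> U" "homeomorphism U (ball 0 r) \<phi> \<phi>'" "\<phi> y = 0"
    using U(3) unfolding chart_at_def by auto
  obtain R where R: "R > 0" "\<And>r. 0 < r \<Longrightarrow> r \<le> R \<Longrightarrow>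
    ball 0 r \<subseteq> E \<and> chart_at X (f y) (\<psi>' ` ball 0 r) (ball 0 r) \<psi> \<psi>' \<and> \<psi>' ` ball 0 r \<subseteq> V0 \<inter> V0"
    using chart_shrink[OF \<psi> V0(1,2)] by metis
  define \<rho> where "\<rho> = min R (r ^ ?m)"
  have \<rho>: "0 < \<rho>" "\<rho> \<le> R" using R(1) U(2) unfolding \<rho>_def by auto
  let ?V = "\<psi>' ` ball 0 \<rho>"
  have V: "ball 0 \<rho> \<subseteq> E" "chart_at X (f y) ?V (ball 0 \<rho>) \<psi> \<psi>'" "?V \<subseteq> V0" using R(2)[OF \<rho>] by auto
  have fin_sum: "finite {u \<in> U. f u = x} \<and> (\<Sum>u \<in> {u \<in> U. f u = x}. local_degree Y X f u) = ?m"
    if x: "x \<in> ?V" for x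
  proof -
    have fib: "{u \<in> U. f u = x} = {u \<in> U. \<psi> (f u) = \<psi> x}"
    proof -
      have "f u = x" if "u \<in> U" "\<psi> (f u) = \<psi> x" for u
        using that U(1) V(3) x homeomorphism_apply1[OF V0(3)] by (metis IntD2 subsetD vimage_eq)
      then show ?thesis by auto
    qed
    have "norm (\<psi> x) < \<rho>" using homeomorphism_image1 V(2) x unfolding chart_at_def by fastforce
    then have lt: "norm (\<psi> x) < r ^ ?m" unfolding \<rho>_def by simp
    show ?thesis
    proof (cases "\<psi> x = 0")
      case True
      have "{u \<in> U. \<psi> (f u) = \<psi> x} = {y}"
      proof -
        have "u = y" if "u \<in> U" "\<psi> (f u) = 0" for u
        proof -
          have "\<phi> u ^ ?m = 0" by (rule trans[OF U(4)[OF that(1), symmetric] that(2)])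
          then have "\<phi> u = \<phi> y" unfolding U'(4) by (rule power_eq_0_iff[THEN iffD1, THEN conjunct1])
          have "u = \<phi>' (\<phi> u)" by (rule homeomorphism_apply1[OF U'(3) that(1), symmetric])
          also have "\<dots> = \<phi>' (\<phi> y)" by (rule arg_cong[OF \<open>\<phi> u = \<phi> y\<close>])
          also have "\<dots> = y" by (rule homeomorphism_apply1[OF U'(3,2)])
          finally show ?thesis .
        qed
        moreover have "\<psi> (f y) = 0" "y \<in> U" using U' V0 by auto
        ultimately show ?thesis unfolding True by blast
      qed
      then have "{u \<in> U. f u = x} = {y}" using fib by simp
      then show ?thesis by simp
    next
      case False
      note c = power_chart_fibre[where F = "\<lambda>u. \<psi> (f u)", OF U(3,2) m U(4) False lt]
      have "local_degree Y X f u = 1" if u: "u \<in> U" "\<psi> (f u) = \<psi> x" for u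
      proof (rule local_degree_eq_1_off_centre[OF f V0(1,3,4) U(3) U(4) m u(1)])
        show "f u \<in> V0" using u U(1) by blast
        show "\<phi> u \<noteq> 0" using U(4)[OF u(1)] u False m by (auto simp: zero_power)
      qed
      then show ?thesis using c fib by simp
    qed
  qed
  show ?thesis
  proof (rule that[of U ?V])
    show "openin (top_of_set X) ?V" "f y \<in> ?V" using V(2) unfolding chart_at_def by auto
  qed (use U U' fin_sum in auto)
qed

text \<open>
  Fibres are discrete by the preceding lemma, and compact.
\<close>

lemma branched_map_finite_fibre:
  fixes f :: "'a::t2_space \<Rightarrow> 'b::t2_space"
  assumes f: "branched_map Y X f" and "compact Y"
  shows "finite {y \<in> Y. f y = x}"
proof -
  have "\<exists>U. openin (top_of_set Y) U \<and> y \<in> U \<and> finite {u \<in> U. f u = f y}" if "y \<in> Y" for y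
    using branched_map_local_fibre[OF f that, of Y] that
    by (metis openin_subtopology_self)
  then obtain U where U: "\<And>y. y \<in> Y \<Longrightarrow> openin (top_of_set Y) (U y)" "\<And>y. y \<in> Y \<Longrightarrow> y \<in> U y"
    "\<And>y. y \<in> Y \<Longrightarrow> finite {u \<in> U y. f u = f y}" by metis
  let ?S = "{y \<in> Y. f y = x}"
  have "closedin (top_of_set Y) (Y \<inter> f -` {x})"
    using continuous_closedin_preimage[OF branched_map_continuous[OF f], of "{x}"] by simp
  moreover have "Y \<inter> f -` {x} = ?S" by auto
  ultimately have "compact ?S" using closedin_compact[OF \<open>compact Y\<close>] by simp
  moreover have "\<exists>T. open T \<and> U y = Y \<inter> T" if "y \<in> Y" for y
    using U(1)[OF that] by (auto simp: openin_open)
  then obtain T where T: "\<And>y. y \<in> Y \<Longrightarrow> open (T y) \<and> U y = Y \<inter> T y" by metis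
  moreover have "?S \<subseteq> (\<Union>y\<in>?S. T y)" using T U(2) by blast
  ultimately obtain C where C: "C \<subseteq> ?S" "finite C" "?S \<subseteq> (\<Union>y\<in>C. T y)"
    using compactE_image[of ?S ?S T] by (metis (no_types, lifting) mem_Collect_eq)
  then have "?S \<subseteq> (\<Union>y\<in>C. {u \<in> U y. f u = f y})" using T by fastforce
  moreover have "finite (\<Union>y\<in>C. {u \<in> U y. f u = f y})" using C U(3) by blast
  ultimately show ?thesis by (rule finite_subset)
qed

text \<open>
  Around the points of the fibre over \<open>x\<close> the weighted count is locally constant. The rest \<open>K\<close> of the
  domain is compact, and its closed image misses \<open>x\<close>, so that no further preimages of points close
  to \<open>x\<close> occur.
\<close>

lemma branched_map_fibre_count_locally_constant:
  fixes f :: "'a::heine_borel \<Rightarrow> 'b::t2_space"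
  assumes f: "branched_map Y X f" and "compact Y" and "x \<in> X"
  shows "\<exists>V. openin (top_of_set X) V \<and> x \<in> V \<and> (\<forall>x'\<in>V.
    (\<Sum>y \<in> {y \<in> Y. f y = x'}. local_degree Y X f y) = (\<Sum>y \<in> {y \<in> Y. f y = x}. local_degree Y X f y))"
proof -
  let ?S = "{y \<in> Y. f y = x}"
  have finS: "finite ?S" using branched_map_finite_fibre[OF f \<open>compact Y\<close>] .
  then have "uniform_discrete ?S" using uniform_discrete_finite_iff by blast
  then obtain d where d: "d > 0" "\<And>y y'. y \<in> ?S \<Longrightarrow> y' \<in> ?S \<Longrightarrow> y \<noteq> y' \<Longrightarrow> d \<le> dist y y'"
    unfolding uniform_discrete_def by (meson not_le)
  define separated where "separated y U V \<longleftrightarrow>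
      openin (top_of_set Y) U \<and> y \<in> U \<and> U \<subseteq> ball y (d / 2) \<and> openin (top_of_set X) V \<and> x \<in> V \<and>
      (\<forall>x'\<in>V. finite {u \<in> U. f u = x'} \<and>
        (\<Sum>u \<in> {u \<in> U. f u = x'}. local_degree Y X f u) = local_degree Y X f y)" for y U V
  have "\<exists>U V. separated y U V" if y: "y \<in> ?S" for y
  proof -
    have yY: "y \<in> Y" "f y = x" using y by auto
    have W: "openin (top_of_set Y) (Y \<inter> ball y (d / 2))" "y \<in> Y \<inter> ball y (d / 2)"
      using yY d by (auto simp: openin_open_Int)
    obtain U V where UV: "openin (top_of_set Y) U" "y \<in> U" "U \<subseteq> Y \<inter> ball y (d / 2)"
      "openin (top_of_set X) V" "f y \<in> V"
      "\<And>x. x \<in> V \<Longrightarrow> finite {u \<in> U. f u = x}"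
      "\<And>x. x \<in> V \<Longrightarrow> (\<Sum>u \<in> {u \<in> U. f u = x}. local_degree Y X f u) = local_degree Y X f y"
      by (rule branched_map_local_fibre[OF f yY(1) W]) blast
    have "separated y U V" unfolding separated_def
      using UV(1-5) yY by (intro conjI ballI UV(6,7)) simp_all
    then show ?thesis by blast
  qed
  then obtain U V where "\<And>y. y \<in> ?S \<Longrightarrow> separated y (U y) (V y)"
    by metis
  then have UV: "\<And>y. y \<in> ?S \<Longrightarrow> openin (top_of_set Y) (U y) \<and> y \<in> U y \<and> U y \<subseteq> ball y (d / 2)"
    "\<And>y. y \<in> ?S \<Longrightarrow> openin (top_of_set X) (V y) \<and> x \<in> V y"
    "\<And>y x'. y \<in> ?S \<Longrightarrow> x' \<in> V y \<Longrightarrow> finite {u \<in> U y. f u = x'} \<and>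
        (\<Sum>u \<in> {u \<in> U y. f u = x'}. local_degree Y X f u) = local_degree Y X f y"
    unfolding separated_def by simp_all
  have disj: "U y \<inter> U y' = {}" if "y \<in> ?S" "y' \<in> ?S" "y \<noteq> y'" for y y'
  proof (rule ccontr)
    assume "U y \<inter> U y' \<noteq> {}"
    then obtain u where "u \<in> U y" "u \<in> U y'" by blast
    then have "u \<in> ball y (d / 2)" "u \<in> ball y' (d / 2)"
      using UV(1)[OF that(1)] UV(1)[OF that(2)] by auto
    then have "dist y u < d / 2" "dist y' u < d / 2" by auto
    then have "dist y y' < d" using dist_triangle2[of y y' u] by simp
    then show False using d(2)[OF that] by simp
  qed
  let ?K = "Y - (\<Union>y\<in>?S. U y)"
  have "openin (top_of_set Y) (\<Union>y\<in>?S. U y)" using UV(1) by blast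
  then have "closedin (top_of_set Y) ?K" by (simp add: closedin_diff)
  then have "compact ?K" using closedin_compact \<open>compact Y\<close> by blast
  moreover have "continuous_on ?K f"
    by (rule continuous_on_subset[OF branched_map_continuous[OF f] Diff_subset])
  ultimately have "compact (f ` ?K)" by (metis compact_continuous_image)
  then have "closed (f ` ?K)" by (rule compact_imp_closed)
  then have oK: "openin (top_of_set X) (X \<inter> - f ` ?K)" by (simp add: openin_open_Int open_Compl)
  let ?V = "(X \<inter> - f ` ?K) \<inter> (\<Inter>y\<in>?S. V y)"
  have xK: "x \<in> X \<inter> - f ` ?K"
  proof -
    have "y \<notin> ?K" if "f y = x" for y using UV(1)[of y] that by blast
    then show ?thesis using \<open>x \<in> X\<close> by blast
  qed
  have "openin (top_of_set X) ?V"
  proof (cases "?S = {}")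
    case True
    then have "(\<Inter>y\<in>?S. V y) = UNIV" by blast
    then show ?thesis using oK by (simp only: Int_UNIV_right)
  next
    case False
    then have "openin (top_of_set X) (\<Inter>y\<in>?S. V y)"
      using UV(2) finS by (intro openin_INT2) simp_all
    then show ?thesis by (rule openin_Int[OF oK])
  qed
  moreover have "x \<in> ?V" using xK UV(2) by auto
  moreover have "(\<Sum>y \<in> {y \<in> Y. f y = x'}. local_degree Y X f y) = (\<Sum>y \<in> ?S. local_degree Y X f y)"
    if x': "x' \<in> ?V" for x'
  proof -
    have "{y \<in> Y. f y = x'} = (\<Union>y\<in>?S. {u \<in> U y. f u = x'})"
    proof (intro equalityI subsetI)
      fix y assume y: "y \<in> {y \<in> Y. f y = x'}"
      then have "y \<notin> ?K" using x' by blast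
      then show "y \<in> (\<Union>y\<in>?S. {u \<in> U y. f u = x'})" using y by blast
    next
      fix u assume "u \<in> (\<Union>y\<in>?S. {u \<in> U y. f u = x'})"
      then obtain y where "y \<in> ?S" "u \<in> U y" "f u = x'" by blast
      then show "u \<in> {y \<in> Y. f y = x'}" using openin_imp_subset UV(1)[of y] by blast
    qed
    also have "(\<Sum>y \<in> (\<Union>y\<in>?S. {u \<in> U y. f u = x'}). local_degree Y X f y) =
        (\<Sum>y\<in>?S. \<Sum>u \<in> {u \<in> U y. f u = x'}. local_degree Y X f u)"
    proof (rule sum.UNION_disjoint[OF finS])
      show "\<forall>y\<in>?S. finite {u \<in> U y. f u = x'}" using UV(3) x' by blast
      show "\<forall>y\<in>?S. \<forall>y'\<in>?S. y \<noteq> y' \<longrightarrow> {u \<in> U y. f u = x'} \<inter> {u \<in> U y'. f u = x'} = {}"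
        using disj by blast
    qed
    also have "\<dots> = (\<Sum>y \<in> ?S. local_degree Y X f y)"
    proof (rule sum.cong[OF refl])
      fix y assume y: "y \<in> ?S"
      then have "x' \<in> V y" using x' by blast
      then show "(\<Sum>u \<in> {u \<in> U y. f u = x'}. local_degree Y X f u) = local_degree Y X f y"
        using UV(3)[OF y] by blast
    qed
    finally show ?thesis .
  qed
  ultimately show ?thesis by blast
qed

theorem branched_map_fibre_count_constant:
  fixes f :: "'a::heine_borel \<Rightarrow> 'b::t2_space"
  assumes f: "branched_map Y X f" and "compact Y" "connected X" and "x \<in> X" "x' \<in> X"
  shows "(\<Sum>y \<in> {y \<in> Y. f y = x}. local_degree Y X f y) = (\<Sum>y \<in> {y \<in> Y. f y = x'}. local_degree Y X f y)"
proof -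
  have "(\<lambda>x. \<Sum>y \<in> {y \<in> Y. f y = x}. local_degree Y X f y) constant_on X"
    using \<open>connected X\<close> branched_map_fibre_count_locally_constant[OF f \<open>compact Y\<close>]
    by (rule locally_constant_imp_constant)
  then show ?thesis using assms(4,5) unfolding constant_on_def by metis
qed

section \<open>Roots of complex functions\<close>

lemma power_germ_power:
  assumes "power_germ Y F y m" "s > 0"
  shows "power_germ Y (\<lambda>u. F u ^ s) y (s * m)"
proof -
  have m: "m > 0" "openin (top_of_set Y) Y" "y \<in> Y" using assms(1) unfolding power_germ_def by auto
  obtain U r \<phi> \<phi>' where U: "U \<subseteq> Y" "r > 0" "chart_at Y y U (ball 0 r) \<phi> \<phi>'"
    "\<And>u. u \<in> U \<Longrightarrow> F u = \<phi> u ^ m"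
    by (rule power_germE[OF assms(1) m(2,3)]) blast
  show ?thesis
  proof (rule power_germI[OF U(3)])
    show "F u ^ s = \<phi> u ^ (s * m)" if "u \<in> U" for u
      unfolding U(4)[OF that] by (simp add: mult.commute flip: power_mult)
  qed (use m assms in simp)
qed

text \<open>
  On the punctured neighbourhood the quotient of \<open>F\<close> by \<open>\<phi> ^ m\<close> is an \<open>s\<close>-th root of unity, hence constant
  because a punctured disc is connected; an \<open>m\<close>-th root \<open>\<eta>\<close> of the constant is absorbed into \<open>\<phi>\<close>.
\<close>

lemma power_germ_root:
  assumes germ: "power_germ Y (\<lambda>u. F u ^ s) y (s * m)" and "s > 0"
    and W: "openin (top_of_set Y) W" "y \<in> W" "continuous_on W F"
  shows "power_germ Y F y m"
proof -
  have m: "m > 0" using germ unfolding power_germ_def by auto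
  obtain U r \<phi> \<phi>' where U: "U \<subseteq> W" "r > 0" "chart_at Y y U (ball 0 r) \<phi> \<phi>'"
    and eq: "\<And>u. u \<in> U \<Longrightarrow> F u ^ s = \<phi> u ^ (s * m)"
    by (rule power_germE[OF germ W(1,2)]) blast
  have hom: "homeomorphism U (ball 0 r) \<phi> \<phi>'" and y: "\<phi> y = 0" "y \<in> U" "openin (top_of_set Y) U"
    using U(3) unfolding chart_at_def by auto
  have \<phi>'0: "\<phi>' 0 = y" using homeomorphism_apply1[OF hom y(2)] y(1) by simp
  let ?P = "ball (0::complex) r - {0}"
  have \<phi>'U: "\<phi>' z \<in> U" "\<phi> (\<phi>' z) = z" if "z \<in> ball 0 r" for z
    using that homeomorphism_image2[OF hom] homeomorphism_apply2[OF hom] by auto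
  have pow: "(F (\<phi>' z) / z ^ m) ^ s = 1" if "z \<in> ?P" for z
    using that eq[of "\<phi>' z"] \<phi>'U[of z] by (simp add: power_divide mult.commute flip: power_mult)
  have "continuous_on (ball 0 r) \<phi>'" using hom homeomorphism_def by blast
  then have "continuous_on ?P \<phi>'" by (rule continuous_on_subset) auto
  then have "continuous_on ?P (\<lambda>z. F (\<phi>' z))"
    by (rule continuous_on_compose2[OF continuous_on_subset[OF W(3) U(1)]]) (use \<phi>'U(1) in auto)
  then have "continuous_on ?P (\<lambda>z. F (\<phi>' z) / z ^ m)"
    by (intro continuous_intros) (use m in auto)
  moreover have "connected ?P"
    by (intro connected_open_diff_countable) (auto simp: countable_finite)
  moreover have "finite ((\<lambda>z. F (\<phi>' z) / z ^ m) ` ?P)"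
    by (rule finite_subset[OF _ finite_nth_roots[OF \<open>s > 0\<close>, of 1]]) (use pow in auto)
  ultimately have "(\<lambda>z. F (\<phi>' z) / z ^ m) constant_on ?P"
    using continuous_finite_range_constant by blast
  then obtain \<omega> where \<omega>: "\<And>z. z \<in> ?P \<Longrightarrow> F (\<phi>' z) / z ^ m = \<omega>"
    unfolding constant_on_def by blast
  have F: "F u = \<omega> * \<phi> u ^ m" if u: "u \<in> U" for u
  proof (cases "u = y")
    case True
    have "F y ^ s = 0" using eq[OF y(2)] y(1) m \<open>s > 0\<close> by (simp add: zero_power)
    then show ?thesis using True y(1) m by (simp add: zero_power)
  next
    case False
    have u': "\<phi>' (\<phi> u) = u" by (rule homeomorphism_apply1[OF hom u])
    then have "\<phi> u \<noteq> 0" using False \<phi>'0 by metis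
    moreover have "\<phi> u \<in> ball 0 r" using homeomorphism_image1[OF hom] u by blast
    ultimately have "F u / \<phi> u ^ m = \<omega>" using \<omega>[of "\<phi> u"] u' by simp
    then show ?thesis using \<open>\<phi> u \<noteq> 0\<close> by (simp add: field_simps)
  qed
  have "of_real (r / 2) \<in> ?P" using U(2) by auto
  then have "\<omega> ^ s = 1" using pow \<omega> by metis
  then have "\<omega> \<noteq> 0" using \<open>s > 0\<close> by (auto simp: zero_power)
  obtain \<eta> where \<eta>: "\<eta> \<noteq> 0" "\<omega> = \<eta> ^ m"
    using exists_complex_root_nonzero[of \<omega> m] \<open>\<omega> \<noteq> 0\<close> m by (metis not_gr0)
  obtain U2 D2 \<phi>2 where U2: "U2 \<subseteq> U" "chart_at Y y U2 D2 (\<lambda>v. \<eta> * \<phi> v - \<eta> * \<phi> y) \<phi>2"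
  proof (rule chart_push[OF y(3) hom open_ball y(2) open_ball order_refl])
    show "\<phi> y \<in> ball 0 r" using y U(2) by simp
    show "inj_on (\<lambda>z. \<eta> * z) (ball 0 r)" using \<eta>(1) by (simp add: inj_on_def)
    show "continuous_on (ball 0 r) (\<lambda>z. \<eta> * z)" by (intro continuous_intros)
  qed
  show ?thesis
  proof (rule power_germI[OF U2(2) m])
    show "F u = (\<eta> * \<phi> u - \<eta> * \<phi> y) ^ m" if "u \<in> U2" for u
      using F[of u] that U2(1) \<eta>(2) y(1) by (auto simp: power_mult_distrib)
  qed
qed

text \<open>
  At a zero of \<open>H\<close> the modulus of \<open>H\<close> is controlled by that of its power.
\<close>

lemma continuous_on_if_power_continuous:
  fixes H :: "'a::topological_space \<Rightarrow> complex"
  assumes pow: "continuous_on W (\<lambda>u. H u ^ s)" and nz: "continuous_on {u \<in> W. H u \<noteq> 0} H" and "s > 0"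
  shows "continuous_on W H"
  unfolding continuous_on_def
proof
  fix x assume x: "x \<in> W"
  have lim: "((\<lambda>u. H u ^ s) \<longlongrightarrow> H x ^ s) (at x within W)"
    using pow x unfolding continuous_on_def by blast
  show "(H \<longlongrightarrow> H x) (at x within W)"
  proof (cases "H x = 0")
    case True
    have "((\<lambda>u. root s (norm (H u ^ s))) \<longlongrightarrow> root s (norm (H x ^ s))) (at x within W)"
      by (intro tendsto_real_root tendsto_norm lim)
    moreover have "root s (norm (H u ^ s)) = norm (H u)" for u
      using \<open>s > 0\<close> by (simp add: norm_power real_root_power_cancel)
    ultimately show ?thesis using True \<open>s > 0\<close> by (simp add: tendsto_norm_zero_iff zero_power)
  next
    case False
    have *: "{u \<in> W. H u \<noteq> 0} = W \<inter> (\<lambda>u. H u ^ s) -` (- {0})" using \<open>s > 0\<close> by auto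
    have "openin (top_of_set W) {u \<in> W. H u \<noteq> 0}"
      unfolding * by (rule continuous_openin_preimage_gen[OF pow]) auto
    then obtain T where T: "open T" "{u \<in> W. H u \<noteq> 0} = W \<inter> T" unfolding openin_open by blast
    have "at x within W = at x within {u \<in> W. H u \<noteq> 0}"
      by (rule at_within_nhd[of x T]) (use T x False in auto)
    then show ?thesis using nz x False unfolding continuous_on_def by auto
  qed
qed

text \<open>
  Local \<open>s\<close>-th roots around the punctures suffice for a global \<open>s\<close>-th root, since the plane is simply
  connected. The proof removes one puncture \<open>z0\<close> at a time: near \<open>z0\<close> the local root is
  \<open>(z - z0) powi k * exp (L (z - z0))\<close>, and a cut-off \<open>M\<close> of \<open>L\<close> turns this into a function \<open>B\<close> that is
  defined and nonvanishing on the whole punctured plane. The quotient of \<open>F\<close> by \<open>B ^ s\<close> equals \<open>1\<close> near \<open>z0\<close>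
  and so has one puncture fewer.
\<close>

lemma punctured_plane_root:
  fixes F :: "complex \<Rightarrow> complex"
  assumes "finite Z" "s > 0" "continuous_on (- Z) F" "\<And>z. z \<notin> Z \<Longrightarrow> F z \<noteq> 0"
    and "\<And>z. z \<in> Z \<Longrightarrow> \<exists>e>0. \<exists>R. continuous_on (ball z e - {z}) R \<and> (\<forall>u\<in>ball z e - {z}. R u ^ s = F u)"
  shows "\<exists>G. continuous_on (- Z) G \<and> (\<forall>z\<in>- Z. G z ^ s = F z)"
  using assms(1,3-5)
proof (induction Z arbitrary: F rule: finite_induct)
  case empty
  have "contractible (UNIV :: complex set)" by (simp add: convex_imp_contractible)
  moreover have "continuous_on UNIV F" using empty(1) by simp
  ultimately obtain l where l: "continuous_on UNIV l" "\<And>x. F x = exp (l x)"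
    using continuous_logarithm_on_contractible[of UNIV F] empty(2) by auto
  have "exp (l z / of_nat s) ^ s = F z" for z
    using l(2)[of z] \<open>s > 0\<close> by (simp flip: exp_of_nat_mult)
  moreover have "continuous_on UNIV (\<lambda>z. exp (l z / of_nat s))"
    using l(1) \<open>s > 0\<close> by (intro continuous_intros) auto
  ultimately show ?case by (intro exI[of _ "\<lambda>z. exp (l z / of_nat s)"]) simp
next
  case (insert z0 Z)
  obtain e0 R where e0: "e0 > 0" "continuous_on (ball z0 e0 - {z0}) R"
    "\<And>u. u \<in> ball z0 e0 - {z0} \<Longrightarrow> R u ^ s = F u"
    using insert.prems(3)[of z0] by blast
  obtain e1 where e1: "e1 > 0" "\<And>z. z \<in> Z \<Longrightarrow> e1 \<le> dist z0 z"
    using finite_set_avoid[OF insert.hyps(1), of z0] insert.hyps(2) by metis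
  define e where "e = min e0 e1"
  have e: "e > 0" "e \<le> e0" "e \<le> e1" using e0 e1 unfolding e_def by auto
  let ?P = "ball (0::complex) e - {0}"
  have shift: "z0 + v \<in> ball z0 e0 - {z0}" "z0 + v \<notin> insert z0 Z" if "v \<in> ?P" for v
  proof -
    show "z0 + v \<in> ball z0 e0 - {z0}" using that e by (simp add: dist_norm)
    show "z0 + v \<notin> insert z0 Z" using e1(2)[of "z0 + v"] that e by (auto simp: dist_norm)
  qed
  have RF: "R (z0 + v) ^ s = F (z0 + v)" if "v \<in> ?P" for v using e0(3) shift(1)[OF that] by blast
  have "continuous_on ?P (\<lambda>v. R (z0 + v))"
    by (rule continuous_on_compose2[OF e0(2)]) (use shift(1) in \<open>auto intro!: continuous_intros\<close>)
  moreover have "R (z0 + v) \<noteq> 0" if "v \<in> ?P" for v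
    using RF[OF that] insert.prems(2)[OF shift(2)[OF that]] \<open>s > 0\<close> by (auto simp: zero_power)
  ultimately obtain k L where L: "continuous_on ?P L" "\<And>v. v \<in> ?P \<Longrightarrow> R (z0 + v) = v powi k * exp (L v)"
    using punctured_ball_logarithm[of e "\<lambda>v. R (z0 + v)"] by metis
  define c where "c v = min 1 (max 0 (2 - 3 * norm v / e))" for v :: complex
  define M where "M v = (if norm v < e then of_real (c v) * L v else 0)" for v
  have contM: "continuous_on (- {0}) M"
  proof -
    have "- {0} = ?P \<union> - cball 0 (2 * e / 3)" using e(1) by auto
    moreover have "continuous_on (?P \<union> - cball 0 (2 * e / 3)) M"
    proof (rule continuous_on_open_Un)
      have "continuous_on ?P (\<lambda>v. of_real (c v) * L v)"
        unfolding c_def using e(1) by (intro continuous_intros L(1)) auto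
      then show "continuous_on ?P M" by (rule continuous_on_eq) (simp add: M_def)
      have "M v = 0" if "v \<in> - cball 0 (2 * e / 3)" for v
      proof -
        have "2 - 3 * norm v / e \<le> 0" using that e(1) by (simp add: field_simps)
        then show ?thesis unfolding M_def c_def by simp
      qed
      then show "continuous_on (- cball 0 (2 * e / 3)) M"
        by (metis (no_types, lifting) continuous_on_cong continuous_on_const)
    qed (auto intro: open_Diff)
    ultimately show ?thesis by simp
  qed
  have M_near: "M v = L v" if "norm v < e / 3" for v
  proof -
    have "3 * norm v / e \<le> 1" using that e(1) by (simp add: field_simps)
    then have "c v = 1" unfolding c_def by linarith
    then show ?thesis using that e(1) unfolding M_def by simp
  qed
  define B where "B z = (z - z0) powi k * exp (M (z - z0))" for z
  have B: "continuous_on (- {z0}) B" "\<And>z. z \<noteq> z0 \<Longrightarrow> B z \<noteq> 0"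
  proof -
    have "continuous_on (- {z0}) (\<lambda>z. M (z - z0))"
      by (rule continuous_on_compose2[OF contM]) (auto intro!: continuous_intros)
    then show "continuous_on (- {z0}) B" unfolding B_def by (intro continuous_intros) auto
  qed (simp add: B_def)
  have B_near: "B z = R z" if "z \<in> ball z0 (e / 3)" "z \<noteq> z0" for z
    using L(2)[of "z - z0"] M_near[of "z - z0"] that e(1)
    by (simp add: B_def dist_norm norm_minus_commute)
  define F1 where "F1 z = (if z = z0 then 1 else F z / B z ^ s)" for z
  have F1_near: "F1 z = 1" if "z \<in> ball z0 (e / 3)" for z
  proof (cases "z = z0")
    case False
    have "R z ^ s = F z" using e0(3)[of z] that False e by auto
    moreover have "B z \<noteq> 0" using B(2) False .
    ultimately show ?thesis using False B_near[OF that] by (simp add: F1_def flip: \<open>R z ^ s = F z\<close>)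
  qed (simp add: F1_def)
  have cF1: "continuous_on (- insert z0 Z) F1"
  proof -
    have "continuous_on (- insert z0 Z) B" by (rule continuous_on_subset[OF B(1)]) auto
    then have "continuous_on (- insert z0 Z) (\<lambda>z. F z / B z ^ s)"
      using insert.prems(1) B(2) by (intro continuous_intros) auto
    then show ?thesis by (rule continuous_on_eq) (auto simp: F1_def)
  qed
  have "continuous_on (- insert z0 Z \<union> ball z0 (e / 3)) F1"
  proof (rule continuous_on_open_Un[OF _ open_ball cF1])
    show "open (- insert z0 Z)" using insert.hyps(1) by (simp add: open_Compl finite_imp_closed)
    show "continuous_on (ball z0 (e / 3)) F1"
      using F1_near by (metis (no_types, lifting) continuous_on_cong continuous_on_const)
  qed
  moreover have "- Z \<subseteq> - insert z0 Z \<union> ball z0 (e / 3)" using e(1) by auto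
  ultimately have "continuous_on (- Z) F1" by (rule continuous_on_subset)
  moreover have "F1 z \<noteq> 0" if "z \<notin> Z" for z
    using insert.prems(2)[of z] that B(2) by (simp add: F1_def)
  moreover have "\<exists>e>0. \<exists>R. continuous_on (ball z e - {z}) R \<and> (\<forall>u\<in>ball z e - {z}. R u ^ s = F1 u)"
    if z: "z \<in> Z" for z
  proof -
    obtain d R' where d: "d > 0" "continuous_on (ball z d - {z}) R'"
      "\<And>u. u \<in> ball z d - {z} \<Longrightarrow> R' u ^ s = F u" using insert.prems(3)[of z] z by blast
    have "z \<noteq> z0" using z insert.hyps by auto
    let ?d = "min d (dist z z0)"
    have *: "ball z ?d - {z} \<subseteq> ball z d - {z}" "ball z ?d - {z} \<subseteq> - {z0}" by auto
    have "continuous_on (ball z ?d - {z}) (\<lambda>u. R' u / B u)"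
    proof (rule continuous_on_divide[OF continuous_on_subset[OF d(2) *(1)] continuous_on_subset[OF B(1) *(2)]])
      show "\<forall>u\<in>ball z ?d - {z}. B u \<noteq> 0" using B(2) *(2) by blast
    qed
    moreover have "(R' u / B u) ^ s = F1 u" if "u \<in> ball z ?d - {z}" for u
    proof -
      have "u \<noteq> z0" "R' u ^ s = F u" using d(3)[of u] * that by auto
      then show ?thesis by (simp add: F1_def power_divide)
    qed
    moreover have "?d > 0" using d(1) \<open>z \<noteq> z0\<close> by simp
    ultimately show ?thesis by blast
  qed
  ultimately obtain G where G: "continuous_on (- Z) G" "\<And>z. z \<in> - Z \<Longrightarrow> G z ^ s = F1 z"
    using insert.IH[of F1] by blast
  have "continuous_on (- insert z0 Z) (\<lambda>z. G z * B z)"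
    by (intro continuous_intros continuous_on_subset[OF G(1)] continuous_on_subset[OF B(1)]) auto
  moreover have "(G z * B z) ^ s = F z" if "z \<in> - insert z0 Z" for z
    using G(2)[of z] B(2)[of z] that by (simp add: F1_def power_mult_distrib)
  ultimately show ?case by (intro exI[of _ "\<lambda>z. G z * B z"]) auto
qed

section \<open>Coordinates on the sphere\<close>

text \<open>
  The sphere is treated as the Riemann sphere: \<open>\<sigma>\<close> is a topological coordinate with pole at \<open>N\<close>.
\<close>

locale sphere_coordinate =
  fixes N :: "real ^ 3" and \<sigma> :: "real ^ 3 \<Rightarrow> complex" and \<tau> :: "complex \<Rightarrow> real ^ 3"
  assumes N: "N \<in> S2" and coord: "homeomorphism (S2 - {N}) UNIV \<sigma> \<tau>"
begin

abbreviation "Z \<equiv> \<tau> 0"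

text \<open>
  The map \<open>z \<mapsto> z ^ s\<close> in the coordinate \<open>\<sigma>\<close>, used for source and target alike. For \<open>s > 0\<close> it fixes the zero and the pole of \<open>\<sigma>\<close>.
\<close>

definition sphere_power :: "nat \<Rightarrow> real ^ 3 \<Rightarrow> real ^ 3" where
  "sphere_power s x = (if x = N then N else \<tau> (\<sigma> x ^ s))"

lemma tau [simp]: "\<tau> z \<in> S2" "\<tau> z \<noteq> N" "\<sigma> (\<tau> z) = z"
proof -
  have "\<tau> z \<in> S2 - {N}" using homeomorphism_image2[OF coord] by blast
  then show "\<tau> z \<in> S2" "\<tau> z \<noteq> N" by blast+
  show "\<sigma> (\<tau> z) = z" using homeomorphism_apply2[OF coord] by simp
qed

lemma norm_tau [simp]: "norm (\<tau> z) = 1" using tau(1)[of z] by simp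

lemma N_neq_tau [simp]: "N \<noteq> \<tau> z"
  using tau(2) by (rule not_sym)

lemma tau_sigma: "x \<in> S2 \<Longrightarrow> x \<noteq> N \<Longrightarrow> \<tau> (\<sigma> x) = x"
  using homeomorphism_apply1[OF coord] by auto

lemma sigma_eq_0_iff: "x \<in> S2 \<Longrightarrow> x \<noteq> N \<Longrightarrow> \<sigma> x = 0 \<longleftrightarrow> x = Z"
  using tau_sigma tau(3) by metis

lemma sigma_inj: "x \<in> S2 \<Longrightarrow> y \<in> S2 \<Longrightarrow> x \<noteq> N \<Longrightarrow> y \<noteq> N \<Longrightarrow> \<sigma> x = \<sigma> y \<Longrightarrow> x = y"
  using tau_sigma by metis

lemma continuous_on_sigma: "continuous_on (S2 - {N}) \<sigma>"
  using coord homeomorphism_def by blast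

lemma continuous_on_tau: "continuous_on A \<tau>"
  using coord homeomorphism_def continuous_on_subset subset_UNIV by metis

lemma openin_punctured: "openin (top_of_set S2) (S2 - {x})"
  by (metis Diff_Diff_Int Int_commute finite.emptyI finite_imp_closed finite_insert openin_open_Int open_Compl Diff_eq)

lemma chart_at_Z: "chart_at S2 Z (S2 - {N}) UNIV \<sigma> \<tau>"
  unfolding chart_at_def using openin_punctured coord by simp

text \<open>
  These are the neighbourhoods of \<open>N\<close> complementary to the compact discs of the coordinate.
\<close>

lemma openin_far: "openin (top_of_set S2) {x \<in> S2. x = N \<or> norm (\<sigma> x) > R}"
proof -
  have "compact (\<tau> ` cball 0 R)" by (intro compact_continuous_image continuous_on_tau) simp
  then have "closed (\<tau> ` cball 0 R)" by (rule compact_imp_closed)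
  then have "openin (top_of_set S2) (S2 \<inter> - \<tau> ` cball 0 R)" by (simp add: openin_open_Int open_Compl)
  moreover have "S2 \<inter> - \<tau> ` cball 0 R = {x \<in> S2. x = N \<or> norm (\<sigma> x) > R}"
  proof (intro equalityI subsetI)
    fix x assume x: "x \<in> S2 \<inter> - \<tau> ` cball 0 R"
    then have "x = N \<or> \<sigma> x \<notin> cball 0 R" using tau_sigma[of x] by (metis ComplD IntD1 IntD2 image_eqI)
    then show "x \<in> {x \<in> S2. x = N \<or> norm (\<sigma> x) > R}" using x by auto
  next
    fix x assume "x \<in> {x \<in> S2. x = N \<or> norm (\<sigma> x) > R}"
    then show "x \<in> S2 \<inter> - \<tau> ` cball 0 R" using N by auto
  qed
  ultimately show ?thesis by simp
qed

text \<open>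
  The coordinate \<open>1 / \<sigma>\<close>, which is centred at \<open>N\<close>.
\<close>

definition \<sigma>\<^sub>N :: "real ^ 3 \<Rightarrow> complex" where
  "\<sigma>\<^sub>N x = (if x = N then 0 else inverse (\<sigma> x))"

lemma sigma_N_eq_0_iff: "x \<in> S2 - {Z} \<Longrightarrow> \<sigma>\<^sub>N x = 0 \<longleftrightarrow> x = N"
  using sigma_eq_0_iff by (auto simp: \<sigma>\<^sub>N_def)

lemma inj_on_sigma_N: "inj_on \<sigma>\<^sub>N (S2 - {Z})"
proof (rule inj_onI)
  fix x y assume xy: "x \<in> S2 - {Z}" "y \<in> S2 - {Z}" "\<sigma>\<^sub>N x = \<sigma>\<^sub>N y"
  show "x = y"
  proof (cases "x = N \<or> y = N")
    case True
    then show ?thesis using xy sigma_N_eq_0_iff by metis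
  next
    case False
    then show ?thesis using xy sigma_inj by (auto simp: \<sigma>\<^sub>N_def)
  qed
qed

lemma continuous_on_sigma_N: "continuous_on (S2 - {Z}) \<sigma>\<^sub>N"
  unfolding continuous_on_def
proof
  fix x assume x: "x \<in> S2 - {Z}"
  show "(\<sigma>\<^sub>N \<longlongrightarrow> \<sigma>\<^sub>N x) (at x within S2 - {Z})"
  proof (cases "x = N")
    case True
    have "\<forall>\<^sub>F u in at x within S2 - {Z}. dist (\<sigma>\<^sub>N u) 0 < e" if "e > 0" for e
    proof -
      obtain T where T: "open T" "{x \<in> S2. x = N \<or> norm (\<sigma> x) > inverse e} = S2 \<inter> T"
        using openin_far[of "inverse e"] unfolding openin_open by blast
      have "N \<in> T" using T(2) N by blast
      then have "\<forall>\<^sub>F u in at x within S2 - {Z}. u \<in> T \<and> u \<in> S2 - {Z}"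
        using T(1) True by (auto simp: eventually_at_topological)
      then show ?thesis
      proof eventually_elim
        case (elim u)
        then have "u = N \<or> norm (\<sigma> u) > inverse e" using T(2) by blast
        then show ?case
          using that by (auto simp: \<sigma>\<^sub>N_def norm_inverse inverse_less_imp_less)
      qed
    qed
    then show ?thesis using True by (simp add: \<sigma>\<^sub>N_def tendsto_iff)
  next
    case False
    have "continuous_on (S2 - {N} - {Z}) (\<lambda>x. inverse (\<sigma> x))"
      using sigma_eq_0_iff continuous_on_subset[OF continuous_on_sigma]
      by (intro continuous_intros) auto
    then have "continuous_on (S2 - {N} - {Z}) \<sigma>\<^sub>N"
      by (rule continuous_on_eq) (auto simp: \<sigma>\<^sub>N_def)
    moreover have "at x within S2 - {Z} = at x within (S2 - {N} - {Z})"
      by (rule at_within_nhd[of x "- {N}"]) (use False in auto)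
    ultimately show ?thesis using x False unfolding continuous_on_def by auto
  qed
qed

end

lemma sphere_coordinate_exists:
  assumes "N \<in> S2"
  obtains \<sigma> \<tau> where "sphere_coordinate N \<sigma> \<tau>"
proof -
  have "aff_dim {x :: real ^ 3. axis 1 1 \<bullet> x = 0} = 2"
    by (simp add: aff_dim_hyperplane)
  moreover have "aff_dim (UNIV :: complex set) = 2" by (simp add: aff_dim_UNIV)
  ultimately have "{x :: real ^ 3. axis 1 1 \<bullet> x = 0} homeomorphic (UNIV :: complex set)"
    by (intro homeomorphic_affine_sets) (auto simp: affine_hyperplane)
  moreover have "S2 - {N} homeomorphic {x :: real ^ 3. axis 1 1 \<bullet> x = 0}"
    using assms by (intro homeomorphic_punctured_sphere_hyperplane) (auto simp: axis_eq_0_iff)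
  ultimately have "S2 - {N} homeomorphic (UNIV :: complex set)" by (rule homeomorphic_trans[rotated])
  then show ?thesis using that assms unfolding homeomorphic_def sphere_coordinate_def by blast
qed

text \<open>
  Any coordinate can be followed by a homeomorphism of the plane, and these act transitively on
  tuples of distinct points.
\<close>

lemma sphere_coordinate_through_points:
  fixes q :: "'i \<Rightarrow> real ^ 3" and t :: "'i \<Rightarrow> complex"
  assumes "N \<in> S2" "finite I" "inj_on q I" "q ` I \<subseteq> S2 - {N}" "inj_on t I"
  obtains \<sigma> \<tau> where "sphere_coordinate N \<sigma> \<tau>" "\<And>i. i \<in> I \<Longrightarrow> \<sigma> (q i) = t i"
proof -
  obtain \<sigma> \<tau> where "sphere_coordinate N \<sigma> \<tau>" using sphere_coordinate_exists[OF assms(1)] .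
  then interpret sphere_coordinate N \<sigma> \<tau> .
  have pw: "pairwise (\<lambda>i j. \<sigma> (q i) \<noteq> \<sigma> (q j) \<and> t i \<noteq> t j) I"
    unfolding pairwise_def
  proof (intro ballI impI)
    fix i j assume ij: "i \<in> I" "j \<in> I" "i \<noteq> j"
    then have "q i \<noteq> q j" "t i \<noteq> t j" using assms(3,5) by (auto dest: inj_onD)
    then show "\<sigma> (q i) \<noteq> \<sigma> (q j) \<and> t i \<noteq> t j" using sigma_inj[of "q i" "q j"] ij assms(4) by blast
  qed
  obtain \<theta> \<theta>' where \<theta>: "homeomorphism UNIV UNIV \<theta> \<theta>'" "\<And>i. i \<in> I \<Longrightarrow> \<theta> (\<sigma> (q i)) = t i"
    by (rule homeomorphism_moving_points_exists[of UNIV UNIV I "\<lambda>i. \<sigma> (q i)" t, OF _ _ _ _ assms(2) _ pw])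
      auto
  have "sphere_coordinate N (\<theta> \<circ> \<sigma>) (\<tau> \<circ> \<theta>')"
    unfolding sphere_coordinate_def using assms(1) homeomorphism_compose[OF coord \<theta>(1)] by blast
  then show ?thesis using that \<theta>(2) by simp
qed

context sphere_coordinate
begin

text \<open>
  The function \<open>1 / \<sigma>\<close> is a continuous bijection; that its inverse is continuous follows from invariance
  of domain after comparison with a coordinate whose pole is the zero of \<open>\<sigma>\<close>.
\<close>

lemma chart_at_N:
  obtains \<tau>\<^sub>N where "chart_at S2 N (S2 - {Z}) UNIV \<sigma>\<^sub>N \<tau>\<^sub>N"
proof -
  obtain \<sigma>2 \<tau>2 where "sphere_coordinate Z \<sigma>2 \<tau>2" using sphere_coordinate_exists tau(1) by metis
  then interpret c2: sphere_coordinate Z \<sigma>2 \<tau>2 .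
  let ?q = "\<sigma>\<^sub>N \<circ> \<tau>2"
  have cont: "continuous_on UNIV ?q"
    by (rule continuous_on_compose[OF c2.continuous_on_tau continuous_on_subset[OF continuous_on_sigma_N]])
      (use c2.tau in auto)
  have inj: "inj_on ?q UNIV"
    using c2.tau(1,2) inj_onD[OF inj_on_sigma_N] c2.tau(3) by (intro inj_onI) (metis comp_apply Diff_iff singletonD)
  have surj: "range ?q = UNIV"
  proof -
    have "z \<in> range ?q" for z
    proof -
      let ?x = "if z = 0 then N else \<tau> (inverse z)"
      have x: "?x \<in> S2 - {Z}" using N tau tau(2)[of 0] by (metis Diff_iff inverse_zero_imp_zero singletonD)
      have "\<sigma>\<^sub>N ?x = z" by (simp add: \<sigma>\<^sub>N_def)
      then have "?q (\<sigma>2 ?x) = z" using c2.tau_sigma[of ?x] x by auto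
      then show ?thesis by (metis rangeI)
    qed
    then show ?thesis by blast
  qed
  obtain q' where "homeomorphism UNIV (range ?q) ?q q'"
    using invariance_of_domain_homeomorphism[OF open_UNIV cont order_refl inj] by metis
  then have "homeomorphism UNIV UNIV ?q q'" unfolding surj .
  then have hom: "homeomorphism (S2 - {Z}) UNIV (?q \<circ> \<sigma>2) (\<tau>2 \<circ> q')"
    using homeomorphism_compose[OF c2.coord] by blast
  have "\<sigma>\<^sub>N x = (?q \<circ> \<sigma>2) x" if "x \<in> S2 - {Z}" for x
    using c2.tau_sigma[of x] that by auto
  then have "homeomorphism (S2 - {Z}) UNIV \<sigma>\<^sub>N (\<tau>2 \<circ> q')"
    using homeomorphism_cong[OF hom refl refl] by blast
  then show ?thesis using that openin_punctured N tau(2)[of 0]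
    unfolding chart_at_def by (auto simp: \<sigma>\<^sub>N_def)
qed

end

section \<open>The power map of the sphere\<close>

lemma power_model_at_iff_germ:
  assumes "continuous_on Y f" "f ` Y \<subseteq> X" "chart_at X (f y) V E \<kappa> \<kappa>'"
  shows "power_model_at Y X f y m \<longleftrightarrow> power_germ Y (\<lambda>u. \<kappa> (f u)) y m"
  using power_model_atI[where f = f and y = y, OF assms] power_germ_if_power_model_at[where f = f and y = y, OF _ assms(3)] by blast

lemma power_germ_power_iff:
  assumes "s > 0" "openin (top_of_set Y) W" "y \<in> W" "continuous_on W F"
  shows "power_germ Y (\<lambda>u. F u ^ s) y (s * m) \<longleftrightarrow> power_germ Y F y m"
  using power_germ_power power_germ_root[OF _ assms] assms(1) by blast

lemma power_germ_cong_iff: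
  assumes "openin (top_of_set Y) W" "y \<in> W" "\<And>u. u \<in> W \<Longrightarrow> F' u = F u"
  shows "power_germ Y F' y m \<longleftrightarrow> power_germ Y F y m"
proof
  assume "power_germ Y F' y m"
  then show "power_germ Y F y m" by (rule power_germ_cong[OF _ assms(1,2)]) (simp add: assms(3))
next
  assume "power_germ Y F y m"
  then show "power_germ Y F' y m" by (rule power_germ_cong[OF _ assms])
qed

lemma bij_betw_roots:
  fixes c :: complex
  assumes "c \<noteq> 0" "s > 0"
  shows "bij_betw (\<lambda>j. c * cis (2 * pi * real j / real s)) {1..s} {z. z ^ s = c ^ s}"
proof -
  define w where "w = cis (2 * pi / real s)"
  have "real s * (2 * pi / real s) = 2 * pi" using assms(2) by simp
  then have "w ^ s = cis (2 * pi)" unfolding w_def Complex.DeMoivre by (rule arg_cong)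
  then have w1: "w ^ s = 1" by simp
  have w0: "w \<noteq> 0" by (simp add: w_def)
  have "bij_betw (\<lambda>j. j - 1) {1..s} {..<s}"
    by (rule bij_betw_byWitness[where f' = Suc]) auto
  then have 1: "bij_betw ((\<lambda>k. cis (2 * pi * real k / real s)) \<circ> (\<lambda>j. j - 1)) {1..s} {z. z ^ s = 1}"
    using Complex.bij_betw_roots_unity[OF assms(2)] by (rule bij_betw_trans)
  have "bij_betw (\<lambda>z. c * w * z) {z. z ^ s = 1} {z. z ^ s = c ^ s}"
    by (rule bij_betw_byWitness[where f' = "\<lambda>z. z / (c * w)"])
      (use assms w1 w0 in \<open>auto simp: power_mult_distrib power_divide\<close>)
  from bij_betw_trans[OF 1 this]
  have "bij_betw ((\<lambda>z. c * w * z) \<circ> ((\<lambda>k. cis (2 * pi * real k / real s)) \<circ> (\<lambda>j. j - 1))) {1..s} {z. z ^ s = c ^ s}" .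
  moreover have "((\<lambda>z. c * w * z) \<circ> ((\<lambda>k. cis (2 * pi * real k / real s)) \<circ> (\<lambda>j. j - 1))) j
      = c * cis (2 * pi * real j / real s)" if "j \<in> {1..s}" for j
  proof -
    have "2 * pi / real s + 2 * pi * real (j - 1) / real s = 2 * pi * real j / real s"
      using that by (simp add: of_nat_diff field_simps)
    then show ?thesis by (simp add: w_def cis_mult mult.assoc)
  qed
  ultimately show ?thesis by (subst bij_betw_cong[symmetric]) auto
qed

context sphere_coordinate
begin

lemma sphere_power_in_S2: "x \<in> S2 \<Longrightarrow> sphere_power s x \<in> S2"
  using N tau(1) by (simp add: sphere_power_def)

lemma sphere_power_eq_N_iff [simp]: "sphere_power s x = N \<longleftrightarrow> x = N"
  by (simp add: sphere_power_def)

lemma sigma_sphere_power: "x \<noteq> N \<Longrightarrow> \<sigma> (sphere_power s x) = \<sigma> x ^ s"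
  by (simp add: sphere_power_def)

lemma sigma_N_sphere_power: "s > 0 \<Longrightarrow> \<sigma>\<^sub>N (sphere_power s x) = \<sigma>\<^sub>N x ^ s"
  by (simp add: sphere_power_def \<sigma>\<^sub>N_def zero_power power_inverse)

lemma sphere_power_eq_Z_iff:
  assumes "x \<in> S2" "s > 0"
  shows "sphere_power s x = Z \<longleftrightarrow> x = Z"
proof (cases "x = N")
  case False
  then have "sphere_power s x = Z \<longleftrightarrow> \<sigma> (sphere_power s x) = 0"
    using sigma_eq_0_iff[OF sphere_power_in_S2] assms by simp
  also have "\<dots> \<longleftrightarrow> \<sigma> x = 0" using False assms by (simp add: sigma_sphere_power)
  finally show ?thesis using sigma_eq_0_iff assms False by simp
qed (simp add: sphere_power_def)

lemma bij_betw_sphere_power_fibre: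
  assumes "c \<noteq> 0" "s > 0"
  shows "bij_betw (\<lambda>j. \<tau> (c * cis (2 * pi * real j / real s))) {1..s} {p \<in> S2. sphere_power s p = \<tau> (c ^ s)}"
proof -
  have "bij_betw \<tau> {z. z ^ s = c ^ s} {p \<in> S2. sphere_power s p = \<tau> (c ^ s)}"
  proof (rule bij_betw_byWitness[where f' = \<sigma>])
    show "\<forall>p\<in>{p \<in> S2. sphere_power s p = \<tau> (c ^ s)}. \<tau> (\<sigma> p) = p"
      using tau_sigma by (auto simp: sphere_power_def)
    show "\<tau> ` {z. z ^ s = c ^ s} \<subseteq> {p \<in> S2. sphere_power s p = \<tau> (c ^ s)}"
      by (auto simp: sphere_power_def)
    show "\<sigma> ` {p \<in> S2. sphere_power s p = \<tau> (c ^ s)} \<subseteq> {z. z ^ s = c ^ s}"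
    proof (rule image_subsetI)
      fix p assume p: "p \<in> {p \<in> S2. sphere_power s p = \<tau> (c ^ s)}"
      then have "p \<noteq> N" by (auto simp: sphere_power_def)
      then have "\<sigma> p ^ s = \<sigma> (\<tau> (c ^ s))" using p sigma_sphere_power by (metis (mono_tags) mem_Collect_eq)
      then show "\<sigma> p \<in> {z. z ^ s = c ^ s}" by simp
    qed
  qed simp
  from bij_betw_trans[OF bij_betw_roots[OF assms] this] show ?thesis by (simp add: comp_def)
qed

text \<open>
  The two parts of \<open>A\<close> are open in \<open>A\<close> and cover it; on each of them one coordinate of the sphere is available.
\<close>

lemma continuous_on_via_sphere:
  "continuous_on (A \<inter> g -` (S2 - {N})) f \<Longrightarrow> continuous_on (A \<inter> g -` (S2 - {Z})) f
    \<Longrightarrow> continuous_on A g \<Longrightarrow> g ` A \<subseteq> S2 \<Longrightarrow> continuous_on A f"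
proof -
  assume f: "continuous_on (A \<inter> g -` (S2 - {N})) f" "continuous_on (A \<inter> g -` (S2 - {Z})) f"
    and g: "continuous_on A g" "g ` A \<subseteq> S2"
  have op: "openin (top_of_set A) (A \<inter> g -` (S2 - {x}))" for x
    using continuous_openin_preimage[OF g(1) _ openin_punctured] g(2) by blast
  have A: "A \<inter> g -` (S2 - {N}) \<union> A \<inter> g -` (S2 - {Z}) = A" using g(2) tau(2)[of 0] by auto
  show ?thesis using continuous_on_Un_local_open[OF _ _ f] op A by metis
qed

lemma continuous_on_sphere_power:
  assumes "s > 0"
  shows "continuous_on S2 (sphere_power s)"
proof (rule continuous_on_via_sphere[where g = "\<lambda>x. x"])
  have "continuous_on (S2 - {N}) (\<lambda>x. \<sigma> x ^ s)" by (intro continuous_intros continuous_on_sigma)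
  then have "continuous_on (S2 - {N}) (\<lambda>x. \<tau> (\<sigma> x ^ s))"
    by (rule continuous_on_compose2[OF continuous_on_tau]) auto
  then have "continuous_on (S2 - {N}) (sphere_power s)"
    by (rule continuous_on_eq) (auto simp: sphere_power_def)
  then show "continuous_on (S2 \<inter> (\<lambda>x. x) -` (S2 - {N})) (sphere_power s)"
    by (rule continuous_on_subset) auto
  obtain \<tau>\<^sub>N where "chart_at S2 N (S2 - {Z}) UNIV \<sigma>\<^sub>N \<tau>\<^sub>N" by (rule chart_at_N)
  then have hom: "homeomorphism (S2 - {Z}) UNIV \<sigma>\<^sub>N \<tau>\<^sub>N" unfolding chart_at_def by blast
  have "continuous_on (S2 - {Z}) (\<lambda>x. \<sigma>\<^sub>N x ^ s)" by (intro continuous_intros continuous_on_sigma_N)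
  moreover have "continuous_on UNIV \<tau>\<^sub>N" using hom homeomorphism_def by blast
  ultimately have "continuous_on (S2 - {Z}) (\<lambda>x. \<tau>\<^sub>N (\<sigma>\<^sub>N x ^ s))"
    using continuous_on_compose2[of UNIV \<tau>\<^sub>N "S2 - {Z}" "\<lambda>x. \<sigma>\<^sub>N x ^ s"] by blast
  moreover have "\<tau>\<^sub>N (\<sigma>\<^sub>N x ^ s) = sphere_power s x" if "x \<in> S2 - {Z}" for x
  proof -
    have "sphere_power s x \<in> S2 - {Z}"
      using that sphere_power_in_S2 sphere_power_eq_Z_iff[OF _ assms] by blast
    then show ?thesis
      using homeomorphism_apply1[OF hom] sigma_N_sphere_power[OF assms] by metis
  qed
  ultimately have "continuous_on (S2 - {Z}) (sphere_power s)" by (rule continuous_on_eq)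
  then show "continuous_on (S2 \<inter> (\<lambda>x. x) -` (S2 - {Z})) (sphere_power s)"
    by (rule continuous_on_subset) auto
qed (auto intro: continuous_on_id)

text \<open>
  In the coordinates \<open>\<sigma>\<close> and \<open>1 / \<sigma>\<close>, centred at the zero and the pole, the composite is the \<open>s\<close>-th
  power of \<open>g\<close>. Elsewhere the power map is a local homeomorphism, so charts of its target serve as
  charts of its source. The equivalence gives both the exponents of a composite and those of a factor.
\<close>

lemma power_model_at_sphere_power:
  assumes g: "continuous_on Y g" "g ` Y \<subseteq> S2" and y: "y \<in> Y" and s: "s > 0"
  shows "power_model_at Y S2 (\<lambda>u. sphere_power s (g u)) y (if g y \<in> {Z, N} then s * m else m)
    \<longleftrightarrow> power_model_at Y S2 g y m"
proof -
  let ?f = "\<lambda>u. sphere_power s (g u)"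
  have f: "continuous_on Y ?f" "?f ` Y \<subseteq> S2"
    using continuous_on_compose2[OF continuous_on_sphere_power[OF s] g] g(2) sphere_power_in_S2 by blast+
  have gy: "g y \<in> S2" using g(2) y by blast
  have W: "openin (top_of_set Y) (Y \<inter> g -` (S2 - {x}))" for x
    using continuous_openin_preimage[OF g(1) _ openin_punctured] g(2) by blast
  have contW: "continuous_on (Y \<inter> g -` (S2 - {N})) (\<lambda>u. \<sigma> (g u))"
    by (rule continuous_on_compose2[OF continuous_on_sigma continuous_on_subset[OF g(1)]]) auto
  consider "g y = Z" | "g y = N" | "g y \<noteq> Z" "g y \<noteq> N" by blast
  then show ?thesis
  proof cases
    case 1
    have yW: "y \<in> Y \<inter> g -` (S2 - {N})" using y gy 1 by simp
    have fy: "?f y = Z" using 1 gy s by (simp add: sphere_power_eq_Z_iff)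
    have "power_model_at Y S2 ?f y (s * m) \<longleftrightarrow> power_germ Y (\<lambda>u. \<sigma> (?f u)) y (s * m)"
      by (rule power_model_at_iff_germ[where f = ?f and y = y, OF f]) (unfold fy, rule chart_at_Z)
    also have "\<dots> \<longleftrightarrow> power_germ Y (\<lambda>u. \<sigma> (g u) ^ s) y (s * m)"
      by (rule power_germ_cong_iff[OF W yW]) (simp add: sigma_sphere_power)
    also have "\<dots> \<longleftrightarrow> power_germ Y (\<lambda>u. \<sigma> (g u)) y m"
      by (rule power_germ_power_iff[OF s W yW contW])
    also have "\<dots> \<longleftrightarrow> power_model_at Y S2 g y m"
      by (rule power_model_at_iff_germ[where f = g and y = y, OF g, symmetric]) (unfold 1, rule chart_at_Z)
    finally show ?thesis using 1 by simp
  next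
    case 2
    obtain \<tau>\<^sub>N where \<tau>\<^sub>N: "chart_at S2 N (S2 - {Z}) UNIV \<sigma>\<^sub>N \<tau>\<^sub>N" by (rule chart_at_N)
    have yW: "y \<in> Y \<inter> g -` (S2 - {Z})" using y gy 2 by simp
    have contW': "continuous_on (Y \<inter> g -` (S2 - {Z})) (\<lambda>u. \<sigma>\<^sub>N (g u))"
      by (rule continuous_on_compose2[OF continuous_on_sigma_N continuous_on_subset[OF g(1)]]) auto
    have fy: "?f y = N" using 2 by simp
    have "power_model_at Y S2 ?f y (s * m) \<longleftrightarrow> power_germ Y (\<lambda>u. \<sigma>\<^sub>N (?f u)) y (s * m)"
      by (rule power_model_at_iff_germ[where f = ?f and y = y, OF f]) (unfold fy, rule \<tau>\<^sub>N)
    also have "\<dots> \<longleftrightarrow> power_germ Y (\<lambda>u. \<sigma>\<^sub>N (g u) ^ s) y (s * m)"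
      by (simp add: sigma_N_sphere_power[OF s])
    also have "\<dots> \<longleftrightarrow> power_germ Y (\<lambda>u. \<sigma>\<^sub>N (g u)) y m"
      by (rule power_germ_power_iff[OF s W yW contW'])
    also have "\<dots> \<longleftrightarrow> power_model_at Y S2 g y m"
      by (rule power_model_at_iff_germ[where f = g and y = y, OF g, symmetric]) (unfold 2, rule \<tau>\<^sub>N)
    finally show ?thesis using 2 by simp
  next
    case 3
    have yW: "y \<in> Y \<inter> g -` (S2 - {N})" using y gy 3 by simp
    have gy': "g y \<in> S2 - {N}" "?f y \<in> S2 - {N}" using gy 3 sphere_power_in_S2 by auto
    have nz: "\<sigma> (g y) \<noteq> 0" using sigma_eq_0_iff[OF gy] 3 by simp
    obtain \<epsilon> where \<epsilon>: "\<epsilon> > 0" "inj_on (\<lambda>z. z ^ s) (ball (\<sigma> (g y)) \<epsilon>)"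
      using power_locally_inj[OF nz s] by blast
    have cb: "continuous_on (ball (\<sigma> (g y)) \<epsilon>) (\<lambda>z. z ^ s)" by (intro continuous_intros)
    obtain V D \<kappa>' where \<kappa>: "chart_at S2 (g y) V D (\<lambda>x. \<sigma> x ^ s - \<sigma> (g y) ^ s) \<kappa>'"
      by (rule chart_push[OF openin_punctured coord open_UNIV gy'(1) open_ball subset_UNIV _ cb \<epsilon>(2)])
        (use \<epsilon>(1) in auto)
    obtain V' D' \<kappa>'' where \<kappa>': "chart_at S2 (?f y) V' D' (\<lambda>x. \<sigma> x - \<sigma> (?f y)) \<kappa>''"
      by (rule chart_push[OF openin_punctured coord open_UNIV gy'(2) open_UNIV subset_UNIV UNIV_I
            continuous_on_id inj_on_id2])
    have "power_model_at Y S2 ?f y m \<longleftrightarrow> power_germ Y (\<lambda>u. \<sigma> (?f u) - \<sigma> (?f y)) y m"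
      by (rule power_model_at_iff_germ[where f = ?f and y = y, OF f \<kappa>'])
    also have "\<dots> \<longleftrightarrow> power_germ Y (\<lambda>u. \<sigma> (g u) ^ s - \<sigma> (g y) ^ s) y m"
      by (rule power_germ_cong_iff[OF W yW]) (use 3 in \<open>simp add: sigma_sphere_power\<close>)
    also have "\<dots> \<longleftrightarrow> power_model_at Y S2 g y m"
      by (rule power_model_at_iff_germ[where f = g and y = y, OF g \<kappa>, symmetric])
    finally show ?thesis using 3 by simp
  qed
qed

end

section \<open>Dividing a branched map by the power map\<close>

context sphere_coordinate
begin

text \<open>
  If \<open>\<sigma> (f u)\<close> or its inverse is \<open>\<phi> u ^ (m * s)\<close>, then \<open>\<phi> u ^ m\<close> or its inverse is an \<open>s\<close>-th root.
\<close>

lemma local_root_over_poles: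
  assumes f: "branched_map S2 S2 f" and y: "y \<in> S2" "f y \<in> {Z, N}"
    and dvd: "s dvd local_degree S2 S2 f y"
  obtains U R where "openin (top_of_set S2) U" "y \<in> U" "continuous_on (U - {y}) R"
    "\<And>u. u \<in> U - {y} \<Longrightarrow> R u ^ s = \<sigma> (f u)"
proof -
  obtain m where m: "local_degree S2 S2 f y = m * s" using dvd by (metis dvd_def mult.commute)
  have model: "power_model_at S2 S2 f y (m * s)" using branched_map_model[OF f y(1)] unfolding m .
  have f': "continuous_on S2 f" "f ` S2 \<subseteq> S2"
    using branched_map_continuous[OF f] f unfolding branched_map_def by auto
  have W: "openin (top_of_set S2) (S2 \<inter> f -` (S2 - {x}))" for x
    using continuous_openin_preimage[OF f'(1) _ openin_punctured] f'(2) by blast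
  have fy: "f y \<in> S2" using f'(2) y(1) by blast
  have off_centre: "\<phi> u \<noteq> 0" if "chart_at S2 y U (ball 0 r) \<phi> \<phi>'" "u \<in> U - {y}" for U r \<phi> \<phi>' u
    using that homeomorphism_apply1[of U "ball 0 r" \<phi> \<phi>'] unfolding chart_at_def by (metis Diff_iff singletonI)
  have cont: "continuous_on (U - {y}) \<phi>" if "chart_at S2 y U (ball 0 r) \<phi> \<phi>'" for U r \<phi> \<phi>'
    using that continuous_on_subset[of U \<phi> "U - {y}"] unfolding chart_at_def homeomorphism_def by blast
  show ?thesis
  proof (cases "f y = N")
    case False
    then have fyZ: "f y = Z" using y by auto
    have yW: "y \<in> S2 \<inter> f -` (S2 - {N})" using y(1) fy False by simp
    have "power_germ S2 (\<lambda>u. \<sigma> (f u)) y (m * s)"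
      by (rule power_germ_if_power_model_at[where f = f and y = y, OF model]) (unfold fyZ, rule chart_at_Z)
    then obtain U r \<phi> \<phi>' where U: "U \<subseteq> S2 \<inter> f -` (S2 - {N})" "r > 0" "chart_at S2 y U (ball 0 r) \<phi> \<phi>'"
      "\<And>u. u \<in> U \<Longrightarrow> \<sigma> (f u) = \<phi> u ^ (m * s)"
      by (rule power_germE[OF _ W yW]) blast
    show ?thesis
    proof (rule that[of U "\<lambda>u. \<phi> u ^ m"])
      show "continuous_on (U - {y}) (\<lambda>u. \<phi> u ^ m)" by (intro continuous_intros cont[OF U(3)])
      show "(\<phi> u ^ m) ^ s = \<sigma> (f u)" if "u \<in> U - {y}" for u
        using U(4)[of u] that by (simp add: power_mult)
    qed (use U(3) in \<open>auto simp: chart_at_def\<close>)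
  next
    case True
    obtain \<tau>\<^sub>N where \<tau>\<^sub>N: "chart_at S2 N (S2 - {Z}) UNIV \<sigma>\<^sub>N \<tau>\<^sub>N" by (rule chart_at_N)
    have yW: "y \<in> S2 \<inter> f -` (S2 - {Z})" using y(1) fy True by simp
    have "power_germ S2 (\<lambda>u. \<sigma>\<^sub>N (f u)) y (m * s)"
      by (rule power_germ_if_power_model_at[where f = f and y = y, OF model]) (unfold True, rule \<tau>\<^sub>N)
    then obtain U r \<phi> \<phi>' where U: "U \<subseteq> S2 \<inter> f -` (S2 - {Z})" "r > 0" "chart_at S2 y U (ball 0 r) \<phi> \<phi>'"
      "\<And>u. u \<in> U \<Longrightarrow> \<sigma>\<^sub>N (f u) = \<phi> u ^ (m * s)"
      by (rule power_germE[OF _ W yW]) blast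
    show ?thesis
    proof (rule that[of U "\<lambda>u. inverse (\<phi> u ^ m)"])
      show "continuous_on (U - {y}) (\<lambda>u. inverse (\<phi> u ^ m))"
        using off_centre[OF U(3)] by (intro continuous_intros cont[OF U(3)]) auto
      show "inverse (\<phi> u ^ m) ^ s = \<sigma> (f u)" if u: "u \<in> U - {y}" for u
      proof -
        have eq: "\<sigma>\<^sub>N (f u) = \<phi> u ^ (m * s)" using U(4) u by blast
        then have "f u \<noteq> N" using off_centre[OF U(3) u] by (auto simp: \<sigma>\<^sub>N_def)
        then have "inverse (\<sigma> (f u)) = \<phi> u ^ (m * s)" using eq by (simp add: \<sigma>\<^sub>N_def)
        then show ?thesis by (metis inverse_inverse_eq power_inverse power_mult)
      qed
    qed (use U(3) in \<open>auto simp: chart_at_def\<close>)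
  qed
qed

text \<open>
  The factor \<open>g\<close> is an \<open>s\<close>-th root of \<open>f\<close> in the coordinate \<open>\<sigma>\<close>. Local roots exist everywhere, near the zeros
  and poles of \<open>\<sigma> \<circ> f\<close> by the divisibility of the local degrees. Viewing the source as the plane
  with point at infinity \<open>M\<close>, itself a zero or pole, reduces the claim to a function on a
  plane with finitely many punctures. Continuity of \<open>g\<close> at the zeros and poles holds because \<open>g\<close> tends to
  \<open>0\<close> or to \<open>N\<close> together with its \<open>s\<close>-th power \<open>f\<close>.
\<close>

theorem sphere_power_factorization:
  assumes f: "branched_map S2 S2 f" and s: "s > 0" and M: "M \<in> S2" "f M \<in> {Z, N}"
    and dvd: "\<And>y. y \<in> S2 \<Longrightarrow> f y \<in> {Z, N} \<Longrightarrow> s dvd local_degree S2 S2 f y"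
  obtains g where "continuous_on S2 g" "g ` S2 \<subseteq> S2" "\<And>y. y \<in> S2 \<Longrightarrow> sphere_power s (g y) = f y"
proof -
  obtain \<sigma>M \<tau>M where "sphere_coordinate M \<sigma>M \<tau>M" using sphere_coordinate_exists[OF M(1)] .
  then interpret m: sphere_coordinate M \<sigma>M \<tau>M .
  have f': "continuous_on S2 f" "f ` S2 \<subseteq> S2"
    using branched_map_continuous[OF f] f unfolding branched_map_def by auto
  define B where "B = {y \<in> S2. f y \<in> {Z, N}}"
  have "B = {y \<in> S2. f y = Z} \<union> {y \<in> S2. f y = N}" unfolding B_def by blast
  then have "finite B" using branched_map_finite_fibre[OF f compact_sphere] by simp
  then have fin: "finite (\<sigma>M ` (B - {M}))" by simp
  have Zs_iff: "z \<in> \<sigma>M ` (B - {M}) \<longleftrightarrow> f (\<tau>M z) \<in> {Z, N}" for z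
  proof
    assume "z \<in> \<sigma>M ` (B - {M})"
    then obtain y where "y \<in> S2" "f y \<in> {Z, N}" "y \<noteq> M" "z = \<sigma>M y" unfolding B_def by blast
    then show "f (\<tau>M z) \<in> {Z, N}" using m.tau_sigma by simp
  next
    assume "f (\<tau>M z) \<in> {Z, N}"
    then have "\<tau>M z \<in> B - {M}" using m.tau unfolding B_def by blast
    then show "z \<in> \<sigma>M ` (B - {M})" using m.tau(3) by (metis imageI)
  qed
  let ?F = "\<lambda>z. \<sigma> (f (\<tau>M z))"
  let ?Z = "\<sigma>M ` (B - {M})"
  have off: "f (\<tau>M z) \<in> S2 - {N}" "f (\<tau>M z) \<noteq> Z" if "z \<notin> ?Z" for z
    using that Zs_iff[of z] f'(2) m.tau(1) by blast+
  have "continuous_on (- ?Z) (\<lambda>z. f (\<tau>M z))"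
    by (rule continuous_on_compose2[OF f'(1) m.continuous_on_tau]) (use m.tau(1) in blast)
  then have contF: "continuous_on (- ?Z) ?F"
    by (rule continuous_on_compose2[OF continuous_on_sigma]) (use off(1) in blast)
  have nzF: "?F z \<noteq> 0" if "z \<notin> ?Z" for z
    using off[OF that] sigma_eq_0_iff by simp
  have rootF: "\<exists>e>0. \<exists>R. continuous_on (ball z e - {z}) R \<and> (\<forall>u\<in>ball z e - {z}. R u ^ s = ?F u)"
    if z: "z \<in> ?Z" for z
  proof -
    have y: "\<tau>M z \<in> S2" "f (\<tau>M z) \<in> {Z, N}" using Zs_iff z m.tau(1) by blast+
    obtain U R where U: "openin (top_of_set S2) U" "\<tau>M z \<in> U" "continuous_on (U - {\<tau>M z}) R"
      "\<And>u. u \<in> U - {\<tau>M z} \<Longrightarrow> R u ^ s = \<sigma> (f u)"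
      by (rule local_root_over_poles[OF f y dvd[OF y]]) blast
    have "openin (top_of_set UNIV) (UNIV \<inter> \<tau>M -` U)"
      by (rule continuous_openin_preimage[OF m.continuous_on_tau _ U(1)]) (use m.tau(1) in blast)
    then have "open (\<tau>M -` U)" by simp
    then obtain e where e: "e > 0" "ball z e \<subseteq> \<tau>M -` U" using U(2) open_contains_ball by blast
    have im: "\<tau>M u \<in> U - {\<tau>M z}" if "u \<in> ball z e - {z}" for u
    proof -
      have "\<tau>M u \<noteq> \<tau>M z" using that m.tau(3) by (metis DiffD2 singletonI)
      moreover have "\<tau>M u \<in> U" using that e(2) by blast
      ultimately show ?thesis by simp
    qed
    have "continuous_on (ball z e - {z}) (\<lambda>u. R (\<tau>M u))"
      by (rule continuous_on_compose2[OF U(3) m.continuous_on_tau]) (rule image_subsetI, rule im)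
    moreover have "\<forall>u\<in>ball z e - {z}. R (\<tau>M u) ^ s = ?F u"
      by (intro ballI U(4) im)
    ultimately have "continuous_on (ball z e - {z}) (\<lambda>u. R (\<tau>M u)) \<and>
      (\<forall>u\<in>ball z e - {z}. R (\<tau>M u) ^ s = ?F u)" by (rule conjI)
    then have "\<exists>R. continuous_on (ball z e - {z}) R \<and> (\<forall>u\<in>ball z e - {z}. R u ^ s = ?F u)"
      by (rule exI[of _ "\<lambda>u. R (\<tau>M u)"])
    with e(1) show ?thesis by blast
  qed
  have "\<exists>G. continuous_on (- ?Z) G \<and> (\<forall>z\<in>- ?Z. G z ^ s = ?F z)"
    by (rule punctured_plane_root[OF fin s contF nzF rootF])
  then obtain G where G: "continuous_on (- ?Z) G" and "\<forall>z\<in>- ?Z. G z ^ s = ?F z" by (elim exE conjE)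
  then have G2: "G z ^ s = ?F z" if "z \<notin> ?Z" for z using that by (simp only: Compl_iff Ball_def not_False_eq_True simp_thms)
  define g where "g y = (if y \<in> B then f y else \<tau> (G (\<sigma>M y)))" for y
  have yB: "y \<noteq> M" "\<tau>M (\<sigma>M y) = y" "\<sigma>M y \<notin> ?Z" if "y \<in> S2 - B" for y
  proof -
    show 1: "y \<noteq> M" using that M unfolding B_def by blast
    show 2: "\<tau>M (\<sigma>M y) = y" using m.tau_sigma that 1 by blast
    show "\<sigma>M y \<notin> ?Z" using Zs_iff[of "\<sigma>M y"] that unfolding 2 B_def by blast
  qed
  have gS2: "g ` S2 \<subseteq> S2" using f'(2) tau(1) unfolding g_def by auto
  have pow: "sphere_power s (g y) = f y" if y: "y \<in> S2" for y
  proof (cases "y \<in> B")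
    case True
    then have "f y = Z \<or> f y = N" unfolding B_def by blast
    then have "sphere_power s (f y) = f y" using s by (auto simp: sphere_power_def zero_power)
    then show ?thesis using True by (simp add: g_def)
  next
    case False
    then have yb: "y \<in> S2 - B" using y by blast
    have "G (\<sigma>M y) ^ s = \<sigma> (f y)" using G2[OF yB(3)[OF yb]] yB(2)[OF yb] by simp
    moreover have "f y \<in> S2" "f y \<noteq> N" using y False f'(2) unfolding B_def by blast+
    ultimately show ?thesis using False tau_sigma by (simp add: g_def sphere_power_def)
  qed
  have gN: "g y = N \<longleftrightarrow> f y = N" if "y \<in> S2" for y
    using sphere_power_eq_N_iff[of s "g y"] unfolding pow[OF that] by blast
  have gZ: "g y = Z \<longleftrightarrow> f y = Z" if "y \<in> S2" for y
  proof -
    have "g y \<in> S2" using gS2 that by blast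
    then show ?thesis using sphere_power_eq_Z_iff[OF _ s, of "g y"] unfolding pow[OF that] by blast
  qed
  have contB: "continuous_on (S2 - B) g"
  proof -
    have "y \<in> S2 - {M}" if "y \<in> S2 - B" for y using yB(1)[OF that] that by simp
    then have "continuous_on (S2 - B) \<sigma>M"
      by (intro continuous_on_subset[OF m.continuous_on_sigma] subsetI)
    then have "continuous_on (S2 - B) (\<lambda>y. G (\<sigma>M y))"
      by (rule continuous_on_compose2[OF G]) (intro image_subsetI, simp only: Compl_iff yB(3) not_False_eq_True)
    then have "continuous_on (S2 - B) (\<lambda>y. \<tau> (G (\<sigma>M y)))"
      by (rule continuous_on_compose2[OF continuous_on_tau[of UNIV]]) blast
    then show ?thesis by (rule continuous_on_eq) (simp add: g_def)
  qed
  have "continuous_on S2 g"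
  proof (rule continuous_on_via_sphere[OF _ _ f'])
    let ?W = "S2 \<inter> f -` (S2 - {N})"
    have "continuous_on ?W (\<lambda>y. \<sigma> (f y))"
      by (rule continuous_on_compose2[OF continuous_on_sigma continuous_on_subset[OF f'(1)]]) auto
    then have p: "continuous_on ?W (\<lambda>y. \<sigma> (g y) ^ s)"
    proof (rule continuous_on_eq)
      fix y assume "y \<in> ?W"
      then have y: "y \<in> S2" "g y \<noteq> N" using gN by auto
      show "\<sigma> (f y) = \<sigma> (g y) ^ s" unfolding pow[OF y(1), symmetric] by (rule sigma_sphere_power[OF y(2)])
    qed
    have "{y \<in> ?W. \<sigma> (g y) \<noteq> 0} \<subseteq> S2 - B"
    proof
      fix y assume "y \<in> {y \<in> ?W. \<sigma> (g y) \<noteq> 0}"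
      then have y: "y \<in> S2" "f y \<noteq> N" "\<sigma> (g y) \<noteq> 0" by auto
      have "g y \<noteq> Z" using y(3) tau(3)[of 0] by metis
      then show "y \<in> S2 - B" using gZ[OF y(1)] y unfolding B_def by blast
    qed
    then have "continuous_on {y \<in> ?W. \<sigma> (g y) \<noteq> 0} g" by (rule continuous_on_subset[OF contB])
    then have "continuous_on {y \<in> ?W. \<sigma> (g y) \<noteq> 0} (\<lambda>y. \<sigma> (g y))"
      by (rule continuous_on_compose2[OF continuous_on_sigma]) (use gS2 gN in auto)
    then have "continuous_on ?W (\<lambda>y. \<sigma> (g y))"
      by (rule continuous_on_if_power_continuous[OF p _ s])
    then have "continuous_on ?W (\<lambda>y. \<tau> (\<sigma> (g y)))"
      by (rule continuous_on_compose2[OF continuous_on_tau[of UNIV]]) blast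
    then show "continuous_on ?W g"
    proof (rule continuous_on_eq)
      show "\<tau> (\<sigma> (g y)) = g y" if "y \<in> ?W" for y
      proof (rule tau_sigma)
        show "g y \<in> S2" using that gS2 by blast
        show "g y \<noteq> N" using that gN[of y] by blast
      qed
    qed
  next
    let ?W = "S2 \<inter> f -` (S2 - {Z})"
    obtain \<tau>\<^sub>N where "chart_at S2 N (S2 - {Z}) UNIV \<sigma>\<^sub>N \<tau>\<^sub>N" by (rule chart_at_N)
    then have hom: "homeomorphism (S2 - {Z}) UNIV \<sigma>\<^sub>N \<tau>\<^sub>N" unfolding chart_at_def by blast
    have gW: "g y \<in> S2 - {Z}" if "y \<in> ?W" for y using that gS2 gZ by blast
    have "continuous_on ?W (\<lambda>y. \<sigma>\<^sub>N (f y))"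
      by (rule continuous_on_compose2[OF continuous_on_sigma_N continuous_on_subset[OF f'(1)]]) auto
    then have p: "continuous_on ?W (\<lambda>y. \<sigma>\<^sub>N (g y) ^ s)"
    proof (rule continuous_on_eq)
      fix y assume "y \<in> ?W"
      then have y: "y \<in> S2" by blast
      show "\<sigma>\<^sub>N (f y) = \<sigma>\<^sub>N (g y) ^ s" unfolding pow[OF y, symmetric] by (rule sigma_N_sphere_power[OF s])
    qed
    have "{y \<in> ?W. \<sigma>\<^sub>N (g y) \<noteq> 0} \<subseteq> S2 - B"
    proof
      fix y assume "y \<in> {y \<in> ?W. \<sigma>\<^sub>N (g y) \<noteq> 0}"
      then have y: "y \<in> S2" "f y \<noteq> Z" "\<sigma>\<^sub>N (g y) \<noteq> 0" by auto
      have "g y \<noteq> N" using y(3) by (auto simp: \<sigma>\<^sub>N_def)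
      then show "y \<in> S2 - B" using gN[OF y(1)] y unfolding B_def by blast
    qed
    then have "continuous_on {y \<in> ?W. \<sigma>\<^sub>N (g y) \<noteq> 0} g" by (rule continuous_on_subset[OF contB])
    then have "continuous_on {y \<in> ?W. \<sigma>\<^sub>N (g y) \<noteq> 0} (\<lambda>y. \<sigma>\<^sub>N (g y))"
    proof (rule continuous_on_compose2[OF continuous_on_sigma_N], intro image_subsetI)
      show "g y \<in> S2 - {Z}" if "y \<in> {y \<in> ?W. \<sigma>\<^sub>N (g y) \<noteq> 0}" for y
        by (rule gW) (rule CollectD[OF that, THEN conjunct1])
    qed
    then have "continuous_on ?W (\<lambda>y. \<sigma>\<^sub>N (g y))"
      by (rule continuous_on_if_power_continuous[OF p _ s])
    moreover have "continuous_on UNIV \<tau>\<^sub>N" using hom homeomorphism_def by blast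
    ultimately have "continuous_on ?W (\<lambda>y. \<tau>\<^sub>N (\<sigma>\<^sub>N (g y)))"
      using continuous_on_compose2[of UNIV \<tau>\<^sub>N ?W "\<lambda>y. \<sigma>\<^sub>N (g y)"] by blast
    then show "continuous_on ?W g"
    proof (rule continuous_on_eq)
      show "\<tau>\<^sub>N (\<sigma>\<^sub>N (g y)) = g y" if "y \<in> ?W" for y
        by (rule homeomorphism_apply1[OF hom gW[OF that]])
    qed
  qed
  then show ?thesis by (rule that[OF _ gS2 pow])
qed

end

section \<open>Branching data\<close>

text \<open>
  Equality of branching data as multisets is turned into a matching of the points.
\<close>

lemma image_mset_eq_imp_bij_betw:
  assumes "finite S" "finite T" "image_mset f (mset_set S) = image_mset g (mset_set T)"
  obtains h where "bij_betw h S T" "\<And>x. x \<in> S \<Longrightarrow> g (h x) = f x"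
proof -
  have "\<exists>h. bij_betw h S T \<and> (\<forall>x\<in>S. g (h x) = f x)"
    using assms
  proof (induction S arbitrary: T rule: finite_induct)
    case empty
    then have "T = {}" by (simp add: mset_set_empty_iff)
    then show ?case by (simp add: bij_betw_def)
  next
    case (insert x S)
    have "f x \<in># image_mset g (mset_set T)" using insert.hyps by (simp flip: insert.prems(2))
    then obtain t where t: "t \<in> T" "g t = f x" using insert.prems(1) by auto
    have "mset_set T = add_mset t (mset_set (T - {t}))" using t(1) insert.prems(1) by (simp add: mset_set.remove)
    then have "image_mset f (mset_set S) = image_mset g (mset_set (T - {t}))"
      using insert.prems(2) insert.hyps t(2) by simp
    then obtain h where h: "bij_betw h S (T - {t})" "\<And>x. x \<in> S \<Longrightarrow> g (h x) = f x"
      using insert.IH[of "T - {t}"] insert.prems(1) by blast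
    have "bij_betw (h(x := t)) S (T - {t})"
      using h(1) insert.hyps(2) by (subst bij_betw_cong[of S _ h]) auto
    then have "bij_betw (h(x := t)) (insert x S) (insert t (T - {t}))"
      using notIn_Un_bij_betw[of x S "h(x := t)" "T - {t}"] insert.hyps(2) by simp
    moreover have "insert t (T - {t}) = T" using t(1) by blast
    moreover have "\<forall>y\<in>insert x S. g ((h(x := t)) y) = f y" using h(2) t(2) by simp
    ultimately show ?case by metis
  qed
  then show ?thesis using that by blast
qed

lemma image_mset_disjoint_UN:
  assumes "finite P" "\<And>p. p \<in> P \<Longrightarrow> finite (A p)"
    and "\<And>p q. p \<in> P \<Longrightarrow> q \<in> P \<Longrightarrow> p \<noteq> q \<Longrightarrow> A p \<inter> A q = {}"
  shows "image_mset f (mset_set (\<Union>p\<in>P. A p)) = (\<Sum>p\<in>P. image_mset f (mset_set (A p)))"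
  using assms
proof (induction P rule: finite_induct)
  case (insert p P)
  have "A p \<inter> (\<Union>p\<in>P. A p) = {}" using insert.prems(2)[of p] insert.hyps(2) by blast
  then have "mset_set (A p \<union> (\<Union>p\<in>P. A p)) = mset_set (A p) + mset_set (\<Union>p\<in>P. A p)"
    using insert.prems(1) insert.hyps(1) by (intro mset_set_Union) auto
  then show ?case using insert by simp
qed simp

lemma trivial_partition_of:
  assumes "partition_of d B" "\<not> nontrivial B"
  shows "B = replicate_mset d 1"
proof -
  have "b = 1" if "b \<in># B" for b
  proof -
    have "b > 0" "\<not> b > 1" using assms that unfolding partition_of_def nontrivial_def by blast+
    then show ?thesis by simp
  qed
  then have B: "B = replicate_mset (size B) 1" by (intro set_mset_subset_singletonD) auto
  have "sum_mset B = sum_mset (replicate_mset (size B) (1::nat))" by (rule arg_cong[OF B])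
  then have "size B = d" using assms(1) unfolding partition_of_def by simp
  with B show ?thesis by (simp only:)
qed

lemma partition_of_if_multiples:
  assumes "partition_of (s * d) (image_mset ((*) s) a)" "s > 0"
  shows "partition_of d a"
proof -
  have "sum_mset (image_mset ((*) s) a) = s * sum_mset a" by (induction a) (auto simp: distrib_left)
  then show ?thesis using assms unfolding partition_of_def by auto
qed

lemma power_model_at_cong:
  assumes "\<And>u. u \<in> Y \<Longrightarrow> f u = f' u" "power_model_at Y X f y m"
  shows "power_model_at Y X f' y m"
proof -
  obtain U V D E \<phi> \<phi>' \<psi> \<psi>' where *: "chart_at Y y U D \<phi> \<phi>'" "chart_at X (f y) V E \<psi> \<psi>'"
    "f ` U \<subseteq> V" "\<And>u. u \<in> U \<Longrightarrow> \<psi> (f u) = \<phi> u ^ m" by (rule power_model_atE[OF assms(2)]) blast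
  have U: "U \<subseteq> Y" "y \<in> U" using *(1) openin_imp_subset unfolding chart_at_def by auto
  have eq: "f u = f' u" if "u \<in> U" for u using assms(1) U(1) that by blast
  show ?thesis unfolding power_model_at_iff_charts
  proof (intro conjI exI)
    show "chart_at X (f' y) V E \<psi> \<psi>'" using *(2) eq[OF U(2)] by simp
    show "f' ` U \<subseteq> V" using *(3) eq by auto
    show "\<forall>u\<in>U. \<psi> (f' u) = \<phi> u ^ m" using *(4) eq by simp
  qed (fact power_model_at_pos[OF assms(2)] *(1))+
qed

lemma power_model_at_cong_iff:
  assumes "\<And>u. u \<in> Y \<Longrightarrow> f u = f' u"
  shows "power_model_at Y X f y m \<longleftrightarrow> power_model_at Y X f' y m"
proof
  show "power_model_at Y X f y m \<Longrightarrow> power_model_at Y X f' y m" by (rule power_model_at_cong[where f = f and f' = f', OF assms])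
  show "power_model_at Y X f' y m \<Longrightarrow> power_model_at Y X f y m"
    by (rule power_model_at_cong[where f = f' and f' = f, OF assms[symmetric]])
qed

lemma branched_map_cong:
  assumes "\<And>u. u \<in> Y \<Longrightarrow> f u = f' u"
  shows "branched_map Y X f \<longleftrightarrow> branched_map Y X f'"
proof -
  have "f ` Y = f' ` Y" by (rule image_cong[OF refl assms])
  moreover have "power_model_at Y X f = power_model_at Y X f'"
    by (intro ext power_model_at_cong_iff assms)
  ultimately show ?thesis unfolding branched_map_def by simp
qed

lemma local_degree_cong:
  assumes "\<And>u. u \<in> Y \<Longrightarrow> f u = f' u"
  shows "local_degree Y X f = local_degree Y X f'"
proof -
  have "power_model_at Y X f = power_model_at Y X f'"
    by (intro ext power_model_at_cong_iff assms)
  then show ?thesis by (intro ext) (simp only: local_degree_def)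
qed

lemma local_degrees_over_cong:
  assumes "\<And>u. u \<in> Y \<Longrightarrow> f u = f' u"
  shows "local_degrees_over Y X f x = local_degrees_over Y X f' x"
proof -
  have "{y \<in> Y. f y = x} = {y \<in> Y. f' y = x}" using assms by auto
  then show ?thesis
    using local_degree_cong[of Y f f'] assms unfolding local_degrees_over_def by simp
qed

context
  fixes Y :: "'a::heine_borel set" and X :: "'b::t2_space set" and f
  assumes f: "branched_map Y X f" and Y: "compact Y"
begin

lemma set_mset_local_degrees_over: "set_mset (local_degrees_over Y X f x) = local_degree Y X f ` {y \<in> Y. f y = x}"
  unfolding local_degrees_over_def using branched_map_finite_fibre[OF f Y] by simp

lemma sum_local_degrees_over:
  "sum_mset (local_degrees_over Y X f x) = (\<Sum>y\<in>{y \<in> Y. f y = x}. local_degree Y X f y)"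
  unfolding local_degrees_over_def by (simp add: sum_unfold_sum_mset)

lemma nontrivial_local_degrees_over_iff:
  "x \<in> X \<Longrightarrow> nontrivial (local_degrees_over Y X f x) \<longleftrightarrow> x \<in> branch_points Y X f"
  unfolding nontrivial_def set_mset_local_degrees_over branch_points_def by auto

lemma local_degrees_over_unbranched:
  assumes "x \<in> X - branch_points Y X f"
  shows "local_degrees_over Y X f x = replicate_mset (card {y \<in> Y. f y = x}) 1"
proof -
  have "local_degree Y X f y = 1" if "y \<in> {y \<in> Y. f y = x}" for y
    using assms that local_degree_pos[OF f, of y] unfolding branch_points_def
    by (metis (mono_tags, lifting) DiffD1 DiffD2 One_nat_def Suc_lessI mem_Collect_eq)
  then have "local_degrees_over Y X f x = image_mset (\<lambda>_. 1) (mset_set {y \<in> Y. f y = x})"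
    unfolding local_degrees_over_def using branched_map_finite_fibre[OF f Y] by (intro image_mset_cong) auto
  then show ?thesis by (simp add: image_mset_const_eq)
qed

lemma partition_of_local_degrees_over:
  assumes "connected X" "x0 \<in> X" "x \<in> X" "sum_mset (local_degrees_over Y X f x0) = d"
  shows "partition_of d (local_degrees_over Y X f x)"
  using branched_map_fibre_count_constant[OF f Y assms(1-3)] assms(4) local_degree_pos[OF f]
  unfolding partition_of_def set_mset_local_degrees_over sum_local_degrees_over by auto

lemma has_degree_if_partition_of:
  assumes "\<And>x. x \<in> X \<Longrightarrow> partition_of d (local_degrees_over Y X f x)"
  shows "has_degree Y X f d"
  unfolding has_degree_def
proof
  fix x assume x: "x \<in> X - branch_points Y X f"
  have "sum_mset (local_degrees_over Y X f x) = d" using assms[of x] x unfolding partition_of_def by blast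
  then have "card {y \<in> Y. f y = x} = d" unfolding local_degrees_over_unbranched[OF x] by simp
  then show "finite {y \<in> Y. f y = x} \<and> card {y \<in> Y. f y = x} = d"
    using branched_map_finite_fibre[OF f Y] by blast
qed

lemma branched_cover_if_partition_of:
  assumes "\<And>x. x \<in> X \<Longrightarrow> partition_of d (local_degrees_over Y X f x)" "d > 0"
  shows "branched_cover Y X f"
proof -
  have "x \<in> f ` Y" if "x \<in> X" for x
  proof -
    have "local_degrees_over Y X f x \<noteq> {#}" using assms(1)[OF that] assms(2) unfolding partition_of_def by auto
    then have "{y \<in> Y. f y = x} \<noteq> {}" unfolding local_degrees_over_def by (metis image_mset_empty mset_set.empty)
    then show ?thesis by blast
  qed
  then show ?thesis using f unfolding branched_map_def branched_cover_def by blast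
qed

text \<open>
  Points other than branch points have trivial partitions, which the filter removes; so any finite set of points containing the branch points may be used.
\<close>

lemma branching_data_eq:
  assumes "finite Q" "branch_points Y X f \<subseteq> Q" "Q \<subseteq> X"
  shows "branching_data Y X f = filter_mset nontrivial (image_mset (local_degrees_over Y X f) (mset_set Q))"
proof -
  have "{x \<in> Q. nontrivial (local_degrees_over Y X f x)} = branch_points Y X f"
    using assms nontrivial_local_degrees_over_iff by blast
  then show ?thesis unfolding branching_data_def filter_mset_image_mset
    using assms(1) by simp
qed

end

context sphere_coordinate
begin

lemma branched_map_sphere_power:
  assumes g: "branched_map S2 S2 g" and s: "s > 0"
  shows "branched_map S2 S2 (\<lambda>u. sphere_power s (g u))"
    and "y \<in> S2 \<Longrightarrow> local_degree S2 S2 (\<lambda>u. sphere_power s (g u)) y =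
      (if g y \<in> {Z, N} then s * local_degree S2 S2 g y else local_degree S2 S2 g y)"
proof -
  have g': "continuous_on S2 g" "g ` S2 \<subseteq> S2"
    using branched_map_continuous[OF g] g unfolding branched_map_def by auto
  have *: "power_model_at S2 S2 (\<lambda>u. sphere_power s (g u)) y
      (if g y \<in> {Z, N} then s * local_degree S2 S2 g y else local_degree S2 S2 g y)" if "y \<in> S2" for y
    using power_model_at_sphere_power[OF g' that s] branched_map_model[OF g that] by blast
  have im: "(\<lambda>u. sphere_power s (g u)) ` S2 \<subseteq> S2" using g'(2) sphere_power_in_S2 by blast
  show "branched_map S2 S2 (\<lambda>u. sphere_power s (g u))"
    unfolding branched_map_def using im * by blast
  show "local_degree S2 S2 (\<lambda>u. sphere_power s (g u)) y =
      (if g y \<in> {Z, N} then s * local_degree S2 S2 g y else local_degree S2 S2 g y)" if "y \<in> S2"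
    by (rule local_degree_eq[OF *[OF that]])
qed

lemma branched_map_if_sphere_power:
  assumes g: "continuous_on S2 g" "g ` S2 \<subseteq> S2" and s: "s > 0"
    and f: "branched_map S2 S2 (\<lambda>u. sphere_power s (g u))"
    and dvd: "\<And>y. y \<in> S2 \<Longrightarrow> g y \<in> {Z, N} \<Longrightarrow> s dvd local_degree S2 S2 (\<lambda>u. sphere_power s (g u)) y"
  shows "branched_map S2 S2 g"
  unfolding branched_map_def
proof (intro conjI ballI)
  fix y assume y: "y \<in> S2"
  let ?k = "local_degree S2 S2 (\<lambda>u. sphere_power s (g u)) y"
  have model: "power_model_at S2 S2 (\<lambda>u. sphere_power s (g u)) y ?k" by (rule branched_map_model[OF f y])
  obtain m where "?k = (if g y \<in> {Z, N} then s * m else m)"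
    using dvd[OF y] by (cases "g y \<in> {Z, N}") (auto elim: dvdE)
  then show "\<exists>m. power_model_at S2 S2 g y m"
    using model power_model_at_sphere_power[OF g y s, of m] by auto
qed (rule g(2))

text \<open>
  The zero and the pole have one preimage under the power map, and all local degrees over them are
  multiplied by \<open>s\<close>. Any other point has \<open>s\<close> preimages, and its partition is the union of theirs.
\<close>

lemma local_degrees_over_sphere_power:
  assumes g: "branched_map S2 S2 g" and s: "s > 0"
  shows "local_degrees_over S2 S2 (\<lambda>u. sphere_power s (g u)) Z = image_mset ((*) s) (local_degrees_over S2 S2 g Z)"
    and "local_degrees_over S2 S2 (\<lambda>u. sphere_power s (g u)) N = image_mset ((*) s) (local_degrees_over S2 S2 g N)"
    and "c \<noteq> 0 \<Longrightarrow> local_degrees_over S2 S2 (\<lambda>u. sphere_power s (g u)) (\<tau> (c ^ s)) =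
      (\<Sum>j\<in>{1..s}. local_degrees_over S2 S2 g (\<tau> (c * cis (2 * pi * real j / real s))))"
proof -
  let ?f = "\<lambda>u. sphere_power s (g u)"
  have gS2: "g y \<in> S2" if "y \<in> S2" for y using g that unfolding branched_map_def by blast
  have fin: "finite {y \<in> S2. g y = x}" for x by (rule branched_map_finite_fibre[OF g compact_sphere])
  note deg = branched_map_sphere_power(2)[OF g s]
  have pole: "local_degrees_over S2 S2 ?f x = image_mset ((*) s) (local_degrees_over S2 S2 g x)"
    if x: "x \<in> {Z, N}" and fx: "\<And>p. p \<in> S2 \<Longrightarrow> sphere_power s p = x \<longleftrightarrow> p = x" for x
  proof -
    have "{y \<in> S2. ?f y = x} = {y \<in> S2. g y = x}" using fx gS2 by blast
    then have "local_degrees_over S2 S2 ?f x = image_mset (local_degree S2 S2 ?f) (mset_set {y \<in> S2. g y = x})"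
      unfolding local_degrees_over_def by simp
    also have "\<dots> = image_mset (\<lambda>y. s * local_degree S2 S2 g y) (mset_set {y \<in> S2. g y = x})"
    proof (rule image_mset_cong)
      fix y assume "y \<in># mset_set {y \<in> S2. g y = x}"
      then have "y \<in> S2" "g y = x" using fin[of x] by auto
      then show "local_degree S2 S2 ?f y = s * local_degree S2 S2 g y" using deg x by simp
    qed
    finally show ?thesis unfolding local_degrees_over_def by (simp add: image_mset.compositionality comp_def)
  qed
  show "local_degrees_over S2 S2 ?f Z = image_mset ((*) s) (local_degrees_over S2 S2 g Z)"
    by (rule pole) (use sphere_power_eq_Z_iff[OF _ s] in auto)
  show "local_degrees_over S2 S2 ?f N = image_mset ((*) s) (local_degrees_over S2 S2 g N)"
    by (rule pole) auto
  show "local_degrees_over S2 S2 ?f (\<tau> (c ^ s)) =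
      (\<Sum>j\<in>{1..s}. local_degrees_over S2 S2 g (\<tau> (c * cis (2 * pi * real j / real s))))" if c: "c \<noteq> 0"
  proof -
    let ?P = "{p \<in> S2. sphere_power s p = \<tau> (c ^ s)}"
    note bij = bij_betw_sphere_power_fibre[OF c s]
    have "finite ?P" using bij_betw_finite[OF bij] by simp
    have fib: "{y \<in> S2. ?f y = \<tau> (c ^ s)} = (\<Union>p\<in>?P. {y \<in> S2. g y = p})" using gS2 by blast
    have off: "g y \<notin> {Z, N}" if "y \<in> S2" "?f y = \<tau> (c ^ s)" for y
    proof
      assume "g y \<in> {Z, N}"
      then have "?f y \<in> {Z, N}" using sphere_power_eq_Z_iff[OF _ s] gS2[OF that(1)] by auto
      then have "\<tau> (c ^ s) = Z" using that(2) tau(2)[of "c ^ s"] by auto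
      then have "c ^ s = 0" using tau(3) by metis
      then show False using c by simp
    qed
    have "local_degrees_over S2 S2 ?f (\<tau> (c ^ s))
        = image_mset (local_degree S2 S2 g) (mset_set {y \<in> S2. ?f y = \<tau> (c ^ s)})"
      unfolding local_degrees_over_def
    proof (rule image_mset_cong)
      fix y assume "y \<in># mset_set {y \<in> S2. ?f y = \<tau> (c ^ s)}"
      then have "y \<in> {y \<in> S2. ?f y = \<tau> (c ^ s)}"
        using fib fin \<open>finite ?P\<close> by (metis (no_types, lifting) elem_mset_set finite_UN_I)
      then show "local_degree S2 S2 ?f y = local_degree S2 S2 g y" using deg[of y] off[of y] by simp
    qed
    also have "\<dots> = (\<Sum>p\<in>?P. local_degrees_over S2 S2 g p)"
      unfolding fib local_degrees_over_def
      by (rule image_mset_disjoint_UN[OF \<open>finite ?P\<close> fin]) auto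
    also have "\<dots> = (\<Sum>j\<in>{1..s}. local_degrees_over S2 S2 g (\<tau> (c * cis (2 * pi * real j / real s))))"
      using sum.reindex_bij_betw[OF bij, of "local_degrees_over S2 S2 g"] by simp
    finally show ?thesis .
  qed
qed

end

section \<open>Transfer of branching data along the power map\<close>

text \<open>
  Labels for the points of the target of \<open>g\<close> that lie over the branch points of \<open>f\<close>: the pair \<open>(k, j)\<close>
  stands for the \<open>j\<close>-th preimage of the \<open>k\<close>-th branch point under the power map. The first two branch
  points are fixed by that map and have one preimage each.
\<close>

definition preimage_index :: "nat \<Rightarrow> nat \<Rightarrow> (nat \<times> nat) set" where
  "preimage_index n s = insert (1, 1) (insert (2, 1) ({3..n} \<times> {1..s}))"

definition preimage_data ::
    "nat multiset \<Rightarrow> nat multiset \<Rightarrow> (nat \<Rightarrow> nat \<Rightarrow> nat multiset) \<Rightarrow> nat \<times> nat \<Rightarrow> nat multiset" where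
  "preimage_data a1 a2 P = (\<lambda>(k, j). if k = 1 then a1 else if k = 2 then a2 else P k j)"

lemma finite_preimage_index: "finite (preimage_index n s)"
  unfolding preimage_index_def by simp

lemma preimage_indexE:
  assumes "i \<in> preimage_index n s"
  obtains "i = (1, 1)" | "i = (2, 1)" | k j where "i = (k, j)" "k \<in> {3..n}" "j \<in> {1..s}"
  using assms unfolding preimage_index_def by blast

lemma image_mset_preimage_data:
  "image_mset (preimage_data a1 a2 P) (mset_set (preimage_index n s)) =
    {#a1, a2#} + image_mset (\<lambda>(k, j). P k j) (mset_set ({3..n} \<times> {1..s}))"
proof -
  have "image_mset (preimage_data a1 a2 P) (mset_set ({3..n} \<times> {1..s})) =
      image_mset (\<lambda>(k, j). P k j) (mset_set ({3..n} \<times> {1..s}))"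
    by (rule image_mset_cong) (auto simp: preimage_data_def)
  moreover have "(1, 1) \<notin> insert (2, 1) ({3..n} \<times> {1..s})" "(2, 1) \<notin> {3..n} \<times> {1..s}" by auto
  ultimately show ?thesis unfolding preimage_index_def by (simp add: preimage_data_def)
qed

text \<open>
  The first two branch points of \<open>f\<close> are made the zero and the pole of a coordinate. All local degrees
  over them are divisible by \<open>s\<close>, so \<open>f\<close> is the power map after some \<open>g\<close>. The preimages under the power
  map of the other branch points decompose the partitions \<open>A k\<close>. The parts have sum \<open>d'\<close> because the
  weighted number of preimages under \<open>g\<close> is constant, and over the zero it is the sum of \<open>a1\<close>.
\<close>

lemma realization_descends:
  fixes s d' n :: nat and A :: "nat \<Rightarrow> nat multiset"
  assumes "s > 0" "d' > 0" "n \<ge> 2"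
    and A: "\<And>k. k \<in> {1..n} \<Longrightarrow> partition_of (s * d') (A k) \<and> nontrivial (A k)"
    and A1: "A 1 = image_mset (\<lambda>a. s * a) a1" and A2: "A 2 = image_mset (\<lambda>a. s * a) a2"
    and f: "realizes S2 S2 f (s * d') (image_mset A (mset_set {1..n}))"
  shows "\<exists>P. (\<forall>k\<in>{3..n}. decomposition s d' (A k) (P k)) \<and>
       (\<exists>g. realizes S2 S2 g d'
          ({#a1, a2#} + image_mset (\<lambda>(k, j). P k j) (mset_set ({3..n} \<times> {1..s}))))"
proof -
  have bm: "branched_map S2 S2 f"
    using f unfolding realizes_def branched_cover_def branched_map_def by blast
  let ?bp = "branch_points S2 S2 f"
  have set_A: "set_mset (image_mset A (mset_set {1..n})) = A ` {1..n}" by simp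
  have "nontrivial B" if B: "B \<in># image_mset A (mset_set {1..n})" for B
  proof -
    have "B \<in> A ` {1..n}" using B unfolding set_A .
    then obtain k where "k \<in> {1..n}" "B = A k" by blast
    then show ?thesis using A[of k] by blast
  qed
  then have "filter_mset nontrivial (image_mset A (mset_set {1..n})) =
      filter_mset (\<lambda>_. True) (image_mset A (mset_set {1..n}))"
    by (intro filter_mset_cong0) simp
  then have "filter_mset nontrivial (image_mset A (mset_set {1..n})) = image_mset A (mset_set {1..n})"
    by (simp only: filter_mset_True)
  then have data: "image_mset A (mset_set {1..n}) = image_mset (local_degrees_over S2 S2 f) (mset_set ?bp)"
    using f unfolding realizes_def branching_data_def by simp
  \<comment> \<open>If there were infinitely many branch points, the multiset of branching data would be empty.\<close>
  have "finite ?bp"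
  proof (rule ccontr)
    assume "infinite ?bp"
    then have "image_mset A (mset_set {1..n}) = {#}" unfolding data by simp
    then have "{1..n} = {}" by (simp add: mset_set_empty_iff)
    then show False using \<open>n \<ge> 2\<close> by simp
  qed
  then obtain x where x: "bij_betw x {1..n} ?bp"
    and ldx: "\<And>k. k \<in> {1..n} \<Longrightarrow> local_degrees_over S2 S2 f (x k) = A k"
    using image_mset_eq_imp_bij_betw[OF _ _ data] by (metis finite_atLeastAtMost)
  have xS2: "x k \<in> S2" if "k \<in> {1..n}" for k
    using bij_betwE[OF x] that unfolding branch_points_def by blast
  have inj_x: "inj_on x {1..n}" using x unfolding bij_betw_def by blast
  have in12: "1 \<in> {1..n}" "2 \<in> {1..n}" using \<open>n \<ge> 2\<close> by auto
  have x12: "x 1 \<noteq> x 2" using inj_onD[OF inj_x _ in12] by auto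
  \<comment> \<open>The coordinate has its pole at the second branch point and its zero at the first.\<close>
  obtain \<sigma> \<tau> where co: "sphere_coordinate (x 2) \<sigma> \<tau>" and \<sigma>0: "\<sigma> (x 1) = 0"
    using sphere_coordinate_through_points[of "x 2" "{1::nat}" x "\<lambda>_. 0"] xS2[OF in12(1)] xS2[OF in12(2)] x12
    by auto
  interpret sphere_coordinate "x 2" \<sigma> \<tau> by (rule co)
  have Z: "Z = x 1" using tau_sigma[OF xS2[OF in12(1)] x12] \<sigma>0 by simp
  have dvd: "s dvd local_degree S2 S2 f y" if y: "y \<in> S2" "f y \<in> {Z, x 2}" for y
  proof -
    have "\<exists>k\<in>{1, 2}. f y = x k" using y(2) unfolding Z by blast
    then obtain k where k: "k = 1 \<or> k = 2" "f y = x k" by blast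
    have "local_degree S2 S2 f y \<in># local_degrees_over S2 S2 f (x k)"
      unfolding set_mset_local_degrees_over[OF bm compact_sphere] using y(1) k(2) by blast
    also have "local_degrees_over S2 S2 f (x k) = A k" using ldx in12 k(1) by blast
    finally show ?thesis using k(1) A1 A2 by auto
  qed
  obtain b where "b \<in># A 1" using A[OF in12(1)] unfolding nontrivial_def by blast
  then have "b \<in># local_degrees_over S2 S2 f (x 1)" using ldx[OF in12(1)] by simp
  then obtain M where M: "M \<in> S2" "f M = x 1"
    unfolding set_mset_local_degrees_over[OF bm compact_sphere] by blast
  have M': "f M \<in> {Z, x 2}" unfolding Z M(2) by blast
  obtain g where g: "continuous_on S2 g" "g ` S2 \<subseteq> S2" and fg: "\<And>y. y \<in> S2 \<Longrightarrow> sphere_power s (g y) = f y"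
    by (rule sphere_power_factorization[OF bm \<open>s > 0\<close> M(1) M' dvd]) (assumption | rule that)+
  let ?f = "\<lambda>u. sphere_power s (g u)"
  have "branched_map S2 S2 ?f \<longleftrightarrow> branched_map S2 S2 f" by (rule branched_map_cong) (rule fg)
  then have bm': "branched_map S2 S2 ?f" using bm by simp
  have deg': "local_degree S2 S2 ?f = local_degree S2 S2 f" by (rule local_degree_cong) (rule fg)
  have ldo': "local_degrees_over S2 S2 ?f p = local_degrees_over S2 S2 f p" for p
    by (rule local_degrees_over_cong) (rule fg)
  have gS2: "g y \<in> S2" if "y \<in> S2" for y using g(2) that by blast
  have bg: "branched_map S2 S2 g"
  proof (rule branched_map_if_sphere_power[OF g \<open>s > 0\<close> bm'])
    fix y assume y: "y \<in> S2" "g y \<in> {Z, x 2}"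
    then have "?f y \<in> {Z, x 2}" using sphere_power_eq_Z_iff[OF gS2[OF y(1)] \<open>s > 0\<close>] by auto
    then show "s dvd local_degree S2 S2 ?f y" unfolding deg' using dvd[OF y(1)] fg[OF y(1)] by simp
  qed
  note pow = local_degrees_over_sphere_power[OF bg \<open>s > 0\<close>, unfolded ldo']
  let ?ld = "local_degrees_over S2 S2 g"
  have inj_s: "inj ((*) s)" using \<open>s > 0\<close> by (simp add: inj_on_def)
  have ld1: "?ld Z = a1"
  proof -
    have "image_mset ((*) s) (?ld Z) = image_mset ((*) s) a1"
      using pow(1) ldx[OF in12(1)] A1 unfolding Z by simp
    then show ?thesis using multiset.inj_map[OF inj_s] by (rule injD[rotated])
  qed
  have ld2: "?ld (x 2) = a2"
  proof -
    have "image_mset ((*) s) (?ld (x 2)) = image_mset ((*) s) a2"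
      using pow(2) ldx[OF in12(2)] A2 by simp
    then show ?thesis using multiset.inj_map[OF inj_s] by (rule injD[rotated])
  qed
  have "partition_of d' a1"
    by (rule partition_of_if_multiples[OF _ \<open>s > 0\<close>]) (use A[OF in12(1)] A1 in simp)
  then have sum_Z: "sum_mset (?ld Z) = d'" unfolding ld1 partition_of_def by blast
  have conn: "connected S2" by (rule connected_sphere) simp
  have part: "partition_of d' (?ld p)" if "p \<in> S2" for p
    by (rule partition_of_local_degrees_over[OF bg compact_sphere conn tau(1) that sum_Z])
  have "\<exists>c. c ^ s = \<sigma> (x k)" for k using exists_complex_root[of s "\<sigma> (x k)"] \<open>s > 0\<close> by (metis not_gr0)
  then obtain c where c: "\<And>k. c k ^ s = \<sigma> (x k)" by metis
  have k3: "x k \<in> S2" "x k \<noteq> x 2" "\<tau> (c k ^ s) = x k" "c k \<noteq> 0" if k: "k \<in> {3..n}" for k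
  proof -
    have k': "k \<in> {1..n}" "k \<noteq> 1" "k \<noteq> 2" using k by auto
    show 1: "x k \<in> S2" by (rule xS2[OF k'(1)])
    show 2: "x k \<noteq> x 2" using inj_onD[OF inj_x _ k'(1) in12(2)] k'(3) by blast
    show 3: "\<tau> (c k ^ s) = x k" unfolding c by (rule tau_sigma[OF 1 2])
    have "x k \<noteq> x 1" using inj_onD[OF inj_x _ k'(1) in12(1)] k'(2) by blast
    then have "\<tau> (c k ^ s) \<noteq> \<tau> 0" using 3 Z by simp
    then show "c k \<noteq> 0" using \<open>s > 0\<close> by (auto simp: zero_power)
  qed
  define pt where "pt k j = \<tau> (c k * cis (2 * pi * real j / real s))" for k j :: nat
  define P where "P k j = ?ld (pt k j)" for k j
  define q where "q = (\<lambda>(k, j). if k = 1 then Z else if k = 2 then x 2 else pt k j)"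
  have q3: "q (k, j) = pt k j" if "k \<in> {3..n}" for k j using that by (simp add: q_def)
  have fibre: "bij_betw (pt k) {1..s} {p \<in> S2. sphere_power s p = x k}" if "k \<in> {3..n}" for k
    using bij_betw_sphere_power_fibre[OF k3(4)[OF that] \<open>s > 0\<close>] unfolding k3(3)[OF that] pt_def .
  have dec: "decomposition s d' (A k) (P k)" if k: "k \<in> {3..n}" for k
  proof -
    have "A k = local_degrees_over S2 S2 f (x k)" using ldx[of k] k by simp
    also have "\<dots> = (\<Sum>j\<in>{1..s}. P k j)"
      using pow(3)[OF k3(4)[OF k]] unfolding k3(3)[OF k] P_def pt_def .
    finally show ?thesis unfolding decomposition_def P_def pt_def using part tau(1) by blast
  qed
  let ?I = "preimage_index n s"
  have q_power: "sphere_power s (q i) = x (fst i)" "q i \<in> S2" if "i \<in> ?I" for i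
  proof -
    show "sphere_power s (q i) = x (fst i)" using that
    proof (cases rule: preimage_indexE)
      case 1
      then show ?thesis using sphere_power_eq_Z_iff[OF tau(1) \<open>s > 0\<close>, of 0] Z by (simp add: q_def)
    next
      case 2
      then show ?thesis by (simp add: q_def)
    next
      case (3 k j)
      then show ?thesis using bij_betwE[OF fibre[OF 3(2)]] q3[OF 3(2)] by simp
    qed
    show "q i \<in> S2" using xS2[OF in12(2)] tau(1) by (simp add: q_def pt_def split: prod.split)
  qed
  have fst_I: "fst i \<in> {1..n}" if "i \<in> ?I" for i
    using that \<open>n \<ge> 2\<close> by (cases rule: preimage_indexE) auto
  have "inj_on q ?I"
  proof (rule inj_onI)
    fix i i' assume i: "i \<in> ?I" "i' \<in> ?I" "q i = q i'"
    then have "x (fst i) = x (fst i')" using q_power(1) by metis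
    then have eq: "fst i = fst i'" using inj_onD[OF inj_x _ fst_I fst_I] i by blast
    show "i = i'"
    proof (cases "fst i \<in> {3..n}")
      case True
      have "snd i \<in> {1..s}" using i(1) True by (cases rule: preimage_indexE) auto
      moreover have "snd i' \<in> {1..s}" using i(2) True unfolding eq by (cases rule: preimage_indexE) auto
      moreover have "pt (fst i) (snd i) = pt (fst i) (snd i')"
        using i(3) q3[OF True] eq by (metis prod.collapse)
      ultimately have "snd i = snd i'"
        using bij_betw_imp_inj_on[OF fibre[OF True]] inj_onD by metis
      then show ?thesis using eq by (simp add: prod_eq_iff)
    next
      case False
      have "snd i = 1" using i(1) False by (cases rule: preimage_indexE) auto
      moreover have "snd i' = 1" using i(2) False unfolding eq by (cases rule: preimage_indexE) auto
      ultimately show ?thesis using eq by (simp add: prod_eq_iff)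
    qed
  qed
  then have "mset_set (q ` ?I) = image_mset q (mset_set ?I)" by (simp add: image_mset_mset_set)
  then have "image_mset ?ld (mset_set (q ` ?I)) = image_mset (\<lambda>i. ?ld (q i)) (mset_set ?I)"
    by (simp add: image_mset.compositionality comp_def)
  also have "\<dots> = image_mset (preimage_data a1 a2 P) (mset_set ?I)"
  proof (rule image_mset_cong)
    fix i assume "i \<in># mset_set ?I"
    then have "i \<in> ?I" using finite_preimage_index by simp
    then show "?ld (q i) = preimage_data a1 a2 P i"
    proof (cases rule: preimage_indexE)
      case (3 k j)
      then show ?thesis using q3[OF 3(2)] by (simp add: preimage_data_def P_def)
    qed (simp_all add: q_def preimage_data_def ld1 ld2)
  qed
  finally have data_q: "image_mset ?ld (mset_set (q ` ?I)) = image_mset (preimage_data a1 a2 P) (mset_set ?I)" .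
  have covers: "branch_points S2 S2 g \<subseteq> q ` ?I"
  proof
    fix p assume "p \<in> branch_points S2 S2 g"
    then obtain y where y: "y \<in> S2" "g y = p" "local_degree S2 S2 g y > 1"
      unfolding branch_points_def by blast
    have "(1, 1) \<in> ?I" "(2, 1) \<in> ?I" unfolding preimage_index_def by auto
    moreover have "q (1, 1) = Z" "q (2, 1) = x 2" by (simp_all add: q_def)
    ultimately have pole: "p \<in> q ` ?I" if "p \<in> {Z, x 2}" using that by (metis image_eqI insertE singletonD)
    show "p \<in> q ` ?I"
    proof (cases "p \<in> {Z, x 2}")
      case False
      then have "local_degree S2 S2 f y > 1"
        using branched_map_sphere_power(2)[OF bg \<open>s > 0\<close> y(1)] y(2,3) unfolding deg' by simp
      then have "f y \<in> ?bp" unfolding branch_points_def using y(1) bm unfolding branched_map_def by blast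
      then obtain k where k: "k \<in> {1..n}" "f y = x k" using x unfolding bij_betw_def by blast
      have p: "p \<in> S2" "sphere_power s p = x k" using y gS2 fg k(2) by auto
      have "x k \<noteq> x 1" using sphere_power_eq_Z_iff[OF p(1) \<open>s > 0\<close>] False p(2) Z by simp
      moreover have "x k \<noteq> x 2" using sphere_power_eq_N_iff[of s p] False p(2) by simp
      ultimately have "k \<noteq> 1" "k \<noteq> 2" by auto
      then have k3': "k \<in> {3..n}" using k(1) by auto
      have "p \<in> pt k ` {1..s}" unfolding bij_betw_imp_surj_on[OF fibre[OF k3']] using p by blast
      then obtain j where j: "j \<in> {1..s}" "p = pt k j" by blast
      have "(k, j) \<in> ?I" unfolding preimage_index_def using k3' j(1) by blast
      moreover have "p = q (k, j)" unfolding q3[OF k3'] by (rule j(2))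
      ultimately show ?thesis by (rule rev_image_eqI)
    qed (rule pole)
  qed
  have q_S2: "q ` ?I \<subseteq> S2" by (rule image_subsetI, rule q_power(2))
  have "finite (q ` ?I)" by (rule finite_imageI[OF finite_preimage_index])
  then have "branching_data S2 S2 g = filter_mset nontrivial (image_mset ?ld (mset_set (q ` ?I)))"
    by (rule branching_data_eq[OF bg compact_sphere _ covers q_S2])
  then have "realizes S2 S2 g d' (image_mset (preimage_data a1 a2 P) (mset_set ?I))"
    unfolding realizes_def data_q
    by (intro conjI has_degree_if_partition_of[OF bg compact_sphere part]
      branched_cover_if_partition_of[OF bg compact_sphere part \<open>d' > 0\<close>])
  then have "realizes S2 S2 g d'
      ({#a1, a2#} + image_mset (\<lambda>(k, j). P k j) (mset_set ({3..n} \<times> {1..s})))"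
    unfolding image_mset_preimage_data .
  with dec show ?thesis by (intro exI[of _ P] conjI ballI exI[of _ g])
qed

text \<open>
  The points of the target of \<open>g\<close> are moved so that those belonging to \<open>a1\<close> and \<open>a2\<close> become the zero and the
  pole of the coordinate, and those belonging to \<open>P k 1, \<dots>, P k s\<close> become the \<open>s\<close>-th roots of \<open>k ^ s\<close>. The
  power map then identifies the latter, and the composite has the required branching data.
\<close>

lemma realization_composes:
  fixes s d' n :: nat and A :: "nat \<Rightarrow> nat multiset"
  assumes "s > 0" "d' > 0" "n \<ge> 3"
    and A: "\<And>k. k \<in> {1..n} \<Longrightarrow> partition_of (s * d') (A k) \<and> nontrivial (A k)"
    and A1: "A 1 = image_mset (\<lambda>a. s * a) a1" and A2: "A 2 = image_mset (\<lambda>a. s * a) a2"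
    and dec: "\<And>k. k \<in> {3..n} \<Longrightarrow> decomposition s d' (A k) (P k)"
    and g: "realizes S2 S2 g d'
          ({#a1, a2#} + image_mset (\<lambda>(k, j). P k j) (mset_set ({3..n} \<times> {1..s})))"
  shows "\<exists>f. realizes S2 S2 f (s * d') (image_mset A (mset_set {1..n}))"
proof -
  have bg: "branched_map S2 S2 g"
    using g unfolding realizes_def branched_cover_def branched_map_def by blast
  let ?bp = "branch_points S2 S2 g"
  let ?ld = "local_degrees_over S2 S2 g"
  let ?I = "preimage_index n s"
  let ?B = "preimage_data a1 a2 P"
  have in12: "1 \<in> {1..n}" "2 \<in> {1..n}" using \<open>n \<ge> 3\<close> by auto
  have part1: "partition_of d' a1"
    by (rule partition_of_if_multiples[OF _ \<open>s > 0\<close>]) (use A[OF in12(1)] A1 in simp)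
  have part2: "partition_of d' a2"
    by (rule partition_of_if_multiples[OF _ \<open>s > 0\<close>]) (use A[OF in12(2)] A2 in simp)
  have partP: "partition_of d' (P k j)" if "k \<in> {3..n}" "j \<in> {1..s}" for k j
    using dec[OF that(1)] that(2) unfolding decomposition_def by blast
  have part_B: "partition_of d' (?B i)" if "i \<in> ?I" for i
    using that
  proof (cases rule: preimage_indexE)
    case (3 k j)
    then show ?thesis using partP[OF 3(2,3)] by (simp add: preimage_data_def)
  qed (simp_all add: preimage_data_def part1 part2)
  define J where "J = {i \<in> ?I. nontrivial (?B i)}"
  have J: "J \<subseteq> ?I" "finite J" using finite_preimage_index unfolding J_def by auto
  have "filter_mset nontrivial (image_mset ?B (mset_set ?I)) = image_mset ?B (mset_set J)"
    unfolding filter_mset_image_mset J_def by (simp only: filter_mset_mset_set[OF finite_preimage_index])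
  then have data: "image_mset ?B (mset_set J) = image_mset ?ld (mset_set ?bp)"
    using g unfolding realizes_def branching_data_def image_mset_preimage_data by simp
  have in3: "3 \<in> {1..n}" "3 \<in> {3..n}" using \<open>n \<ge> 3\<close> by auto
  obtain b where "b \<in># A 3" "b > 1" using A[OF in3(1)] unfolding nontrivial_def by blast
  moreover have "A 3 = (\<Sum>j\<in>{1..s}. P 3 j)" using dec[OF in3(2)] unfolding decomposition_def by blast
  ultimately obtain j where j: "j \<in> {1..s}" "b \<in># P 3 j" "b > 1" by (auto simp: set_mset_sum)
  have "(3, j) \<in> J"
    unfolding J_def preimage_index_def preimage_data_def nontrivial_def using j in3 by auto
  \<comment> \<open>If there were infinitely many branch points, the multiset of branching data would be empty.\<close>
  have "finite ?bp"
  proof (rule ccontr)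
    assume "infinite ?bp"
    then have "J = {}" using data J(2) by (simp add: mset_set_empty_iff)
    then show False using \<open>(3, j) \<in> J\<close> by blast
  qed
  obtain x where x: "bij_betw x J ?bp" and ldx: "\<And>i. i \<in> J \<Longrightarrow> ?ld (x i) = ?B i"
    by (rule image_mset_eq_imp_bij_betw[OF J(2) \<open>finite ?bp\<close> data]) blast
  \<comment> \<open>The trivial partitions are placed over distinct points that are not branch points.\<close>
  have "infinite S2"
  proof
    assume "finite S2"
    moreover have "connected S2" by (rule connected_sphere) simp
    ultimately have "S2 = {} \<or> (\<exists>p. S2 = {p})" using connected_finite_iff_sing by blast
    moreover have "axis 1 1 \<in> S2" "- axis 1 1 \<in> S2" by simp_all
    ultimately have "axis 1 1 = (- axis 1 1 :: real ^ 3)" by (metis empty_iff singletonD)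
    then have "(axis 1 1 :: real ^ 3) $ 1 = (- axis 1 1 :: real ^ 3) $ 1" by (rule arg_cong)
    then show False by (simp add: axis_def)
  qed
  then have "infinite (S2 - ?bp)" using \<open>finite ?bp\<close> by simp
  then obtain C where C: "finite C" "card C = card (?I - J)" "C \<subseteq> S2 - ?bp"
    using infinite_arbitrarily_large by blast
  have "finite (?I - J)" using finite_preimage_index by simp
  then obtain e where e: "bij_betw e (?I - J) C" using finite_same_card_bij[of "?I - J" C] C by auto
  define q where "q i = (if i \<in> J then x i else e i)" for i
  have bp_S2: "?bp \<subseteq> S2" unfolding branch_points_def by blast
  have q: "bij_betw q ?I (?bp \<union> C)"
  proof -
    have "bij_betw q J ?bp" using x by (subst bij_betw_cong[of J q x]) (auto simp: q_def)
    moreover have "bij_betw q (?I - J) C" using e by (subst bij_betw_cong[of "?I - J" q e]) (auto simp: q_def)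
    moreover have "?bp \<inter> C = {}" using C(3) by blast
    ultimately have "bij_betw q (J \<union> (?I - J)) (?bp \<union> C)" by (rule bij_betw_combine)
    moreover have "J \<union> (?I - J) = ?I" using J(1) by blast
    ultimately show ?thesis by simp
  qed
  have q_S2: "q i \<in> S2" if "i \<in> ?I" for i using bij_betwE[OF q] that C(3) bp_S2 by blast
  have ldq: "?ld (q i) = ?B i" if i: "i \<in> ?I" for i
  proof (cases "i \<in> J")
    case True
    then show ?thesis using ldx by (simp add: q_def)
  next
    case False
    then have "q i \<in> C" using bij_betwE[OF e] i by (simp add: q_def)
    then have unbr: "q i \<in> S2 - ?bp" using C(3) by blast
    have "card {y \<in> S2. g y = q i} = d'" using g unbr unfolding realizes_def has_degree_def by blast
    then have "?ld (q i) = replicate_mset d' 1"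
      using local_degrees_over_unbranched[OF bg compact_sphere unbr] by simp
    also have "\<dots> = ?B i"
      by (rule trivial_partition_of[OF part_B[OF i], symmetric]) (use False i in \<open>simp add: J_def\<close>)
    finally show ?thesis .
  qed
  let ?I' = "?I - {(2, 1)}"
  have I12: "(1, 1) \<in> ?I" "(2, 1) \<in> ?I" unfolding preimage_index_def by auto
  have I3: "(k, j) \<in> ?I'" if "k \<in> {3..n}" "j \<in> {1..s}" for k j
    using that unfolding preimage_index_def by auto
  \<comment> \<open>The modulus \<open>k\<close> separates the fibres of the power map over different branch points.\<close>
  define t :: "nat \<times> nat \<Rightarrow> complex" where
    "t = (\<lambda>(k, j). if k = 1 then 0 else of_nat k * cis (2 * pi * real j / real s))"
  have norm_t: "norm (t (k, j)) = (if k = 1 then 0 else real k)" for k j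
    by (simp add: t_def norm_mult)
  have I'E: "i = (1, 1) \<or> fst i \<in> {3..n} \<and> snd i \<in> {1..s}" if "i \<in> ?I'" for i
  proof -
    have "i \<in> ?I" "i \<noteq> (2, 1)" using that by auto
    then show ?thesis by (cases rule: preimage_indexE) auto
  qed
  have "inj_on t ?I'"
  proof (rule inj_onI)
    fix i i' assume i: "i \<in> ?I'" "i' \<in> ?I'" "t i = t i'"
    have "norm (t (fst i, snd i)) = norm (t (fst i', snd i'))" using i(3) by simp
    then have eq: "fst i = fst i'"
      unfolding norm_t using I'E[OF i(1)] I'E[OF i(2)] by (auto split: if_splits)
    show "i = i'"
    proof (cases "fst i = 1")
      case True
      then show ?thesis using I'E[OF i(1)] I'E[OF i(2)] eq by auto
    next
      case False
      then have ii: "snd i \<in> {1..s}" "snd i' \<in> {1..s}" "fst i \<noteq> 0"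
        using I'E[OF i(1)] I'E[OF i(2)] eq by auto
      have "of_nat (fst i) * cis (2 * pi * real (snd i) / real s) =
          of_nat (fst i) * cis (2 * pi * real (snd i') / real s)"
        using i(3) False eq unfolding t_def by (simp add: case_prod_beta)
      then have "snd i = snd i'"
        using inj_onD[OF bij_betw_imp_inj_on[OF bij_betw_roots[of "of_nat (fst i)" s]] _ ii(1,2)]
          ii(3) \<open>s > 0\<close> by simp
      then show ?thesis using eq by (simp add: prod_eq_iff)
    qed
  qed
  have inj_q: "inj_on q ?I" using q by (rule bij_betw_imp_inj_on)
  have "q ` ?I' \<subseteq> S2 - {q (2, 1)}"
  proof (rule image_subsetI)
    fix i assume i: "i \<in> ?I'"
    then have "q i \<noteq> q (2, 1)" using inj_onD[OF inj_q _ _ I12(2), of i] by blast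
    then show "q i \<in> S2 - {q (2, 1)}" using q_S2 i by blast
  qed
  then obtain \<sigma> \<tau> where co: "sphere_coordinate (q (2, 1)) \<sigma> \<tau>" and \<sigma>: "\<And>i. i \<in> ?I' \<Longrightarrow> \<sigma> (q i) = t i"
    using sphere_coordinate_through_points[OF q_S2[OF I12(2)] _ inj_on_subset[OF inj_q Diff_subset] _ \<open>inj_on t ?I'\<close>]
      finite_preimage_index by (metis finite_Diff)
  interpret sphere_coordinate "q (2, 1)" \<sigma> \<tau> by (rule co)
  have \<tau>: "\<tau> (t i) = q i" if i: "i \<in> ?I'" for i
  proof -
    have "q i \<noteq> q (2, 1)" using inj_onD[OF inj_q _ _ I12(2), of i] i by blast
    moreover have "q i \<in> S2" using q_S2 i by blast
    ultimately show ?thesis using tau_sigma \<sigma>[OF i] by metis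
  qed
  have "(1, 1) \<in> ?I'" using I12 by simp
  then have Z: "Z = q (1, 1)" using \<tau>[of "(1, 1)"] by (simp add: t_def)
  have q3: "q (k, j) = \<tau> (of_nat k * cis (2 * pi * real j / real s))" if "k \<in> {3..n}" "j \<in> {1..s}" for k j
    using \<tau>[OF I3[OF that]] that by (simp add: t_def)
  let ?f = "\<lambda>u. sphere_power s (g u)"
  let ?ldf = "local_degrees_over S2 S2 ?f"
  have bf: "branched_map S2 S2 ?f" by (rule branched_map_sphere_power(1)[OF bg \<open>s > 0\<close>])
  note pow = local_degrees_over_sphere_power[OF bg \<open>s > 0\<close>]
  define x' where "x' k = (if k = 1 then Z else if k = 2 then q (2, 1) else \<tau> (of_nat k ^ s))" for k :: nat
  have kE: "k = 1 \<or> k = 2 \<or> k \<in> {3..n}" if "k \<in> {1..n}" for k using that by auto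
  have x'_S2: "x' k \<in> S2" for k using q_S2[OF I12(2)] tau(1) by (simp add: x'_def)
  have ldf: "?ldf (x' k) = A k" if "k \<in> {1..n}" for k
    using kE[OF that]
  proof (elim disjE)
    assume "k = 1"
    then show ?thesis using pow(1) ldq[OF I12(1)] A1 Z by (simp add: x'_def preimage_data_def)
  next
    assume "k = 2"
    then show ?thesis using pow(2) ldq[OF I12(2)] A2 by (simp add: x'_def preimage_data_def)
  next
    assume k: "k \<in> {3..n}"
    then have "?ldf (x' k) = (\<Sum>j\<in>{1..s}. ?ld (\<tau> (of_nat k * cis (2 * pi * real j / real s))))"
      using pow(3)[of "of_nat k"] by (simp add: x'_def)
    also have "\<dots> = (\<Sum>j\<in>{1..s}. P k j)"
    proof (rule sum.cong[OF refl])
      fix j assume j: "j \<in> {1..s}"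
      have "?ld (q (k, j)) = ?B (k, j)" using ldq I3[OF k j] by blast
      then show "?ld (\<tau> (of_nat k * cis (2 * pi * real j / real s))) = P k j"
        using k unfolding q3[OF k j] by (simp add: preimage_data_def)
    qed
    also have "\<dots> = A k" using dec[OF k] unfolding decomposition_def by simp
    finally show ?thesis .
  qed
  have "inj_on x' {1..n}"
  proof (rule inj_onI)
    fix k l assume k: "k \<in> {1..n}" and l: "l \<in> {1..n}" and eq: "x' k = x' l"
    have pole: "x' k = q (2, 1) \<longleftrightarrow> k = 2" for k
      using tau(2)[of 0] tau(2)[of "of_nat k ^ s"] unfolding x'_def by auto
    have norm: "norm (\<sigma> (x' k)) = (if k = 1 then 0 else real k ^ s)" if "k \<noteq> 2" for k
      using that by (simp add: x'_def norm_power)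
    show "k = l"
    proof (cases "k = 2")
      case True
      then show ?thesis using pole eq by metis
    next
      case False
      then have "l \<noteq> 2" using pole eq by metis
      then have "(if k = 1 then 0 else real k ^ s) = (if l = 1 then 0 else real l ^ s)"
        using norm[OF False] norm[of l] eq by simp
      then show ?thesis using k l \<open>s > 0\<close> by (auto split: if_splits simp: power_eq_iff_eq_base)
    qed
  qed
  then have data_x': "image_mset ?ldf (mset_set (x' ` {1..n})) = image_mset A (mset_set {1..n})"
    using ldf by (auto simp flip: image_mset_mset_set simp: image_mset.compositionality comp_def intro!: image_mset_cong)
  have "branch_points S2 S2 ?f \<subseteq> x' ` {1..n}"
  proof
    fix p assume "p \<in> branch_points S2 S2 ?f"
    then obtain y where y: "y \<in> S2" "?f y = p" "local_degree S2 S2 ?f y > 1"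
      unfolding branch_points_def by blast
    have gy: "g y \<in> S2" using bg y(1) unfolding branched_map_def by blast
    show "p \<in> x' ` {1..n}"
    proof (cases "g y \<in> {Z, q (2, 1)}")
      case True
      then have "p = Z \<or> p = q (2, 1)"
        using sphere_power_eq_Z_iff[OF gy \<open>s > 0\<close>] sphere_power_eq_N_iff[of s "g y"]
        unfolding y(2) by blast
      moreover have "x' 1 = Z" "x' 2 = q (2, 1)" by (simp_all add: x'_def)
      ultimately have "p = x' 1 \<or> p = x' 2" by metis
      then show ?thesis using in12 by blast
    next
      case False
      then have "local_degree S2 S2 g y > 1"
        using branched_map_sphere_power(2)[OF bg \<open>s > 0\<close> y(1)] y(3) by simp
      then have "g y \<in> ?bp" unfolding branch_points_def using y(1) gy by blast
      then obtain i where i: "i \<in> ?I" "g y = q i" using q unfolding bij_betw_def by blast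
      show ?thesis using i(1)
      proof (cases rule: preimage_indexE)
        case (3 k j)
        have "p = sphere_power s (\<tau> (of_nat k * cis (2 * pi * real j / real s)))"
          using y(2) i(2) q3[OF 3(2,3)] 3(1) by simp
        also have "\<dots> = \<tau> (of_nat k ^ s)"
          using bij_betwE[OF bij_betw_sphere_power_fibre[of "of_nat k" s]] 3(2,3) \<open>s > 0\<close> by simp
        also have "\<dots> = x' k" using 3(2) by (simp add: x'_def)
        finally show ?thesis using 3(2) by auto
      next
        case 1
        have "g y = Z" unfolding i(2) 1 Z ..
        then show ?thesis using False by blast
      next
        case 2
        then show ?thesis using False i(2) by blast
      qed
    qed
  qed
  moreover have "finite (x' ` {1..n})" "x' ` {1..n} \<subseteq> S2" using x'_S2 by auto
  ultimately have data_f: "branching_data S2 S2 ?f = filter_mset nontrivial (image_mset A (mset_set {1..n}))"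
    using branching_data_eq[OF bf compact_sphere, of "x' ` {1..n}"] unfolding data_x' by blast
  have conn: "connected S2" by (rule connected_sphere) simp
  have "sum_mset (?ldf (x' 1)) = s * d'" unfolding ldf[OF in12(1)] using A[OF in12(1)] unfolding partition_of_def by blast
  then have part: "partition_of (s * d') (?ldf p)" if "p \<in> S2" for p
    by (rule partition_of_local_degrees_over[OF bf compact_sphere conn x'_S2 that])
  have "s * d' > 0" using assms(1,2) by simp
  then have "realizes S2 S2 ?f (s * d') (image_mset A (mset_set {1..n}))"
    unfolding realizes_def
    by (intro conjI data_f has_degree_if_partition_of[OF bf compact_sphere part]
      branched_cover_if_partition_of[OF bf compact_sphere part])
  then show ?thesis by (rule exI[of _ ?f])
qed

theorem theorem1p1:
  fixes s d' n :: nat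
    and a1 a2 :: "nat multiset"
    and A :: "nat \<Rightarrow> nat multiset"
  assumes "s \<ge> 2" and "d' \<ge> 1" and "n \<ge> 3"
    and "\<And>k. k \<in> {1..n} \<Longrightarrow> partition_of (s * d') (A k) \<and> nontrivial (A k)"
    and "A 1 = image_mset (\<lambda>a. s * a) a1"
    and "A 2 = image_mset (\<lambda>a. s * a) a2"
    and Riemann_Hurwitz: "(\<Sum>k\<in>{1..n}. size (A k)) = s * (n - 2) * d' + 2"
  shows "(\<exists>f. realizes S2 S2 f (s * d') (image_mset A (mset_set {1..n})))
    \<longleftrightarrow>
    (\<exists>P :: nat \<Rightarrow> nat \<Rightarrow> nat multiset.
       (\<forall>k\<in>{3..n}. decomposition s d' (A k) (P k)) \<and>
       (\<exists>g. realizes S2 S2 g d'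
          ({#a1, a2#} + image_mset (\<lambda>(k, j). P k j) (mset_set ({3..n} \<times> {1..s})))))"
    (is "?lhs \<longleftrightarrow> ?rhs")
proof -
  have pos: "s > 0" "d' > 0" "n \<ge> 2" using assms(1-3) by auto
  show ?thesis
  proof
    assume ?lhs
    then obtain f where f: "realizes S2 S2 f (s * d') (image_mset A (mset_set {1..n}))" by (rule exE)
    show ?rhs by (rule realization_descends[OF pos assms(4-6) f])
  next
    assume ?rhs
    then obtain P g where P: "\<forall>k\<in>{3..n}. decomposition s d' (A k) (P k)"
      and g: "realizes S2 S2 g d'
          ({#a1, a2#} + image_mset (\<lambda>(k, j). P k j) (mset_set ({3..n} \<times> {1..s})))"
      by (elim exE conjE)
    show ?lhs by (rule realization_composes[OF pos(1,2) assms(3-6) bspec[OF P] g])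
  qed
qed

end
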